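(* Let $J$ be a finite set and let $\{\xi_i; i\in J\}$ be square integrable real random variables on a common probability space with $\mathbb{E}\xi_i=0$ for all $i\in J$, and suppose there are numbers $a_i\in\mathbb{R}$, $i\in J$, such that almost surely $\xi_i\in\mathbb{Z}+a_i$. Let $W=\sum_{i\in J}\xi_i$, $a=\sum_{i\in J}a_i$, and assume $\sigma^2:=\mathrm{Var}\,W>1$. Put $\delta:=\langle -4\sigma^2\rangle$ and $t:=\langle a+2\sigma^2+\delta/2\rangle/(4\sigma^2+\delta)$. For $A\subset J$ write $\xi_A=\{\xi_i;i\in A\}$. Assume that for every $i\in J$ there are subsets $A_i\subset B_i\subset J$ such that $\xi_i$ is independent of $\xi_{A_i^c}$, and $\xi_{A_i}$ is independent of $\xi_{B_i^c}$. Define $\eta_i=\sum_{j\in A_i}\xi_j$ and $\tau_i=\sum_{j\in B_i}\xi_j$. Then, for $l=1,2$, $$d_l\bigl(\mathscr{L}(W),\widehat{\mathrm{Bi}}(\lceil 4\sigma^2\rceil,1/2-t)\bigr)\le \sigma^{-2}\Bigl(\sum_{i\in J}\vartheta_{l,i}+1.75\Bigr),$$ where $$\vartheta_{l,i}=\tfrac12\mathbb{E}\bigl\{|\xi_i|\eta_i^2 D^l(\mathscr{L}(W\mid \xi_i,\eta_i))\bigr\}+\mathbb{E}\bigl\{|\xi_i\eta_i(\tau_i-\eta_i)|D^l(\mathscr{L}(W\mid\xi_i,\eta_i,\tau_i))\bigr\}+|\mathbb{E}\xi_i\eta_i|\,\mathbb{E}\bigl\{|\tau_i|D^l(\mathscr{L}(W\mid\tau_i))\bigr\}.$$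 If further there are constants $c_{l,i}$ such that almost surely $D^l(\mathscr{L}(W\mid \xi_{B_i}))\le c_{l,i}$, then $$\vartheta_{l,i}\le c_{l,i}\bigl(\tfrac12\mathbb{E}|\xi_i\eta_i^2|+\mathbb{E}|\xi_i\eta_i(\tau_i-\eta_i)|+|\mathbb{E}\xi_i\eta_i|\,\mathbb{E}|\tau_i|\bigr).$$
   Context: $\langle x\rangle=x-\lfloor x\rfloor$ is the fractional part of $x\in\mathbb{R}$. $\mathscr{L}(X)$ is the law of $X$, and $\mathscr{L}(X\mid Y)$ the (regular) conditional law of $X$ given $Y$. $\mathrm{Bi}(n,p)$ is the binomial distribution with $n$ trials and success probability $p$; $\widehat{\mathrm{Bi}}(n,p)$ is the centered binomial distribution, i.e. $\mathrm{Bi}(n,p)$ shifted by $-np$ (a distribution on $\mathbb{Z}-np$). For probability distributions $P,Q$ on $\mathbb{R}$, $d_1(P,Q)=d_{\mathrm{TV}}(P,Q)=\sup_{A\subset\mathbb{R}}|P(A)-Q(A)|$ (measurable $A$) and $d_2(P,Q)=d_{\mathrm{loc}}(P,Q)=\sup_{x\in\mathbb{R}}|P([x,x+1))-Q([x,x+1))|$. For a measure $\mu$ on $\mathbb{R}$ and $l\in\{1,2,\dots\}$, $D^l(\mu)=\|\mu*(\delta_1-\delta_0)^{*l}\|$, where $*$ is convolution, $\delta_x$ is the unit mass at $x$, and $\|\cdot\|$ is the variation norm (total mass of the total variation measure, so that $D^1(\mu)=2d_{\mathrm{TV}}(\mu,\mu*\delta_1)$ for probability measures $\mu$). Complements $A_i^c,B_i^c$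 are taken in $J$. *)

theory Defs
  imports "HOL-Probability.Probability"
begin

text \<open>
  A regular conditional law of \<open>X\<close> given \<open>Y\<close> is indexed by the points of the sample space and
  measurable with respect to the sigma-algebra generated by \<open>Y\<close>.
\<close>

definition is_cond_law ::
  "'w measure \<Rightarrow> 'w measure \<Rightarrow> ('w \<Rightarrow> real) \<Rightarrow> ('w \<Rightarrow> real measure) \<Rightarrow> bool" where
  "is_cond_law M F X K \<longleftrightarrow>
     K \<in> F \<rightarrow>\<^sub>M prob_algebra borel \<and>
     (\<forall>A \<in> sets borel. AE \<omega> in M.
        measure (K \<omega>) A = real_cond_exp M F (\<lambda>\<omega>. indicator A (X \<omega>)) \<omega>)"

definition cond_law ::
  "'w measure \<Rightarrow> 'b measure \<Rightarrow> ('w \<Rightarrow> 'b) \<Rightarrow> ('w \<Rightarrow> real) \<Rightarrow> 'w \<Rightarrow> real measure" where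
  "cond_law M N Y X = (SOME K. is_cond_law M (vimage_algebra (space M) Y N) X K)"

text \<open>
  The following facts show that the choice in the definition of \<open>cond_law\<close> is legitimate: a version
  exists, and any two versions agree almost surely.
\<close>

lemma real_cond_exp_LIMSEQ_antimono:
  fixes f :: "nat \<Rightarrow> 'w \<Rightarrow> real"
  assumes "prob_space M" and F: "subalgebra M F"
    and f[measurable]: "\<And>n. f n \<in> borel_measurable M" and g[measurable]: "g \<in> borel_measurable M"
    and bd: "\<And>n x. \<bar>f n x\<bar> \<le> 1"
    and anti: "\<And>x. antimono (\<lambda>n. f n x)"
    and lim: "\<And>x. (\<lambda>n. f n x) \<longlonglongrightarrow> g x"
  shows "AE x in M. (\<lambda>n. real_cond_exp M F (f n) x) \<longlonglongrightarrow> real_cond_exp M F g x"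
proof -
  interpret prob_space M by fact
  interpret finite_measure_subalgebra M F by standard (rule F)
  have bdg: "\<bar>g x\<bar> \<le> 1" for x
    by (rule LIMSEQ_le_const2[OF tendsto_rabs[OF lim]]) (use bd in auto)
  have int[simp]: "integrable M (f n)" for n
    by (rule integrable_const_bound[where B=1]) (use bd in auto)
  have intg[simp]: "integrable M g"
    by (rule integrable_const_bound[where B=1]) (use bdg in auto)
  let ?h = "\<lambda>n. real_cond_exp M F (f n)" and ?k = "real_cond_exp M F g"
  have dec: "AE x in M. \<forall>n. ?h (Suc n) x \<le> ?h n x"
    unfolding AE_all_countable using anti
    by (intro allI real_cond_exp_mono) (auto simp: antimono_def)
  have gle: "g x \<le> f n x" for n x
    by (rule decseq_ge[OF _ lim]) (use anti in auto)
  have low: "AE x in M. \<forall>n. ?k x \<le> ?h n x"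
    unfolding AE_all_countable by (intro allI real_cond_exp_mono) (auto simp: gle)
  have up: "AE x in M. \<forall>n. \<bar>?h n x\<bar> \<le> 1"
    unfolding AE_all_countable
  proof
    fix n
    have "AE x in M. ?h n x \<le> 1"
      by (rule real_cond_exp_le_c) (use bd[of n] in \<open>auto simp: abs_le_iff\<close>)
    moreover have "AE x in M. ?h n x \<ge> -1"
      by (rule real_cond_exp_ge_c) (use bd[of n] in \<open>auto simp: abs_le_iff minus_le_iff\<close>)
    ultimately show "AE x in M. \<bar>?h n x\<bar> \<le> 1" by eventually_elim auto
  qed
  define L where "L = (\<lambda>x. lim (\<lambda>n. ?h n x))"
  have Lm[measurable]: "L \<in> borel_measurable M" unfolding L_def by measurable
  have conv: "AE x in M. (\<lambda>n. ?h n x) \<longlonglongrightarrow> L x"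
    using dec low up
  proof eventually_elim
    case (elim x)
    have "decseq (\<lambda>n. ?h n x)" using elim(1) by (auto simp: decseq_Suc_iff)
    then have "convergent (\<lambda>n. ?h n x)"
      using elim(2) by (metis decseq_convergent convergentI)
    then show ?case unfolding L_def by (simp add: convergent_LIMSEQ_iff)
  qed
  have hm: "?h n \<in> borel_measurable M" for n by simp
  have up': "AE x in M. norm (?h n x) \<le> 1" for n
    using up by eventually_elim auto
  have c1: "(\<lambda>n. \<integral>x. ?h n x \<partial>M) \<longlonglongrightarrow> (\<integral>x. L x \<partial>M)"
    by (rule integral_dominated_convergence[where w="\<lambda>_. 1"])
      (use conv up' in auto)
  have iL: "integrable M L"
    by (rule integrable_dominated_convergence[where w="\<lambda>_. 1" and s="?h"])
      (use conv up' in auto)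
  have c2: "(\<lambda>n. \<integral>x. f n x \<partial>M) \<longlonglongrightarrow> (\<integral>x. g x \<partial>M)"
    by (rule integral_dominated_convergence[where w="\<lambda>_. 1"]) (use lim bd in auto)
  have "(\<integral>x. ?h n x \<partial>M) = (\<integral>x. f n x \<partial>M)" for n by (rule real_cond_exp_int) simp
  then have eq: "(\<integral>x. L x \<partial>M) = (\<integral>x. ?k x \<partial>M)"
    using c1 c2 real_cond_exp_int(2)[OF intg] by (auto dest: LIMSEQ_unique)
  have le: "AE x in M. ?k x \<le> L x"
    using conv low by eventually_elim (rule LIMSEQ_le_const, auto)
  have "AE x in M. L x - ?k x = 0"
    by (subst integral_nonneg_eq_0_iff_AE[symmetric])
      (use le eq iL real_cond_exp_int(1)[OF intg] in \<open>auto elim!: eventually_mono\<close>)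
  with conv show ?thesis by eventually_elim auto
qed

lemma is_cond_law_exists:
  assumes "prob_space M" and F: "subalgebra M F" and X[measurable]: "X \<in> borel_measurable M"
  shows "\<exists>K. is_cond_law M F X K"
proof -
  interpret prob_space M by fact
  interpret finite_measure_subalgebra M F by standard (rule F)
  have spF: "space F = space M" using F by (auto simp: subalgebra_def)
  define e where "e = (\<lambda>A. real_cond_exp M F (\<lambda>\<omega>. indicator A (X \<omega>)))"
  have eF[measurable]: "e A \<in> borel_measurable F" for A unfolding e_def by simp
  have ind[measurable]: "A \<in> sets borel \<Longrightarrow> (\<lambda>\<omega>. indicator A (X \<omega>) :: real) \<in> borel_measurable M" for A
    using X by (rule measurable_compose[OF _ borel_measurable_indicator])
  have iind: "A \<in> sets borel \<Longrightarrow> integrable M (\<lambda>\<omega>. indicator A (X \<omega>) :: real)" for A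
    by (rule integrable_const_bound[where B=1]) (auto simp: indicator_def)
  define g where "g = (\<lambda>q::rat. e {..of_rat q})"
  have gF[measurable]: "g q \<in> borel_measurable F" for q unfolding g_def by simp

  have e_dec: "AE \<omega> in M. (\<lambda>n. e (A n) \<omega>) \<longlonglongrightarrow> e (\<Inter>n. A n) \<omega>"
    if "\<And>n. A n \<in> sets borel" "decseq A" for A
    unfolding e_def
  proof (rule real_cond_exp_LIMSEQ_antimono[OF \<open>prob_space M\<close> F])
    show "(\<lambda>n. indicator (A n) (X x)) \<longlonglongrightarrow> (indicator (\<Inter>n. A n) (X x) :: real)" for x
      using that(2) by (rule LIMSEQ_indicator_decseq)
    show "antimono (\<lambda>n. indicator (A n) (X x) :: real)" for x
      using that(2) by (auto simp: decseq_def antimono_def indicator_def)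
  qed (use that in \<open>auto simp: indicator_def\<close>)
  have e_compl: "AE \<omega> in M. e (- A) \<omega> = 1 - e A \<omega>" if "A \<in> sets borel" for A
  proof -
    have "AE \<omega> in M. real_cond_exp M F (\<lambda>\<omega>. 1 - indicator A (X \<omega>)) \<omega>
        = real_cond_exp M F (\<lambda>\<omega>. 1) \<omega> - e A \<omega>"
      unfolding e_def using that by (intro real_cond_exp_diff iind) auto
    moreover have "AE \<omega> in M. real_cond_exp M F (\<lambda>\<omega>. 1) \<omega> = 1"
      by (rule real_cond_exp_F_meas) auto
    ultimately have "AE \<omega> in M. real_cond_exp M F (\<lambda>\<omega>. 1 - indicator A (X \<omega>)) \<omega> = 1 - e A \<omega>"
      by eventually_elim simp
    moreover have "(\<lambda>\<omega>. 1 - indicator A (X \<omega>) :: real) = (\<lambda>\<omega>. indicator (- A) (X \<omega>))"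
      by (auto simp: indicator_def)
    ultimately show ?thesis unfolding e_def by simp
  qed
  have e_empty: "AE \<omega> in M. e {} \<omega> = 0"
    unfolding e_def using real_cond_exp_F_meas[of "\<lambda>_. 0"] by auto
  have e_mono: "AE \<omega> in M. e A \<omega> \<le> e B \<omega>" if "A \<subseteq> B" "A \<in> sets borel" "B \<in> sets borel" for A B
    unfolding e_def using that by (intro real_cond_exp_mono iind) (auto simp: indicator_def)

  define good where "good \<omega> \<longleftrightarrow> (\<forall>q r. q \<le> r \<longrightarrow> g q \<omega> \<le> g r \<omega>) \<and> (\<forall>q. 0 \<le> g q \<omega>) \<and>
    (\<forall>q. g q \<omega> \<le> 1) \<and> (\<forall>k::nat. \<exists>n::nat. 1 - g (of_nat n) \<omega> < 1 / real (Suc k)) \<and>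
    (\<forall>k::nat. \<exists>n::nat. g (- of_nat n) \<omega> < 1 / real (Suc k))" for \<omega>
  have good_meas[measurable]: "Measurable.pred F good"
    unfolding good_def by measurable
  have AE_good: "AE \<omega> in M. good \<omega>"
  proof -
    have 1: "AE \<omega> in M. \<forall>q r. q \<le> r \<longrightarrow> g q \<omega> \<le> g r \<omega>"
      unfolding AE_all_countable
    proof (intro allI)
      fix q r show "AE \<omega> in M. q \<le> r \<longrightarrow> g q \<omega> \<le> g r \<omega>"
      proof (cases "q \<le> r")
        case True
        have "AE \<omega> in M. g q \<omega> \<le> g r \<omega>" unfolding g_def using True
          by (intro e_mono) (auto simp: of_rat_less_eq intro: order_trans)
        then show ?thesis by simp
      qed simp
    qed
    have 2: "AE \<omega> in M. \<forall>q. 0 \<le> g q \<omega>"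
      unfolding AE_all_countable g_def e_def by (intro allI real_cond_exp_pos) auto
    have 3: "AE \<omega> in M. \<forall>q. g q \<omega> \<le> 1"
      unfolding AE_all_countable g_def e_def
      by (intro allI real_cond_exp_le_c iind) (auto simp: indicator_def)
    have i0: "(\<Inter>n. - {..real n}) = {}"
      using real_arch_simple by (force simp: not_le[symmetric])
    have "AE \<omega> in M. (\<lambda>n. e (- {..real n}) \<omega>) \<longlonglongrightarrow> e (\<Inter>n. - {..real n}) \<omega>"
      by (rule e_dec) (auto simp: decseq_def)
    moreover have "AE \<omega> in M. \<forall>n. e (- {..real n}) \<omega> = 1 - g (of_nat n) \<omega>"
      unfolding AE_all_countable g_def of_rat_of_nat_eq by (intro allI e_compl) simp
    ultimately have 4: "AE \<omega> in M. (\<lambda>n. 1 - g (of_nat n) \<omega>) \<longlonglongrightarrow> 0"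
      using e_empty by eventually_elim (simp only: i0)
    have i1: "(\<Inter>n. {..- real n}) = {}"
    proof (rule equals0I)
      fix y assume y: "y \<in> (\<Inter>n. {..- real n})"
      obtain n where "- y < real n" using reals_Archimedean2 by blast
      moreover have "y \<le> - real n" using y by simp
      ultimately show False by simp
    qed
    have "AE \<omega> in M. (\<lambda>n. e ({..- real n}) \<omega>) \<longlonglongrightarrow> e (\<Inter>n. {..- real n}) \<omega>"
      by (rule e_dec) (auto simp: decseq_def)
    then have 5: "AE \<omega> in M. (\<lambda>n. g (- of_nat n) \<omega>) \<longlonglongrightarrow> 0"
      using e_empty unfolding g_def by eventually_elim (simp add: of_rat_minus i1)
    have small: "\<exists>n. f n < 1 / real (Suc k)" if "f \<longlonglongrightarrow> 0" for f :: "nat \<Rightarrow> real" and k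
      using order_tendstoD(2)[OF that, of "1 / real (Suc k)"]
      by (auto simp: eventually_sequentially)
    show ?thesis using 1 2 3 4 5 unfolding good_def
      by eventually_elim (auto intro!: small simp del: of_nat_Suc)
  qed

  define c where "c \<omega> x = (INF q\<in>{q. x < of_rat q}. g q \<omega>)" for \<omega> and x :: real
  have ne: "{q. x < of_rat q} \<noteq> {}" for x :: real
    using of_rat_dense[of x "x+1"] by auto
  have c_le: "c \<omega> x \<le> g q \<omega>" if "good \<omega>" "x < of_rat q" for \<omega> x q
    unfolding c_def using that by (intro cINF_lower bdd_belowI2[where m=0]) (auto simp: good_def)
  have c_ge: "b \<le> c \<omega> x" if "\<And>q. x < of_rat q \<Longrightarrow> b \<le> g q \<omega>" for \<omega> x b
    unfolding c_def using that ne by (intro cINF_greatest) auto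
  have c_lt: "\<exists>q. x < of_rat q \<and> g q \<omega> < b" if "c \<omega> x < b" for \<omega> x b
  proof (rule ccontr)
    assume "\<not> ?thesis"
    then have "b \<le> c \<omega> x" by (intro c_ge) (meson not_less)
    with that show False by simp
  qed
  have rd: "real_distribution (interval_measure (c \<omega>))"
    and cdf: "cdf (interval_measure (c \<omega>)) = c \<omega>" if G: "good \<omega>" for \<omega>
  proof -
    have mono: "x \<le> y \<Longrightarrow> c \<omega> x \<le> c \<omega> y" for x y
      by (rule c_ge) (rule c_le[OF G], simp)
    have c1: "c \<omega> x \<le> 1" for x
    proof -
      obtain q where "x < of_rat q" using ne[of x] by auto
      from c_le[OF G this] show ?thesis using G unfolding good_def by (meson order_trans)
    qed
    have c0: "0 \<le> c \<omega> x" for x using G by (intro c_ge) (auto simp: good_def)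
    have rc: "continuous (at_right x) (c \<omega>)" for x
      unfolding continuous_within
    proof (rule order_tendstoI)
      fix b assume "b < c \<omega> x"
      then have "b < c \<omega> y" if "x < y" for y using mono[of x y] that by simp
      then show "\<forall>\<^sub>F y in at_right x. b < c \<omega> y"
        by (auto simp: eventually_at_right_field intro!: exI[of _ "x+1"])
    next
      fix b assume "c \<omega> x < b"
      then obtain q where q: "x < of_rat q" "g q \<omega> < b" using c_lt by blast
      then have "c \<omega> y < b" if "y < of_rat q" for y using c_le[OF G that] by simp
      then show "\<forall>\<^sub>F y in at_right x. c \<omega> y < b"
        using q by (auto simp: eventually_at_right_field intro!: exI[of _ "of_rat q"])
    qed
    have top: "(c \<omega> \<longlongrightarrow> 1) at_top"
    proof (rule order_tendstoI)
      fix b :: real assume "b < 1"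
      then obtain k where k: "1 / real (Suc k) < 1 - b" using nat_approx_posE[of "1-b"] by auto
      obtain n where n: "1 - g (of_nat n) \<omega> < 1 / real (Suc k)" using G unfolding good_def by blast
      have "b < c \<omega> y" if "real n \<le> y" for y
      proof -
        have "g (of_nat n) \<omega> \<le> c \<omega> y"
        proof (rule c_ge)
          fix q assume "y < of_rat q"
          then have "of_rat (of_nat n) \<le> (of_rat q :: real)" using that by simp
          then have "of_nat n \<le> q" by (simp only: of_rat_less_eq)
          then show "g (of_nat n) \<omega> \<le> g q \<omega>" using G unfolding good_def by blast
        qed
        then show ?thesis using n k by linarith
      qed
      then show "\<forall>\<^sub>F y in at_top. b < c \<omega> y" by (auto simp: eventually_at_top_linorder)
    next
      fix b :: real assume "1 < b"
      then show "\<forall>\<^sub>F y in at_top. c \<omega> y < b"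
        using c1 by (intro always_eventually allI) (rule le_less_trans)
    qed
    have bot: "(c \<omega> \<longlongrightarrow> 0) at_bot"
    proof (rule order_tendstoI)
      fix b :: real assume "b < 0"
      then show "\<forall>\<^sub>F y in at_bot. b < c \<omega> y"
        using c0 by (intro always_eventually allI) (rule less_le_trans)
    next
      fix b :: real assume "0 < b"
      then obtain k where k: "1 / real (Suc k) < b" using nat_approx_posE by blast
      obtain n where n: "g (- of_nat n) \<omega> < 1 / real (Suc k)" using G unfolding good_def by blast
      have "c \<omega> y < b" if "y \<le> - real n - 1" for y
        using c_le[OF G, of y "- of_nat n"] that n k by (simp add: of_rat_minus)
      then show "\<forall>\<^sub>F y in at_bot. c \<omega> y < b" by (auto simp: eventually_at_bot_linorder)
    qed
    show "real_distribution (interval_measure (c \<omega>))"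
      by (rule real_distribution_interval_measure) (use mono rc top bot in auto)
    show "cdf (interval_measure (c \<omega>)) = c \<omega>"
      by (rule cdf_interval_measure) (use mono rc top bot in auto)
  qed
  define K where "K \<omega> = (if good \<omega> then interval_measure (c \<omega>) else return borel 0)" for \<omega>
  have KP: "prob_space (K \<omega>)" and KS: "sets (K \<omega>) = sets borel" for \<omega>
    using rd[of \<omega>] by (auto simp: K_def real_distribution_def prob_space_return)
  have Kx: "measure (K \<omega>) {..x} = (if good \<omega> then c \<omega> x else indicator {..x} 0)" for \<omega> x
    using cdf[of \<omega>] by (auto simp: K_def cdf_def fun_eq_iff measure_return)
  have cF: "(\<lambda>\<omega>. if good \<omega> then c \<omega> x else indicator {..x} 0) \<in> borel_measurable F" for x
  proof -
    have "(\<lambda>\<omega>. INF q\<in>{q. x < of_rat q}. if good \<omega> then g q \<omega> else 0) \<in> borel_measurable F"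
      by (rule borel_measurable_cINF) (auto intro!: bdd_belowI2[where m=0] simp: good_def)
    then have "(\<lambda>\<omega>. if good \<omega> then (INF q\<in>{q. x < of_rat q}. if good \<omega> then g q \<omega> else 0) else indicator {..x} 0) \<in> borel_measurable F"
      by measurable
    also have "(\<lambda>\<omega>. if good \<omega> then (INF q\<in>{q. x < of_rat q}. if good \<omega> then g q \<omega> else 0) else indicator {..x} 0) = (\<lambda>\<omega>. if good \<omega> then c \<omega> x else indicator {..x} 0)"
      by (auto simp: c_def fun_eq_iff)
    finally show ?thesis .
  qed
  have borel_gen: "sets (borel :: real measure) = sigma_sets UNIV (range atMost)"
    by (simp add: borel_eq_atMost)
  have stable: "Int_stable (range (atMost :: real \<Rightarrow> real set))"
    by (auto simp: Int_stable_def)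
  have pow: "range (atMost :: real \<Rightarrow> real set) \<subseteq> Pow UNIV" by simp
  have KM: "K \<in> F \<rightarrow>\<^sub>M prob_algebra borel"
  proof (rule measurable_prob_algebra_generated[OF borel_gen stable])
    fix A :: "real set" assume "A \<in> range atMost"
    then obtain x where A: "A = {..x}" by auto
    have "emeasure (K \<omega>) A = ennreal (if good \<omega> then c \<omega> x else indicator {..x} 0)" for \<omega>
    proof -
      interpret K: prob_space "K \<omega>" by (rule KP)
      show ?thesis unfolding A K.emeasure_eq_measure Kx ..
    qed
    then show "(\<lambda>\<omega>. emeasure (K \<omega>) A) \<in> borel_measurable F" using cF by simp
  qed (use KP KS in auto)
  have "AE \<omega> in M. measure (K \<omega>) A = e A \<omega>" if "A \<in> sets borel" for A
    using stable pow that[unfolded borel_gen]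
  proof (induction rule: sigma_sets_induct_disjoint)
    case (basic A)
    then obtain x where A: "A = {..x}" by auto
    have "\<exists>q. x < of_rat q \<and> of_rat q < x + 1 / real (Suc n)" for n
      using of_rat_dense[of x "x + 1 / real (Suc n)"] by auto
    then obtain q0 where q0: "\<And>n. x < of_rat (q0 n)" "\<And>n. of_rat (q0 n) < x + 1 / real (Suc n)" by metis
    define q where "q n = Min (q0 ` {..n})" for n
    have qx: "x < of_rat (q n)" for n
    proof -
      have "q n \<in> q0 ` {..n}" unfolding q_def by (rule Min_in) auto
      then show ?thesis using q0(1) by auto
    qed
    have qdec: "m \<le> n \<Longrightarrow> q n \<le> q m" for m n unfolding q_def by (intro Min_antimono) auto
    have qup: "of_rat (q n) < x + 1 / real (Suc n)" for n
    proof -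
      have "q n \<le> q0 n" unfolding q_def by simp
      then have "of_rat (q n) \<le> (of_rat (q0 n) :: real)" by (simp only: of_rat_less_eq)
      with q0(2)[of n] show ?thesis by simp
    qed
    have "AE \<omega> in M. (\<lambda>n. e {..of_rat (q n)} \<omega>) \<longlonglongrightarrow> e (\<Inter>n. {..of_rat (q n)}) \<omega>"
      by (rule e_dec) (auto simp: decseq_def qdec of_rat_less_eq intro: order_trans)
    moreover have "(\<Inter>n. {..of_rat (q n)}) = {..x}"
    proof (intro equalityI subsetI)
      fix y :: real assume y: "y \<in> (\<Inter>n. {..of_rat (q n)})"
      have "y \<le> x"
      proof (rule ccontr)
        assume "\<not> y \<le> x"
        then obtain n where "1 / real (Suc n) < y - x" using nat_approx_posE[of "y-x"] by auto
        moreover have "y \<le> of_rat (q n)" using y by simp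
        ultimately show False using qup[of n] by linarith
      qed
      then show "y \<in> {..x}" by simp
    next
      fix y assume "y \<in> {..x}"
      then show "y \<in> (\<Inter>n. {..of_rat (q n)})" using qx by (auto intro: order_trans less_imp_le)
    qed
    ultimately have "AE \<omega> in M. (\<lambda>n. g (q n) \<omega>) \<longlonglongrightarrow> e {..x} \<omega>" by (simp add: g_def)
    with AE_good show ?case
    proof eventually_elim
      case (elim \<omega>)
      have "(\<lambda>n. g (q n) \<omega>) \<longlonglongrightarrow> c \<omega> x"
      proof (rule order_tendstoI)
        fix b assume "b < c \<omega> x"
        then show "\<forall>\<^sub>F n in sequentially. b < g (q n) \<omega>"
          using c_le[OF elim(1) qx] by (intro always_eventually allI) (rule less_le_trans)
      next
        fix b assume "c \<omega> x < b"
        then obtain r where r: "x < of_rat r" "g r \<omega> < b" using c_lt by blast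
        then obtain N where N: "1 / real (Suc N) < of_rat r - x" using nat_approx_posE[of "of_rat r - x"] by auto
        have "g (q n) \<omega> < b" if "N \<le> n" for n
        proof -
          have "(of_rat (q N) :: real) \<le> of_rat r" using qup[of N] N by linarith
          then have "q N \<le> r" by (simp only: of_rat_less_eq)
          then have "q n \<le> r" using qdec[OF that] by simp
          then have "g (q n) \<omega> \<le> g r \<omega>" using elim(1) unfolding good_def by blast
          with r show ?thesis by simp
        qed
        then show "\<forall>\<^sub>F n in sequentially. g (q n) \<omega> < b" by (auto simp: eventually_sequentially)
      qed
      then have "c \<omega> x = e {..x} \<omega>" using elim(2) LIMSEQ_unique by blast
      then show ?case using elim(1) by (simp add: A Kx)
    qed
  next
    case empty
    show ?case using e_empty by eventually_elim simp
  next
    case (compl A)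
    then have A: "A \<in> sets borel" by (simp add: borel_gen)
    have m: "measure (K \<omega>) (UNIV - A) = 1 - measure (K \<omega>) A" for \<omega>
      using prob_space.prob_compl[OF KP, of A \<omega>] A KS sets_eq_imp_space_eq[OF KS] by simp
    have "AE \<omega> in M. e (UNIV - A) \<omega> = 1 - e A \<omega>"
      using e_compl[OF A] by (simp add: Compl_eq_Diff_UNIV)
    then show ?case using compl.IH by eventually_elim (simp add: m)
  next
    case (union A)
    then have A: "A i \<in> sets borel" for i by (auto simp: borel_gen)
    let ?U = "\<lambda>n. \<Union>i<n. A i"
    have mK: "measure (K \<omega>) (?U n) = (\<Sum>i<n. measure (K \<omega>) (A i))" for \<omega> n
    proof -
      interpret K: prob_space "K \<omega>" by (rule KP)
      show ?thesis using union(1) A KS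
        by (intro K.finite_measure_finite_Union) (auto simp: disjoint_family_on_def)
    qed
    have eU: "AE \<omega> in M. \<forall>n. e (?U n) \<omega> = (\<Sum>i<n. e (A i) \<omega>)"
      unfolding AE_all_countable
    proof
      fix n
      have "AE \<omega> in M. real_cond_exp M F (\<lambda>x. \<Sum>i<n. indicator (A i) (X x)) \<omega> = (\<Sum>i<n. e (A i) \<omega>)"
        unfolding e_def using A by (intro real_cond_exp_sum iind)
      moreover have "(\<lambda>x. \<Sum>i<n. indicator (A i) (X x) :: real) = (\<lambda>x. indicator (?U n) (X x))"
        using union(1)
        by (subst indicator_UN_disjoint) (auto simp: disjoint_family_on_def)
      ultimately show "AE \<omega> in M. e (?U n) \<omega> = (\<Sum>i<n. e (A i) \<omega>)" unfolding e_def by simp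
    qed
    have u: "(\<Inter>n. - ?U n) = - (\<Union>i. A i)" by auto
    have "AE \<omega> in M. (\<lambda>n. e (- ?U n) \<omega>) \<longlonglongrightarrow> e (\<Inter>n. - ?U n) \<omega>"
    proof (rule e_dec)
      have "?U n \<in> sets borel" for n using A by auto
      then show "- ?U n \<in> sets borel" for n by (rule borel_comp)
    qed (auto simp: decseq_def)
    moreover have "AE \<omega> in M. \<forall>n. e (- ?U n) \<omega> = 1 - e (?U n) \<omega>"
      unfolding AE_all_countable using A by (intro allI e_compl) auto
    moreover have "AE \<omega> in M. e (- (\<Union>i. A i)) \<omega> = 1 - e (\<Union>i. A i) \<omega>"
      using A by (intro e_compl) auto
    moreover have "AE \<omega> in M. \<forall>i. measure (K \<omega>) (A i) = e (A i) \<omega>"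
      unfolding AE_all_countable using union by auto
    ultimately show ?case using eU
    proof eventually_elim
      case (elim \<omega>)
      interpret K: prob_space "K \<omega>" by (rule KP)
      have "(\<lambda>n. 1 - (1 - e (?U n) \<omega>)) \<longlonglongrightarrow> 1 - (1 - e (\<Union>i. A i) \<omega>)"
      proof (rule tendsto_diff[OF tendsto_const])
        show "(\<lambda>n. 1 - e (?U n) \<omega>) \<longlonglongrightarrow> 1 - e (\<Union>i. A i) \<omega>"
          using elim(1)[unfolded u] by (simp only: elim(2)[rule_format] elim(3))
      qed
      then have "(\<lambda>n. measure (K \<omega>) (?U n)) \<longlonglongrightarrow> e (\<Union>i. A i) \<omega>"
        using elim by (simp add: mK)
      moreover have "(\<lambda>n. measure (K \<omega>) (?U n)) \<longlonglongrightarrow> measure (K \<omega>) (\<Union>n. ?U n)"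
        by (rule K.finite_Lim_measure_incseq) (use A KS in \<open>auto intro!: incseq_SucI elim: less_SucI\<close>)
      moreover have "(\<Union>n. ?U n) = (\<Union>i. A i)" by auto
      ultimately show ?case using LIMSEQ_unique by metis
    qed
  qed
  then show ?thesis using KM unfolding is_cond_law_def e_def by blast
qed

lemma is_cond_law_unique:
  assumes K: "is_cond_law M F X K" and K': "is_cond_law M F X K'" and sp: "space F = space M"
  shows "AE \<omega> in M. K \<omega> = K' \<omega>"
proof -
  have "AE \<omega> in M. \<forall>q::rat. measure (K \<omega>) {..of_rat q} = measure (K' \<omega>) {..of_rat q}"
    unfolding AE_all_countable
  proof
    fix q :: rat
    have s: "{..of_rat q :: real} \<in> sets borel" by simp
    show "AE \<omega> in M. measure (K \<omega>) {..of_rat q} = measure (K' \<omega>) {..of_rat q}"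
      using K[unfolded is_cond_law_def, THEN conjunct2, rule_format, OF s]
        K'[unfolded is_cond_law_def, THEN conjunct2, rule_format, OF s]
      by eventually_elim simp
  qed
  moreover have "AE \<omega> in M. \<omega> \<in> space M" by simp
  ultimately show ?thesis
  proof eventually_elim
    case (elim \<omega>)
    have rd: "real_distribution (L \<omega>)" if "L \<in> F \<rightarrow>\<^sub>M prob_algebra borel" for L
      using measurable_space[OF that] elim(2) sp
      by (auto simp: space_prob_algebra real_distribution_def real_distribution_axioms_def)
    interpret L: real_distribution "K \<omega>" using K by (auto simp: is_cond_law_def intro: rd)
    interpret L': real_distribution "K' \<omega>" using K' by (auto simp: is_cond_law_def intro: rd)
    have "cdf (K \<omega>) x = cdf (K' \<omega>) x" for x
    proof -
      have rat: "cdf (K \<omega>) (of_rat q) = cdf (K' \<omega>) (of_rat q)" for q using elim(1) by (simp add: cdf_def)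
      have fr: "\<exists>\<^sub>F y in at_right x. cdf (K \<omega>) y - cdf (K' \<omega>) y = 0"
        unfolding frequently_def eventually_at_right_field
      proof clarsimp
        fix b assume "x < b"
        then obtain q where "x < of_rat q" "of_rat q < b" using of_rat_dense by blast
        then show "\<exists>y>x. y < b \<and> cdf (K \<omega>) y = cdf (K' \<omega>) y" using rat by blast
      qed
      have lim: "((\<lambda>y. cdf (K \<omega>) y - cdf (K' \<omega>) y) \<longlongrightarrow> cdf (K \<omega>) x - cdf (K' \<omega>) x) (at_right x)"
        using L.cdf_is_right_cont[of x] L'.cdf_is_right_cont[of x]
        unfolding continuous_within by (rule tendsto_diff)
      show ?thesis
      proof (rule ccontr)
        assume "\<not> ?thesis"
        then have "cdf (K \<omega>) x - cdf (K' \<omega>) x \<noteq> 0" by simp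
        with lim have "\<forall>\<^sub>F y in at_right x. cdf (K \<omega>) y - cdf (K' \<omega>) y \<noteq> 0"
          by (rule tendsto_imp_eventually_ne)
        with fr show False by (simp add: frequently_def)
      qed
    qed
    then have "cdf (K \<omega>) = cdf (K' \<omega>)" by (rule ext)
    then show ?case by (intro cdf_unique) unfold_locales
  qed
qed

lemma cond_law_is_cond_law:
  assumes "prob_space M" "Y \<in> M \<rightarrow>\<^sub>M N" "X \<in> borel_measurable M"
  shows "is_cond_law M (vimage_algebra (space M) Y N) X (cond_law M N Y X)"
  unfolding cond_law_def
proof (rule someI_ex[where P="is_cond_law M (vimage_algebra (space M) Y N) X"],
    rule is_cond_law_exists[OF assms(1) _ assms(3)])
  show "subalgebra M (vimage_algebra (space M) Y N)"
    using assms(2) unfolding subalgebra_def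
    by (auto simp: sets_vimage_algebra2 measurable_def)
qed

definition d_TV :: "real measure \<Rightarrow> real measure \<Rightarrow> real" where
  "d_TV P Q = (SUP A \<in> sets borel. \<bar>measure P A - measure Q A\<bar>)"

definition d_loc :: "real measure \<Rightarrow> real measure \<Rightarrow> real" where
  "d_loc P Q = (SUP x. \<bar>measure P {x..<x+1} - measure Q {x..<x+1}\<bar>)"

text \<open>Only \<open>l = 1\<close> and \<open>l = 2\<close> are meaningful.\<close>

definition dist_l :: "nat \<Rightarrow> real measure \<Rightarrow> real measure \<Rightarrow> real" where
  "dist_l l = (if l = 1 then d_TV else d_loc)"

text \<open>
  Finite signed measures on the line are represented by their set functions. The total mass of the
  total variation measure is the supremum of \<open>\<Sum>\<bar>\<nu> A\<bar>\<close> over finite measurable partitions.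
\<close>

definition variation_norm :: "(real set \<Rightarrow> real) \<Rightarrow> real" where
  "variation_norm \<nu> =
     (SUP P \<in> {P. finite P \<and> P \<subseteq> sets borel \<and> partition_on UNIV P}. \<Sum>A\<in>P. \<bar>\<nu> A\<bar>)"

text \<open>
  The signed measure \<open>\<mu> * (\<delta>\<^sub>1 - \<delta>\<^sub>0)\<^sup>*\<^sup>l\<close>, obtained by convolving \<open>l\<close> times with
  \<open>\<delta>\<^sub>1 - \<delta>\<^sub>0\<close> and using that convolution is bilinear.
\<close>

fun diff_conv :: "nat \<Rightarrow> real measure \<Rightarrow> real set \<Rightarrow> real" where
  "diff_conv 0 \<mu> A = measure \<mu> A"
| "diff_conv (Suc l) \<mu> A =
     diff_conv l (\<mu> \<star> return borel 1) A - diff_conv l (\<mu> \<star> return borel 0) A"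

definition D_norm :: "nat \<Rightarrow> real measure \<Rightarrow> real" where
  "D_norm l \<mu> = variation_norm (diff_conv l \<mu>)"

definition centered_binomial :: "nat \<Rightarrow> real \<Rightarrow> real measure" where
  "centered_binomial n p =
     distr (measure_pmf (binomial_pmf n p)) borel (\<lambda>k. real k - real n * p)"

definition subfamily :: "('i \<Rightarrow> 'w \<Rightarrow> real) \<Rightarrow> 'i set \<Rightarrow> 'w \<Rightarrow> 'i \<Rightarrow> real" where
  "subfamily \<xi> A \<omega> = (\<lambda>j\<in>A. \<xi> j \<omega>)"

abbreviation family_space :: "'i set \<Rightarrow> ('i \<Rightarrow> real) measure" where
  "family_space A \<equiv> PiM A (\<lambda>_. borel)"

definition indep_subfamilies ::
  "'w measure \<Rightarrow> ('i \<Rightarrow> 'w \<Rightarrow> real) \<Rightarrow> 'i set \<Rightarrow> 'i set \<Rightarrow> bool" where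
  "indep_subfamilies M \<xi> A B \<longleftrightarrow>
     prob_space.indep_var M (family_space A) (subfamily \<xi> A) (family_space B) (subfamily \<xi> B)"

text \<open>
  Third moments need not be finite under square integrability, so expectations of nonnegative
  quantities are taken in \<open>ennreal\<close> and may equal \<open>\<infinity>\<close>.
\<close>

definition theta ::
  "'w measure \<Rightarrow> ('w \<Rightarrow> real) \<Rightarrow> nat \<Rightarrow> ('w \<Rightarrow> real) \<Rightarrow> ('w \<Rightarrow> real) \<Rightarrow> ('w \<Rightarrow> real) \<Rightarrow> ennreal" where
  "theta M W l \<xi>\<^sub>i \<eta>\<^sub>i \<tau>\<^sub>i =
     ennreal (1/2) *
       (\<integral>\<^sup>+\<omega>. ennreal (\<bar>\<xi>\<^sub>i \<omega>\<bar> * (\<eta>\<^sub>i \<omega>)\<^sup>2 *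
          D_norm l (cond_law M borel (\<lambda>\<omega>. (\<xi>\<^sub>i \<omega>, \<eta>\<^sub>i \<omega>)) W \<omega>)) \<partial>M)
   + (\<integral>\<^sup>+\<omega>. ennreal (\<bar>\<xi>\<^sub>i \<omega> * \<eta>\<^sub>i \<omega> * (\<tau>\<^sub>i \<omega> - \<eta>\<^sub>i \<omega>)\<bar> *
          D_norm l (cond_law M borel (\<lambda>\<omega>. (\<xi>\<^sub>i \<omega>, \<eta>\<^sub>i \<omega>, \<tau>\<^sub>i \<omega>)) W \<omega>)) \<partial>M)
   + ennreal \<bar>\<integral>\<omega>. \<xi>\<^sub>i \<omega> * \<eta>\<^sub>i \<omega> \<partial>M\<bar> *
       (\<integral>\<^sup>+\<omega>. ennreal (\<bar>\<tau>\<^sub>i \<omega>\<bar> * D_norm l (cond_law M borel \<tau>\<^sub>i W \<omega>)) \<partial>M)"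

end

theory Submission
  imports Defs
begin

text \<open>
  The proof is Stein's method for the centered binomial law. With \<open>n = 4 \<sigma>2 + \<delta>\<close> and \<open>p = 1/2 - t\<close>, the
  solution \<open>f\<close> of \<open>p (n - k) f (k + 1) - (1 - p) k f k = h k - E h\<close> on \<open>0..n\<close>, extended by \<open>0\<close>, has
  increments at most \<open>1 / \<sigma>2\<close> for indicators \<open>h\<close>, and is itself at most \<open>1 / \<sigma>2\<close> if \<open>h\<close> is the
  indicator of a point. In the centered variable the left side is
  \<open>\<sigma>2 (f (k + 1) - f k) - w (f k + f (k + 1)) / 2\<close> up to an error of order \<open>1 / \<sigma>2\<close> in mean.

  The summands \<open>\<eta> i\<close> and \<open>\<tau> i\<close> live on other lattices than \<open>W\<close>, so \<open>f\<close> is replaced by the quadratic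
  spline \<open>G\<close> on the line with \<open>G k = (f k + f (k + 1)) / 2\<close> and \<open>G' k = f (k + 1) - f k\<close> at the integers;
  \<open>G''\<close> is the second difference of the step function with values \<open>f k\<close>. Hence, integrated against
  a law \<open>\<mu>\<close>, translates of \<open>G'\<close> vary at rate \<open>D_norm l \<mu> / \<sigma>2\<close> at most. Independence
  and the Taylor decomposition
  \<open>E \<xi> G(W) = E \<xi> (G(W) - G(W - \<eta>) - \<eta> G'(W - \<eta>)) + E \<xi> \<eta> (G'(W - \<eta>) - G'(W - \<tau>)) + E \<xi> \<eta> E G'(W - \<tau>)\<close>
  then produce the three terms of \<open>theta\<close>. The second claim follows since conditioning on less averages
  the law of \<open>W\<close>, and for laws on a lattice \<open>D_norm\<close> is determined by countably many atoms.
\<close>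

section \<open>Solution of the binomial Stein equation\<close>

text \<open>At \<open>p = 1/2\<close> the binomial variance is \<open>n / 4\<close>, so
  \<open>n\<close> is \<open>4 * \<sigma>2\<close> rounded up, with excess \<open>\<delta>\<close>.
  The centered law must also live on the lattice of \<open>W\<close>, which fixes
  \<open>n * p\<close> modulo 1; \<open>t\<close> is the least nonnegative shift of \<open>p\<close>
  away from \<open>1/2\<close> that achieves this, whence \<open>n * t < 1\<close>. Mean and lattice
  are then matched exactly, the variance within 1/4. Because \<open>p\<close> is close to
  \<open>1/2\<close>, the weighted mean \<open>p f (k + 1) + (1 - p) f k\<close> may be replaced by
  the symmetric one at the cost of \<open>t\<close> times an increment. Two obstacles shape the
  rest. Only second moments are finite, so every remainder is arranged to need no more than the
  second moment of \<open>W\<close>, and bounds that involve third moments are inequalities in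
  \<open>ennreal\<close>. And \<open>D_norm\<close> is a supremum over uncountably many partitions:
  along a conditional law it is not known to be measurable, and an almost sure bound on it cannot be
  checked partition by partition.\<close>

definition bin_weight :: "nat \<Rightarrow> real \<Rightarrow> nat \<Rightarrow> real" where
  "bin_weight n p k = pmf (binomial_pmf n p) k"

lemma bin_weight_nonneg [simp]: "0 \<le> bin_weight n p k"
  by (simp add: bin_weight_def)

text \<open>Detailed balance: the binomial law is reversible for the chain on \<open>0..n\<close>
  that moves up at rate \<open>p (n - k)\<close> and down at rate \<open>(1 - p) k\<close>. For
  \<open>n \<le> k\<close> both sides are zero.\<close>

lemma bin_weight_balance:
  assumes "0 \<le> p" "p \<le> 1"
  shows "p * (real n - real k) * bin_weight n p k = (1 - p) * real (Suc k) * bin_weight n p (Suc k)"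
proof (cases "k < n")
  case True
  have "real (Suc k) * real (n choose Suc k) = real ((n - k) * (n choose k))"
    using binomial_absorb_comp[of n k] Suc_times_binomial_eq
    by (metis binomial_absorption choose_reduce_nat  of_nat_mult binomial_absorb_comp mult.commute)
  then have *: "real (Suc k) * real (n choose Suc k) = (real n - real k) * real (n choose k)"
    using True by (simp add: of_nat_diff)
  define r where "r = p * p ^ k * (1 - p) * (1 - p) ^ (n - Suc k)"
  have pw: "(1 - p) ^ (n - k) = (1 - p) * (1 - p) ^ (n - Suc k)"
    using True by (metis Suc_diff_Suc power_Suc)
  have "p * (real n - real k) * bin_weight n p k = ((real n - real k) * real (n choose k)) * r"
    using True assms by (simp add: bin_weight_def pmf_binomial pw r_def mult_ac)
  also have "\<dots> = (1 - p) * real (Suc k) * bin_weight n p (Suc k)"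
    using True assms unfolding *[symmetric] by (simp add: bin_weight_def pmf_binomial r_def mult_ac del: of_nat_Suc)
  finally show ?thesis .
next
  case False
  then show ?thesis using assms by (cases "k = n") (auto simp: bin_weight_def binomial_eq_0)
qed

section \<open>Tails of the binomial law\<close>

definition bin_below :: "nat \<Rightarrow> real \<Rightarrow> nat \<Rightarrow> real" where
  "bin_below n p k = (\<Sum>m<k. bin_weight n p m)"

definition bin_above :: "nat \<Rightarrow> real \<Rightarrow> nat \<Rightarrow> real" where
  "bin_above n p k = (\<Sum>m=k..n. bin_weight n p m)"

lemma bin_below_nonneg: "0 \<le> bin_below n p k"
  and bin_above_nonneg: "0 \<le> bin_above n p k"
  by (simp_all add: bin_below_def bin_above_def sum_nonneg)

lemma sum_bin_weight:
  assumes "0 \<le> p" "p \<le> 1"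
  shows "(\<Sum>m\<le>n. bin_weight n p m) = 1"
  unfolding bin_weight_def by (rule sum_pmf_eq_1) (use assms set_pmf_binomial_eq[of p n] in auto)

lemma bin_below_plus_above:
  assumes "0 \<le> p" "p \<le> 1" "k \<le> Suc n"
  shows "bin_below n p k + bin_above n p k = 1"
proof -
  have "{..n} = {..<k} \<union> {k..n}" using assms by auto
  then show ?thesis
    unfolding bin_below_def bin_above_def sum_bin_weight[OF assms(1,2), of n, symmetric]
    by (simp add: sum.union_disjoint ivl_disj_int)
qed

text \<open>Balance turns the term \<open>m\<close> on the left into the term \<open>Suc m\<close>
  on the right, and \<open>m < k\<close> allows the factors \<open>n - m\<close> and
  \<open>Suc m\<close> to be replaced by \<open>n - k\<close> and \<open>k\<close>. This yields the
  decrease of a point solution below its point.\<close>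

lemma bin_below_ratio:
  assumes "0 \<le> p" "p \<le> 1" 
  shows "p * (real n - real k) * bin_below n p k \<le> (1 - p) * real k * bin_below n p (Suc k)"
proof -
  have "p * (real n - real k) * bin_weight n p m \<le> (1 - p) * real k * bin_weight n p (Suc m)" if "m < k" for m
  proof -
    have "p * (real n - real k) * bin_weight n p m \<le> p * (real n - real m) * bin_weight n p m"
      using that assms by (intro mult_right_mono mult_left_mono) auto
    also have "\<dots> \<le> (1 - p) * real k * bin_weight n p (Suc m)"
      unfolding bin_weight_balance[OF assms(1,2)]
      using that assms by (intro mult_right_mono mult_left_mono) auto
    finally show ?thesis .
  qed
  then have "(\<Sum>m<k. p * (real n - real k) * bin_weight n p m) \<le> (\<Sum>m<k. (1 - p) * real k * bin_weight n p (Suc m))"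
    by (intro sum_mono) auto
  then have "p * (real n - real k) * bin_below n p k \<le> (1 - p) * real k * (\<Sum>m<k. bin_weight n p (Suc m))"
    by (simp add: bin_below_def sum_distrib_left)
  also have "\<dots> \<le> (1 - p) * real k * bin_below n p (Suc k)"
    unfolding bin_below_def sum.lessThan_Suc_shift using assms by (intro mult_left_mono) auto
  finally show ?thesis .
qed

lemma bin_above_Suc_shift: "bin_above n p (Suc k) = (\<Sum>m\<in>{k..<n}. bin_weight n p (Suc m))"
  unfolding bin_above_def sum.shift_bounds_Suc_ivl[symmetric] atLeastLessThanSuc_atLeastAtMost ..

lemma sum_le_bin_above: "(\<Sum>m\<in>{k..<n}. bin_weight n p m) \<le> bin_above n p k"
  unfolding bin_above_def by (rule sum_mono2) auto

text \<open>Mirror image of \<open>bin_below_ratio\<close>; it yields the decrease above the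
  point.\<close>

lemma bin_above_ratio:
  assumes "0 \<le> p" "p \<le> 1" "k \<le> n"
  shows "(1 - p) * real k * bin_above n p (Suc k) \<le> p * (real n - real k) * bin_above n p k"
proof -
  have "(1 - p) * real k * bin_weight n p (Suc m) \<le> p * (real n - real k) * bin_weight n p m"
    if "m \<in> {k..<n}" for m
  proof -
    have "(1 - p) * real k * bin_weight n p (Suc m) \<le> (1 - p) * real (Suc m) * bin_weight n p (Suc m)"
      using that assms by (intro mult_right_mono mult_left_mono) auto
    also have "\<dots> \<le> p * (real n - real k) * bin_weight n p m"
      unfolding bin_weight_balance[OF assms(1,2), symmetric]
      using that assms by (intro mult_right_mono mult_left_mono) auto
    finally show ?thesis .
  qed
  then have "(\<Sum>m\<in>{k..<n}. (1 - p) * real k * bin_weight n p (Suc m)) \<le> (\<Sum>m\<in>{k..<n}. p * (real n - real k) * bin_weight n p m)"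
    by (intro sum_mono) auto
  then have "(1 - p) * real k * bin_above n p (Suc k) \<le> p * (real n - real k) * (\<Sum>m\<in>{k..<n}. bin_weight n p m)"
    by (simp add: bin_above_Suc_shift sum_distrib_left)
  also have "\<dots> \<le> p * (real n - real k) * bin_above n p k"
    using assms sum_le_bin_above by (intro mult_left_mono) auto
  finally show ?thesis .
qed

text \<open>The origin of the factor \<open>n + 1\<close>: by Pascal's rule
  \<open>p * bin_weight n p m + (1 - p) * bin_weight n p (Suc m)\<close> is the weight of
  \<open>Suc m\<close> under \<open>n + 1\<close> trials, and \<open>Suc m\<close> times it equals
  \<open>(n + 1) * p * bin_weight n p m\<close>.\<close>

lemma bin_below_bound:
  assumes "0 \<le> p" "p \<le> 1"
  shows "(real n + 1) * p * bin_below n p k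
    \<le> real k * ((1 - p) * bin_below n p (Suc k) + p * bin_below n p k)"
proof -
  have "(real n + 1) * p * bin_weight n p m \<le> real k * ((1 - p) * bin_weight n p (Suc m) + p * bin_weight n p m)"
    if "m < k" for m
  proof -
    have "(real n + 1) * p * bin_weight n p m = real (Suc m) * ((1 - p) * bin_weight n p (Suc m) + p * bin_weight n p m)"
      using bin_weight_balance[OF assms, of n m] by (simp add: algebra_simps)
    also have "\<dots> \<le> real k * ((1 - p) * bin_weight n p (Suc m) + p * bin_weight n p m)"
      using that assms by (intro mult_right_mono) auto
    finally show ?thesis .
  qed
  then have "(\<Sum>m<k. (real n + 1) * p * bin_weight n p m)
      \<le> (\<Sum>m<k. real k * ((1 - p) * bin_weight n p (Suc m) + p * bin_weight n p m))"
    by (intro sum_mono) auto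
  then have "(real n + 1) * p * bin_below n p k
      \<le> real k * ((1 - p) * (\<Sum>m<k. bin_weight n p (Suc m)) + p * bin_below n p k)"
    by (simp add: bin_below_def sum_distrib_left sum.distrib distrib_left)
  also have "\<dots> \<le> real k * ((1 - p) * bin_below n p (Suc k) + p * bin_below n p k)"
    unfolding bin_below_def sum.lessThan_Suc_shift
    using assms by (intro mult_left_mono add_mono) auto
  finally show ?thesis .
qed

text \<open>The counterpart for upper tails, obtained by counting failures instead of
  successes.\<close>

lemma bin_above_bound:
  assumes "0 \<le> p" "p \<le> 1" "k \<le> n"
  shows "(real n + 1) * (1 - p) * bin_above n p (Suc k)
    \<le> (real n - real k) * (p * bin_above n p k + (1 - p) * bin_above n p (Suc k))"
proof -
  have "(real n + 1) * (1 - p) * bin_weight n p (Suc m)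
      \<le> (real n - real k) * (p * bin_weight n p m + (1 - p) * bin_weight n p (Suc m))"
    if "m \<in> {k..<n}" for m
  proof -
    have "(real n + 1) * (1 - p) * bin_weight n p (Suc m)
        = (real n - real m) * (p * bin_weight n p m + (1 - p) * bin_weight n p (Suc m))"
      using bin_weight_balance[OF assms(1,2), of n m] by (simp add: algebra_simps)
    also have "\<dots> \<le> (real n - real k) * (p * bin_weight n p m + (1 - p) * bin_weight n p (Suc m))"
      using that assms by (intro mult_right_mono) auto
    finally show ?thesis .
  qed
  then have "(\<Sum>m\<in>{k..<n}. (real n + 1) * (1 - p) * bin_weight n p (Suc m))
      \<le> (\<Sum>m\<in>{k..<n}. (real n - real k) * (p * bin_weight n p m + (1 - p) * bin_weight n p (Suc m)))"
    by (intro sum_mono) auto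
  then have "(real n + 1) * (1 - p) * bin_above n p (Suc k)
      \<le> (real n - real k) * (p * (\<Sum>m\<in>{k..<n}. bin_weight n p m) + (1 - p) * bin_above n p (Suc k))"
    by (simp add: bin_above_Suc_shift sum_distrib_left sum.distrib distrib_left)
  also have "\<dots> \<le> (real n - real k) * (p * bin_above n p k + (1 - p) * bin_above n p (Suc k))"
    using assms sum_le_bin_above by (intro mult_left_mono add_mono) auto
  finally show ?thesis .
qed

text \<open>Multiply the Stein equation for the indicator of \<open>j\<close> by
  \<open>bin_weight n p m\<close> and sum over \<open>m < k\<close>: by detailed balance the left
  side telescopes to \<open>(1 - p) * k * bin_weight n p k * f k\<close>, which leaves this formula.
  The value 0 at \<open>0\<close> and at \<open>n + 1\<close> is a free choice, since the equations
  at \<open>0\<close> and \<open>n\<close> give these values the coefficient zero.\<close>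

definition point_sol :: "nat \<Rightarrow> real \<Rightarrow> nat \<Rightarrow> nat \<Rightarrow> real" where
  "point_sol n p j k = (if 1 \<le> k \<and> k \<le> n then
     (if k \<le> j then - bin_weight n p j * bin_below n p k else bin_weight n p j * bin_above n p k)
       / ((1 - p) * real k * bin_weight n p k)
   else 0)"

definition set_sol :: "nat \<Rightarrow> real \<Rightarrow> nat set \<Rightarrow> nat \<Rightarrow> real" where
  "set_sol n p H k = (\<Sum>j\<in>H \<inter> {..n}. point_sol n p j k)"

section \<open>Properties of the solutions for points and for sets\<close>

context
  fixes n :: nat and p :: real
  assumes p: "0 < p" "p < 1"
begin

lemma p_le: "0 \<le> p" "p \<le> 1" using p by auto

lemma bin_weight_pos: "k \<le> n \<Longrightarrow> 0 < bin_weight n p k"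
  using p by (simp add: bin_weight_def pmf_binomial)

text \<open>Balance replaces the weight of \<open>Suc k\<close> by that of \<open>k\<close>, so that
  the values at \<open>k\<close> and \<open>Suc k\<close> become comparable.\<close>

lemma point_sol_Suc:
  assumes "k < n"
  shows "point_sol n p j (Suc k)
    = (if Suc k \<le> j then - bin_weight n p j * bin_below n p (Suc k) else bin_weight n p j * bin_above n p (Suc k))
      / (p * (real n - real k) * bin_weight n p k)"
  using assms by (simp add: point_sol_def bin_weight_balance[OF p_le])

lemma point_sol_stein:
  assumes "j \<le> n" "k \<le> n"
  shows "p * (real n - real k) * point_sol n p j (Suc k) - (1 - p) * real k * point_sol n p j k
    = of_bool (k = j) - bin_weight n p j"
proof -
  let ?\<pi> = "bin_weight n p"
  have pk: "?\<pi> k > 0" using bin_weight_pos assms by auto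
  have *: "bin_below n p (Suc m) = bin_below n p m + ?\<pi> m" for m by (simp add: bin_below_def)
  have ab: "bin_above n p m = 1 - bin_below n p m" if "m \<le> Suc n" for m
    using bin_below_plus_above[OF p_le that] by simp
  have 1: "p * (real n - real k) * point_sol n p j (Suc k) =
    (if Suc k \<le> j then - ?\<pi> j * bin_below n p (Suc k) else ?\<pi> j * bin_above n p (Suc k)) / ?\<pi> k"
  proof (cases "k < n")
    case True
    then show ?thesis using p pk unfolding point_sol_Suc[OF True] by (simp add: field_simps)
  next
    \<comment> \<open>At \<open>k = n\<close> the upward rate vanishes on the left, and on the right
      the tail from \<open>Suc n\<close> is empty.\<close>
    case False
    then have "k = n" using assms by auto
    then show ?thesis using assms by (simp add: bin_above_def)
  qed
  have 2: "(1 - p) * real k * point_sol n p j k =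
    (if k \<le> j then - ?\<pi> j * bin_below n p k else ?\<pi> j * bin_above n p k) / ?\<pi> k"
    using p pk assms by (cases "k = 0") (auto simp: point_sol_def bin_below_def)
  show ?thesis unfolding 1 2 using pk assms
    by (cases k j rule: linorder_cases) (auto simp: * ab field_simps)
qed

text \<open>The sum over all points is the solution for a constant test function. The points below
  \<open>k\<close> contribute the product of both tails, the others its negative.\<close>

lemma sum_point_sol: "(\<Sum>j\<le>n. point_sol n p j k) = 0"
proof (cases "1 \<le> k \<and> k \<le> n")
  case True
  let ?\<pi> = "bin_weight n p"
  let ?c = "(1 - p) * real k * ?\<pi> k"
  have "{..n} = {..<k} \<union> {k..n}" using True by auto
  then have "(\<Sum>j\<le>n. point_sol n p j k) = (\<Sum>j<k. point_sol n p j k) + (\<Sum>j=k..n. point_sol n p j k)"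
    by (simp add: sum.union_disjoint ivl_disj_int)
  also have "(\<Sum>j<k. point_sol n p j k) = (\<Sum>j<k. ?\<pi> j * (bin_above n p k / ?c))"
    using True by (intro sum.cong) (auto simp: point_sol_def)
  also have "\<dots> = bin_below n p k * bin_above n p k / ?c"
    by (simp add: bin_below_def sum_distrib_right sum_divide_distrib)
  also have "(\<Sum>j=k..n. point_sol n p j k) = (\<Sum>j=k..n. ?\<pi> j * (- bin_below n p k / ?c))"
    using True by (intro sum.cong) (auto simp: point_sol_def)
  also have "\<dots> = - (bin_below n p k * bin_above n p k / ?c)"
    unfolding sum_distrib_right[symmetric] bin_above_def by simp
  finally show ?thesis by simp
qed (auto simp: point_sol_def)

lemma point_sol_nonpos: "k \<le> j \<Longrightarrow> point_sol n p j k \<le> 0"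
  using p bin_below_nonneg[of n p k] by (simp add: point_sol_def)

lemma point_sol_nonneg: "j < k \<Longrightarrow> 0 \<le> point_sol n p j k"
  using p bin_above_nonneg[of n p k] by (simp add: point_sol_def)

text \<open>The tail ratios give the decrease in the interior; at the ends, where one of the two
  values is 0, the sign of the other suffices. Hence in a sum over several points \<open>j\<close>
  only the summand \<open>j = k\<close> can increase from \<open>k\<close> to
  \<open>Suc k\<close>.\<close>

lemma point_sol_step:
  assumes "j \<le> n" "k \<noteq> j"
  shows "point_sol n p j (Suc k) \<le> point_sol n p j k"
proof -
  consider "k = 0" | "k \<ge> n" | "0 < k" "k < n" "k < j" | "0 < k" "k < n" "j < k"
    using assms by linarith
  then show ?thesis
  proof cases
    case 1
    then have "point_sol n p j k = 0" by (simp add: point_sol_def)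
    then show ?thesis using point_sol_nonpos[of "Suc k" j] 1 assms by auto
  next
    case 2
    then have "point_sol n p j (Suc k) = 0" by (simp add: point_sol_def)
    then show ?thesis using point_sol_nonneg[of j k] 2 assms by auto
  next
    case 3
    let ?x = "(1 - p) * real k" and ?y = "p * (real n - real k)"
    have pos: "?x > 0" "?y > 0" using 3 p by auto
    have "bin_below n p k / ?x \<le> bin_below n p (Suc k) / ?y"
      using bin_below_ratio[OF p_le, of n k] pos by (simp add: field_simps)
    then have "bin_weight n p j / bin_weight n p k * (bin_below n p k / ?x)
        \<le> bin_weight n p j / bin_weight n p k * (bin_below n p (Suc k) / ?y)"
      by (intro mult_left_mono) auto
    then show ?thesis
      using 3 unfolding point_sol_Suc[OF 3(2)] by (simp add: point_sol_def mult_ac)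
  next
    case 4
    let ?x = "(1 - p) * real k" and ?y = "p * (real n - real k)"
    have pos: "?x > 0" "?y > 0" using 4 p by auto
    have "bin_above n p (Suc k) / ?y \<le> bin_above n p k / ?x"
      using bin_above_ratio[OF p_le, of k n] pos 4 by (simp add: field_simps)
    then have "bin_weight n p j / bin_weight n p k * (bin_above n p (Suc k) / ?y)
        \<le> bin_weight n p j / bin_weight n p k * (bin_above n p k / ?x)"
      by (intro mult_left_mono) auto
    then show ?thesis
      using 4 unfolding point_sol_Suc[OF 4(2)] by (simp add: point_sol_def mult_ac)
  qed
qed

text \<open>The one increasing step. The tail bounds on its two ends have weights \<open>p\<close>
  and \<open>1 - p\<close> in common, and for each weight the lower and upper tails are
  complementary.\<close>

lemma point_sol_jump:
  assumes "j \<le> n"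
  shows "point_sol n p j (Suc j) - point_sol n p j j \<le> 1 / ((real n + 1) * p * (1 - p))"
proof -
  let ?N = "(real n + 1) * p * (1 - p)"
  have N: "?N > 0" using p by simp
  have pj: "bin_weight n p j > 0" using bin_weight_pos assms by auto
  have up: "point_sol n p j (Suc j) * ?N \<le> p * bin_above n p j + (1 - p) * bin_above n p (Suc j)"
  proof (cases "j < n")
    case True
    have "point_sol n p j (Suc j) = bin_above n p (Suc j) / (p * (real n - real j))"
      using pj unfolding point_sol_Suc[OF True] by simp
    then have "point_sol n p j (Suc j) * ?N = (real n + 1) * (1 - p) * bin_above n p (Suc j) / (real n - real j)"
      using p by simp
    also have "\<dots> \<le> p * bin_above n p j + (1 - p) * bin_above n p (Suc j)"
      using bin_above_bound[OF p_le, of j n] True by (simp add: field_simps)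
    finally show ?thesis .
  next
    case False
    then have "point_sol n p j (Suc j) = 0" by (simp add: point_sol_def)
    then show ?thesis using p bin_above_nonneg[of n p] by simp
  qed
  have lo: "- point_sol n p j j * ?N \<le> (1 - p) * bin_below n p (Suc j) + p * bin_below n p j"
  proof (cases "j = 0")
    case False
    have "point_sol n p j j = - (bin_below n p j / ((1 - p) * real j))"
      using pj False assms by (simp add: point_sol_def)
    then have "- point_sol n p j j * ?N = (real n + 1) * p * bin_below n p j / real j"
      using p by simp
    also have "\<dots> \<le> (1 - p) * bin_below n p (Suc j) + p * bin_below n p j"
      using bin_below_bound[OF p_le, of n j] False by (simp add: field_simps)
    finally show ?thesis .
  next
    case True
    then have "point_sol n p j j = 0" by (simp add: point_sol_def)
    then show ?thesis using p bin_below_nonneg[of n p] by simp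
  qed
  have "(point_sol n p j (Suc j) - point_sol n p j j) * ?N
      \<le> p * (bin_below n p j + bin_above n p j) + (1 - p) * (bin_below n p (Suc j) + bin_above n p (Suc j))"
    using up lo by (simp add: algebra_simps)
  also have "\<dots> = 1" using bin_below_plus_above[OF p_le] assms by simp
  finally show ?thesis using N by (simp add: field_simps)
qed

text \<open>The solution decreases from 0 through nonpositive values up to \<open>j\<close>, jumps,
  and then decreases through nonnegative values to 0. Its extremes are therefore the two ends of the
  jump, which have opposite signs, and the jump bounds both.\<close>

lemma point_sol_bound:
  assumes "j \<le> n"
  shows "\<bar>point_sol n p j k\<bar> \<le> 1 / ((real n + 1) * p * (1 - p))"
proof (cases "k \<le> j")
  case True
  then have "point_sol n p j j \<le> point_sol n p j k"
  proof (induction rule: inc_induct)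
    case (step m)
    then show ?case using point_sol_step[OF assms, of m] by auto
  qed simp
  then show ?thesis
    using point_sol_nonpos[OF True] point_sol_nonneg[of j "Suc j"] point_sol_jump[OF assms] by auto
next
  case False
  then have "Suc j \<le> k" by simp
  then have "point_sol n p j k \<le> point_sol n p j (Suc j)"
  proof (induction rule: dec_induct)
    case (step m)
    then show ?case using point_sol_step[OF assms, of m] by auto
  qed simp
  then show ?thesis
    using False point_sol_nonneg[of j k] point_sol_nonpos[of j j] point_sol_jump[OF assms] by auto
qed

lemma set_sol_0: "set_sol n p H 0 = 0"
  and set_sol_above: "n < k \<Longrightarrow> set_sol n p H k = 0"
  by (auto simp: set_sol_def point_sol_def)

lemma set_sol_stein:
  assumes "k \<le> n"
  shows "p * (real n - real k) * set_sol n p H (Suc k) - (1 - p) * real k * set_sol n p H k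
    = of_bool (k \<in> H) - (\<Sum>j\<in>H \<inter> {..n}. bin_weight n p j)"
proof -
  have "p * (real n - real k) * set_sol n p H (Suc k) - (1 - p) * real k * set_sol n p H k
      = (\<Sum>j\<in>H \<inter> {..n}. p * (real n - real k) * point_sol n p j (Suc k) - (1 - p) * real k * point_sol n p j k)"
    by (simp add: set_sol_def sum_distrib_left sum_subtractf)
  also have "\<dots> = (\<Sum>j\<in>H \<inter> {..n}. of_bool (k = j) - bin_weight n p j)"
    using assms by (intro sum.cong point_sol_stein) auto
  also have "\<dots> = (\<Sum>j\<in>H \<inter> {..n}. of_bool (k = j)) - (\<Sum>j\<in>H \<inter> {..n}. bin_weight n p j)"
    by (rule sum_subtractf)
  also have "(\<Sum>j\<in>H \<inter> {..n}. of_bool (k = j)) = (of_bool (k \<in> H) :: real)"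
    using assms by (simp add: of_bool_def)
  finally show ?thesis .
qed

text \<open>At most one point of \<open>H\<close>, namely \<open>k\<close> itself, contributes a
  positive increment, so the bound does not grow with the size of \<open>H\<close>.\<close>

lemma set_sol_diff_le: "set_sol n p H (Suc k) - set_sol n p H k \<le> 1 / ((real n + 1) * p * (1 - p))"
proof -
  have "set_sol n p H (Suc k) - set_sol n p H k = (\<Sum>j\<in>H \<inter> {..n}. point_sol n p j (Suc k) - point_sol n p j k)"
    by (simp add: set_sol_def sum_subtractf)
  also have "\<dots> \<le> (\<Sum>j\<in>H \<inter> {..n}. if j = k then 1 / ((real n + 1) * p * (1 - p)) else 0)"
    using point_sol_step point_sol_jump by (intro sum_mono) auto
  also have "\<dots> \<le> 1 / ((real n + 1) * p * (1 - p))" using p by simp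
  finally show ?thesis .
qed

text \<open>Complementation reverses the sign, so an upper bound on increments that is valid for all
  sets is also a lower bound.\<close>

lemma set_sol_compl: "set_sol n p (- H) k = - set_sol n p H k"
proof -
  have "set_sol n p H k + set_sol n p (- H) k = (\<Sum>j\<in>H \<inter> {..n} \<union> - H \<inter> {..n}. point_sol n p j k)"
    unfolding set_sol_def by (subst sum.union_disjoint) auto
  also have "H \<inter> {..n} \<union> - H \<inter> {..n} = {..n}" by auto
  finally show ?thesis using sum_point_sol by simp
qed

lemma set_sol_diff_bound: "\<bar>set_sol n p H (Suc k) - set_sol n p H k\<bar> \<le> 1 / ((real n + 1) * p * (1 - p))"
  using set_sol_diff_le[of H k] set_sol_diff_le[of "- H" k] by (simp add: set_sol_compl)

text \<open>The form \<open>H \<inter> {j}\<close> covers sets with at most one point, including the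
  empty set and points above \<open>n\<close>, where the solution is zero.\<close>

lemma set_sol_point_bound:
  "\<bar>set_sol n p (H \<inter> {j}) k\<bar> \<le> 1 / ((real n + 1) * p * (1 - p))"
proof (cases "H \<inter> {j} \<inter> {..n} = {j}")
  case True
  then show ?thesis using point_sol_bound[of j k] by (auto simp: set_sol_def)
next
  case False
  then have "H \<inter> {j} \<inter> {..n} = {}" by auto
  then show ?thesis using p unfolding set_sol_def by simp
qed

end

section \<open>The variation norm of differences\<close>

lemma convolution_return:
  assumes "prob_space \<mu>" and [measurable_cong]: "sets \<mu> = sets borel"
  shows "\<mu> \<star> return borel c = distr \<mu> borel (\<lambda>x. x + c :: real)"
proof (rule measure_eqI)
  interpret prob_space \<mu> by fact
  interpret R: prob_space "return borel c" by (rule prob_space_return) simp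
  have sp: "space \<mu> = UNIV" using sets_eq_imp_space_eq[OF assms(2)] by simp
  fix X assume "X \<in> sets (\<mu> \<star> return borel c)"
  then have X[measurable]: "X \<in> sets borel" by simp
  have "emeasure (\<mu> \<star> return borel c) X = (\<integral>\<^sup>+x. \<integral>\<^sup>+y. indicator X (x + y) \<partial>return borel c \<partial>\<mu>)"
    using nn_integral_convolution[of \<mu> "return borel c" "indicator X"] assms
      finite_measure_axioms R.finite_measure_axioms sp
    by simp
  also have "\<dots> = (\<integral>\<^sup>+x. indicator X (x + c) \<partial>\<mu>)"
    by (simp add: nn_integral_return)
  also have "\<dots> = emeasure (distr \<mu> borel (\<lambda>x. x + c)) X"
    using nn_integral_distr[of "\<lambda>x. x + c" \<mu> borel "indicator X"] by simp
  finally show "emeasure (\<mu> \<star> return borel c) X = emeasure (distr \<mu> borel (\<lambda>x. x + c)) X" .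
qed simp

lemma measure_distr_integral:
  fixes f :: "'a \<Rightarrow> real"
  assumes "prob_space \<mu>" and [measurable]: "f \<in> borel_measurable \<mu>" and [measurable]: "A \<in> sets borel"
  shows "measure (distr \<mu> borel f) A = (\<integral>w. indicator A (f w) \<partial>\<mu>)"
proof -
  interpret prob_space \<mu> by fact
  interpret D: prob_space "distr \<mu> borel f" by (rule prob_space_distr) simp
  have "measure (distr \<mu> borel f) A = (\<integral>x. indicator A x \<partial>distr \<mu> borel f)" by simp
  also have "\<dots> = (\<integral>w. indicator A (f w) \<partial>\<mu>)" by (rule integral_distr) simp_all
  finally show ?thesis .
qed

section \<open>Differences of translated laws\<close>

context
  fixes \<mu> :: "real measure"
  assumes prob: "prob_space \<mu>" and sets_\<mu>[measurable_cong]: "sets \<mu> = sets borel"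
begin

lemma prob_shift: "prob_space (distr \<mu> borel (\<lambda>x. x + c))"
  by (rule prob_space.prob_space_distr[OF prob]) simp

lemma shift_shift: "distr (distr \<mu> borel (\<lambda>x. x + c)) borel (\<lambda>x. x + d) = distr \<mu> borel (\<lambda>x. x + (c + d))"
  by (simp add: distr_distr comp_def add.assoc)

lemma diff_conv_1: "diff_conv 1 \<mu> A
    = measure (distr \<mu> borel (\<lambda>x. x + 1)) A - measure (distr \<mu> borel (\<lambda>x. x + 0)) A"
  by (simp only: diff_conv.simps One_nat_def convolution_return[OF prob sets_\<mu>])

lemma diff_conv_2: "diff_conv 2 \<mu> A
    = measure (distr \<mu> borel (\<lambda>x. x + 2)) A - 2 * measure (distr \<mu> borel (\<lambda>x. x + 1)) A
      + measure (distr \<mu> borel (\<lambda>x. x + 0)) A"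
proof -
  have c: "distr \<mu> borel (\<lambda>x. x + c) \<star> return borel d = distr \<mu> borel (\<lambda>x. x + (c + d))" for c d
    using convolution_return[OF prob_shift[of c], of d] by (simp only: shift_shift sets_distr)
  have "diff_conv 2 \<mu> A = diff_conv 1 (\<mu> \<star> return borel 1) A - diff_conv 1 (\<mu> \<star> return borel 0) A"
    by (simp only: diff_conv.simps numeral_2_eq_2 One_nat_def)
  also have "\<dots> = measure (distr \<mu> borel (\<lambda>x. x + (1 + 1))) A - measure (distr \<mu> borel (\<lambda>x. x + (1 + 0))) A
     - (measure (distr \<mu> borel (\<lambda>x. x + (0 + 1))) A - measure (distr \<mu> borel (\<lambda>x. x + (0 + 0))) A)"
    by (simp only: diff_conv.simps One_nat_def convolution_return[OF prob sets_\<mu>] c)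
  finally show ?thesis by simp
qed

lemma diff_conv_1_integral: "A \<in> sets borel \<Longrightarrow>
    diff_conv 1 \<mu> A = (\<integral>w. indicator A (w + 1) - indicator A w \<partial>\<mu>)"
  and diff_conv_2_integral: "A \<in> sets borel \<Longrightarrow>
    diff_conv 2 \<mu> A = (\<integral>w. indicator A (w + 2) - 2 * indicator A (w + 1) + indicator A w \<partial>\<mu>)"
proof -
  interpret prob_space \<mu> by (rule prob)
  assume A[measurable]: "A \<in> sets borel"
  have i[simp]: "integrable \<mu> (\<lambda>w. indicator A (w + c) :: real)" for c
    by (rule integrable_const_bound[where B=1]) (auto simp: indicator_def)
  have i0[simp]: "integrable \<mu> (\<lambda>w. indicator A w :: real)" using i[of 0] by simp
  show "diff_conv 1 \<mu> A = (\<integral>w. indicator A (w + 1) - indicator A w \<partial>\<mu>)"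
    unfolding diff_conv_1 by (subst (1 2) measure_distr_integral[OF prob]) simp_all
  show "diff_conv 2 \<mu> A = (\<integral>w. indicator A (w + 2) - 2 * indicator A (w + 1) + indicator A w \<partial>\<mu>)"
    unfolding diff_conv_2 by (subst (1 2 3) measure_distr_integral[OF prob]) simp_all
qed

lemma diff_conv_empty: "l \<in> {1, 2} \<Longrightarrow> diff_conv l \<mu> {} = 0"
  using diff_conv_1[of "{}"] diff_conv_2[of "{}"] by auto

text \<open>The coefficients 1, 2, 1 of a second difference of probability laws give 4. The value is
  immaterial: the bound makes the real supremum in \<open>variation_norm\<close> range over a set
  that is bounded above.\<close>

lemma sum_abs_diff_conv_le:
  assumes "l \<in> {1, 2}" "finite P" "P \<subseteq> sets borel" "disjoint P"
  shows "(\<Sum>A\<in>P. \<bar>diff_conv l \<mu> A\<bar>) \<le> 4"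
proof -
  let ?m = "\<lambda>c A. measure (distr \<mu> borel (\<lambda>x. x + c)) A"
  have le1: "(\<Sum>A\<in>P. ?m c A) \<le> 1" for c
  proof -
    interpret D: prob_space "distr \<mu> borel (\<lambda>x. x + c)" by (rule prob_shift)
    have "(\<Sum>A\<in>P. ?m c A) = ?m c (\<Union>A\<in>P. A)"
      using assms by (intro D.finite_measure_finite_Union[symmetric])
        (auto simp: disjoint_family_on_def disjoint_def)
    then show ?thesis by simp
  qed
  have "\<bar>diff_conv l \<mu> A\<bar> \<le> ?m 2 A + 2 * ?m 1 A + ?m 0 A" for A
  proof -
    have nn: "0 \<le> ?m c A" for c by simp
    consider "l = 1" | "l = 2" using assms(1) by auto
    then show ?thesis
    proof cases
      case 1
      show ?thesis unfolding 1 diff_conv_1 using nn[of 0] nn[of 1] nn[of 2] by linarith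
    next
      case 2
      show ?thesis unfolding 2 diff_conv_2 using nn[of 0] nn[of 1] nn[of 2] by linarith
    qed
  qed
  then have "(\<Sum>A\<in>P. \<bar>diff_conv l \<mu> A\<bar>) \<le> (\<Sum>A\<in>P. ?m 2 A + 2 * ?m 1 A + ?m 0 A)"
    by (rule sum_mono)
  also have "\<dots> = (\<Sum>A\<in>P. ?m 2 A) + 2 * (\<Sum>A\<in>P. ?m 1 A) + (\<Sum>A\<in>P. ?m 0 A)"
    by (simp only: sum.distrib sum_distrib_left)
  finally show ?thesis using le1[of 2] le1[of 1] le1[of 0] by linarith
qed

text \<open>A disjoint family is completed to a partition by the complement of its union. Empty
  members are discarded, because partition blocks are nonempty; this also makes the indexing
  injective.\<close>

lemma sum_abs_diff_conv_le_D_norm: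
  assumes l: "l \<in> {1, 2}" and I: "finite I" and A: "\<And>i. i \<in> I \<Longrightarrow> A i \<in> sets borel"
    and dis: "disjoint_family_on A I"
  shows "(\<Sum>i\<in>I. \<bar>diff_conv l \<mu> (A i)\<bar>) \<le> D_norm l \<mu>"
proof -
  define I' where "I' = {i \<in> I. A i \<noteq> {}}"
  define P where "P = insert (- (\<Union>i\<in>I. A i)) (A ` I') - {{}}"
  have P: "finite P" "P \<subseteq> sets borel" "partition_on UNIV P"
  proof -
    show "finite P" using I by (auto simp: P_def I'_def)
    have "(\<Union>i\<in>I. A i) \<in> sets borel" using I A by (intro sets.finite_UN) auto
    then have "- (\<Union>i\<in>I. A i) \<in> sets borel" by (rule borel_comp)
    then show "P \<subseteq> sets borel" using A by (auto simp: P_def I'_def)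
    have "x \<in> \<Union>P" for x
    proof (cases "x \<in> (\<Union>i\<in>I. A i)")
      case True
      then obtain i where "i \<in> I" "x \<in> A i" by blast
      then show ?thesis unfolding P_def I'_def by blast
    next
      case False
      then show ?thesis unfolding P_def by blast
    qed
    then have "\<Union>P = UNIV" by blast
    moreover have "{} \<notin> P" by (simp add: P_def)
    moreover have "disjoint P"
    proof (rule disjointI)
      fix C D assume CD: "C \<in> P" "D \<in> P" "C \<noteq> D"
      have "E = - (\<Union>i\<in>I. A i) \<or> (\<exists>i\<in>I. E = A i)" if "E \<in> P" for E
        using that by (auto simp: P_def I'_def)
      then consider i j where "i \<in> I" "j \<in> I" "C = A i" "D = A j"
        | i where "i \<in> I" "C = A i" "D = - (\<Union>i\<in>I. A i)"
        | i where "i \<in> I" "D = A i" "C = - (\<Union>i\<in>I. A i)"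
        using CD by metis
      then show "C \<inter> D = {}"
      proof cases
        case (1 i j)
        then show ?thesis using disjoint_family_onD[OF dis, of i j] CD(3) by auto
      qed auto
    qed
    ultimately show "partition_on UNIV P" by (simp add: partition_on_def)
  qed
  have inj: "inj_on A I'" using dis
    unfolding inj_on_def I'_def disjoint_family_on_def by blast
  have "(\<Sum>i\<in>I. \<bar>diff_conv l \<mu> (A i)\<bar>) = (\<Sum>i\<in>I'. \<bar>diff_conv l \<mu> (A i)\<bar>)"
    using I diff_conv_empty[OF l] by (intro sum.mono_neutral_right) (auto simp: I'_def)
  also have "\<dots> = (\<Sum>B\<in>A ` I'. \<bar>diff_conv l \<mu> B\<bar>)" using inj by (simp add: sum.reindex)
  also have "\<dots> \<le> (\<Sum>B\<in>P. \<bar>diff_conv l \<mu> B\<bar>)"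
    using P(1) by (intro sum_mono2) (auto simp: P_def I'_def)
  also have "\<dots> \<le> D_norm l \<mu>"
    unfolding D_norm_def variation_norm_def
  proof (rule cSUP_upper)
    show "bdd_above ((\<lambda>P. \<Sum>A\<in>P. \<bar>diff_conv l \<mu> A\<bar>) ` {P. finite P \<and> P \<subseteq> sets borel \<and> partition_on UNIV P})"
      using sum_abs_diff_conv_le[OF l] by (intro bdd_aboveI2[where M=4]) (auto simp: partition_on_def)
  qed (use P in auto)
  finally show ?thesis .
qed

lemma D_norm_nonneg: "l \<in> {1, 2} \<Longrightarrow> 0 \<le> D_norm l \<mu>"
  using sum_abs_diff_conv_le_D_norm[of l "{}" "\<lambda>_. {}"] by (simp add: disjoint_family_on_def)

end

section \<open>Spline interpolation and smoothing\<close>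

text \<open>
  For \<open>s\<close> the unit step, the ramp and the quadratic ramp, the bracket is respectively the second
  difference of \<open>indicator {k..<k + 1}\<close>, the difference of two hat functions, and the quadratic B-spline
  supported on \<open>{k - 2..k + 1}\<close>; each is the derivative of the next.
\<close>

definition spline :: "(real \<Rightarrow> real) \<Rightarrow> (int \<Rightarrow> real) \<Rightarrow> int set \<Rightarrow> real \<Rightarrow> real" where
  "spline s f S x = (\<Sum>k\<in>S. f k *
     (s (x - of_int k + 2) - 3 * s (x - of_int k + 1) + 3 * s (x - of_int k) - s (x - of_int k - 1)))"

definition step_fun :: "real \<Rightarrow> real" where "step_fun x = indicator {0..} x"
definition ramp :: "real \<Rightarrow> real" where "ramp x = max x 0"
definition quad_ramp :: "real \<Rightarrow> real" where "quad_ramp x = (max x 0)\<^sup>2 / 2"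

lemma step_fun_measurable[measurable]: "step_fun \<in> borel_measurable borel"
  and ramp_measurable[measurable]: "ramp \<in> borel_measurable borel"
  and quad_ramp_measurable[measurable]: "quad_ramp \<in> borel_measurable borel"
  unfolding step_fun_def[abs_def] ramp_def[abs_def] quad_ramp_def[abs_def] by measurable

lemma spline_measurable[measurable]:
  assumes [measurable]: "s \<in> borel_measurable borel"
  shows "spline s f S \<in> borel_measurable borel"
  unfolding spline_def[abs_def] by measurable

text \<open>At integers the quadratic B-spline is nonzero only at its two inner knots, with value
  1/2 at each. This produces the average of neighbouring values.\<close>

lemma quad_ramp_kernel_int:
  "quad_ramp (of_int j + 2) - 3 * quad_ramp (of_int j + 1) + 3 * quad_ramp (of_int j) - quad_ramp (of_int j - 1)
    = (of_bool (j = 0) + of_bool (j = -1)) / 2"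
proof -
  consider "j \<le> -2" | "j = -1" | "j = 0" | "j \<ge> 1" by linarith
  then show ?thesis
  proof cases
    case 1 
    then have "real_of_int j \<le> -2" by linarith
    then show ?thesis using 1 by (simp add: quad_ramp_def max_def)
  next
    case 4
    then have "real_of_int j \<ge> 1" by linarith
    then show ?thesis using 4 by (simp add: quad_ramp_def max_def power2_eq_square field_simps)
  qed (simp_all add: quad_ramp_def max_def)
qed

lemma ramp_kernel_int:
  "ramp (of_int j + 2) - 3 * ramp (of_int j + 1) + 3 * ramp (of_int j) - ramp (of_int j - 1)
    = of_bool (j = -1) - of_bool (j = 0)"
proof -
  consider "j \<le> -2" | "j = -1" | "j = 0" | "j \<ge> 1" by linarith
  then show ?thesis
  proof cases
    case 1 
    then have "real_of_int j \<le> -2" by linarith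
    then show ?thesis using 1 by (simp add: ramp_def max_def)
  next
    case 4
    then have "real_of_int j \<ge> 1" by linarith
    then show ?thesis using 4 by (simp add: ramp_def max_def)
  qed (simp_all add: ramp_def max_def)
qed

lemma sum_of_bool_shift:
  fixes f :: "int \<Rightarrow> real"
  assumes "finite S" "\<And>k. k \<notin> S \<Longrightarrow> f k = 0"
  shows "(\<Sum>k\<in>S. f k * of_bool (m - k = j)) = f (m - j)"
proof -
  have "(\<Sum>k\<in>S. f k * of_bool (m - k = j)) = (\<Sum>k\<in>S. if k = m - j then f k else 0)"
    by (intro sum.cong) auto
  then show ?thesis using assms by simp
qed

lemma spline_quad_ramp_int:
  assumes "finite S" "\<And>k. k \<notin> S \<Longrightarrow> f k = 0"
  shows "spline quad_ramp f S (of_int m) = (f m + f (m + 1)) / 2"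
proof -
  have "spline quad_ramp f S (of_int m) = (\<Sum>k\<in>S. f k * ((of_bool (m - k = 0) + of_bool (m - k = -1)) / 2))"
    unfolding spline_def quad_ramp_kernel_int[symmetric] by simp
  also have "\<dots> = ((\<Sum>k\<in>S. f k * of_bool (m - k = 0)) + (\<Sum>k\<in>S. f k * of_bool (m - k = -1))) / 2"
    unfolding sum.distrib[symmetric] sum_divide_distrib by (intro sum.cong) (auto simp: algebra_simps)
  also have "\<dots> = (f (m - 0) + f (m - -1)) / 2"
    by (subst (1 2) sum_of_bool_shift) (use assms in auto)
  finally show ?thesis by simp
qed

lemma spline_ramp_int:
  assumes "finite S" "\<And>k. k \<notin> S \<Longrightarrow> f k = 0"
  shows "spline ramp f S (of_int m) = f (m + 1) - f m"
proof -
  have "spline ramp f S (of_int m) = (\<Sum>k\<in>S. f k * (of_bool (m - k = -1) - of_bool (m - k = 0)))"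
    unfolding spline_def ramp_kernel_int[symmetric] by simp
  also have "\<dots> = (\<Sum>k\<in>S. f k * of_bool (m - k = -1)) - (\<Sum>k\<in>S. f k * of_bool (m - k = 0))"
    unfolding sum_subtractf[symmetric] by (intro sum.cong) (auto simp: algebra_simps)
  also have "\<dots> = f (m - -1) - f (m - 0)"
    by (subst (1 2) sum_of_bool_shift) (use assms in auto)
  finally show ?thesis by simp
qed

section \<open>Derivatives and rough bounds of the splines\<close>

lemma quad_ramp_has_derivative: "(quad_ramp has_field_derivative ramp x) (at x)"
proof -
  consider "x < 0" | "x = 0" | "0 < x" by linarith
  then show ?thesis
  proof cases
    case 1
    have "((\<lambda>_. 0) has_field_derivative 0) (at x)" by simp
    then have "(quad_ramp has_field_derivative 0) (at x)"
      by (rule has_field_derivative_transform_within_open[where S="{..<0}"])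
        (use 1 in \<open>auto simp: quad_ramp_def max_def\<close>)
    then show ?thesis using 1 by (simp add: ramp_def max_def)
  next
    case 3
    have "((\<lambda>x. x\<^sup>2 / 2) has_field_derivative x) (at x)" by (auto intro!: derivative_eq_intros)
    then have "(quad_ramp has_field_derivative x) (at x)"
      by (rule has_field_derivative_transform_within_open[where S="{0<..}"])
        (use 3 in \<open>auto simp: quad_ramp_def max_def\<close>)
    then show ?thesis using 3 by (simp add: ramp_def max_def)
  next
    case 2
    have "((\<lambda>h. (quad_ramp (0 + h) - quad_ramp 0) / h) \<longlongrightarrow> 0) (at 0)"
    proof (rule Lim_null_comparison)
      show "\<forall>\<^sub>F h in at 0. norm ((quad_ramp (0 + h) - quad_ramp 0) / h) \<le> \<bar>h\<bar>"
        by (intro always_eventually allI) (auto simp: quad_ramp_def max_def power2_eq_square)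
      show "((\<lambda>h::real. \<bar>h\<bar>) \<longlongrightarrow> 0) (at 0)" by (intro tendsto_rabs_zero tendsto_ident_at)
    qed
    then show ?thesis using 2 by (simp add: DERIV_def ramp_def)
  qed
qed

lemma spline_has_derivative:
  "(spline quad_ramp f S has_field_derivative spline ramp f S x) (at x)"
proof -
  have sh: "((\<lambda>x. quad_ramp (x - of_int k + c)) has_field_derivative ramp (x - of_int k + c)) (at x)" for k c
  proof -
    have "((\<lambda>x. x - of_int k + c) has_field_derivative 1) (at x)" by (auto intro!: derivative_eq_intros)
    from DERIV_chain2[OF quad_ramp_has_derivative this] show ?thesis by simp
  qed
  have sh0: "((\<lambda>x. quad_ramp (x - of_int k)) has_field_derivative ramp (x - of_int k)) (at x)" for k
    using sh[of k 0] by simp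
  have sh1: "((\<lambda>x. quad_ramp (x - of_int k - 1)) has_field_derivative ramp (x - of_int k - 1)) (at x)" for k
    using sh[of k "-1"] by simp
  show ?thesis
    unfolding spline_def[abs_def]
    by (intro DERIV_sum DERIV_cmult DERIV_diff DERIV_add sh sh0 sh1)
qed

lemma isCont_ramp: "isCont ramp x"
  unfolding ramp_def[abs_def] by (intro continuous_intros)

lemma isCont_spline_ramp: "isCont (spline ramp f S) x"
  unfolding spline_def[abs_def] by (intro continuous_intros isCont_o2[OF _ isCont_ramp])

text \<open>A crude bound. This one and the next two serve only integrability and the use of
  Fubini's theorem; the constant, which depends on \<open>f\<close> and \<open>S\<close>, does not
  enter the final estimate.\<close>

lemma spline_ramp_bound: "\<bar>spline ramp f S x\<bar> \<le> 4 * (\<Sum>k\<in>S. \<bar>f k\<bar>)"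
proof -
  have "\<bar>ramp (z + 2) - 3 * ramp (z + 1) + 3 * ramp z - ramp (z - 1)\<bar> \<le> 4" for z
    by (auto simp: ramp_def max_def)
  then have "\<bar>spline ramp f S x\<bar> \<le> (\<Sum>k\<in>S. \<bar>f k\<bar> * 4)"
    unfolding spline_def by (intro order_trans[OF sum_abs] sum_mono) (auto simp: abs_mult intro!: mult_left_mono)
  then show ?thesis by (simp add: sum_distrib_left mult.commute)
qed

lemma spline_step_bound: "\<bar>spline step_fun f S x\<bar> \<le> 4 * (\<Sum>k\<in>S. \<bar>f k\<bar>)"
proof -
  have "\<bar>step_fun (z + 2) - 3 * step_fun (z + 1) + 3 * step_fun z - step_fun (z - 1)\<bar> \<le> 4" for z
    by (auto simp: step_fun_def indicator_def)
  then have "\<bar>spline step_fun f S x\<bar> \<le> (\<Sum>k\<in>S. \<bar>f k\<bar> * 4)"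
    unfolding spline_def by (intro order_trans[OF sum_abs] sum_mono) (auto simp: abs_mult intro!: mult_left_mono)
  then show ?thesis by (simp add: sum_distrib_left mult.commute)
qed

lemma spline_quad_ramp_lipschitz:
  "\<bar>spline quad_ramp f S x - spline quad_ramp f S y\<bar> \<le> 4 * (\<Sum>k\<in>S. \<bar>f k\<bar>) * \<bar>x - y\<bar>"
proof -
  have "norm (spline quad_ramp f S x - spline quad_ramp f S y) \<le> 4 * (\<Sum>k\<in>S. \<bar>f k\<bar>) * norm (x - y)"
    by (rule field_differentiable_bound[where S=UNIV and f'="spline ramp f S"])
      (use spline_has_derivative spline_ramp_bound in auto)
  then show ?thesis by simp
qed

text \<open>The step function is not continuous, so the integral is computed as the length of an
  interval cut off at \<open>- c\<close>.\<close>

lemma ramp_diff_integral: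
  assumes "y \<le> x"
  shows "has_bochner_integral lborel (\<lambda>u. indicator {y..x} u * step_fun (u + c)) (ramp (x + c) - ramp (y + c))"
proof -
  have eq: "(\<lambda>u. indicator {y..x} u * step_fun (u + c)) = indicator {max y (- c)..x}"
    by (auto simp: step_fun_def indicator_def fun_eq_iff)
  have "has_bochner_integral lborel (indicator {max y (- c)..x} :: real \<Rightarrow> real) (measure lborel {max y (- c)..x})"
    by (rule has_bochner_integral_real_indicator) (auto simp: emeasure_lborel_Icc_eq)
  moreover have "measure lborel {max y (- c)..x} = ramp (x + c) - ramp (y + c)"
    using assms by (auto simp: measure_def emeasure_lborel_Icc_eq ramp_def max_def)
  ultimately show ?thesis unfolding eq by simp
qed

lemma spline_ramp_diff_integral:
  assumes "y \<le> x"
  shows "spline ramp f S (w + x) - spline ramp f S (w + y)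
    = (\<integral>u. indicator {y..x} u * spline step_fun f S (w + u) \<partial>lborel)"
proof -
  define d where "d = (\<lambda>k c. ramp (x + (w - of_int k + c)) - ramp (y + (w - of_int k + c)))"
  have b: "has_bochner_integral lborel (\<lambda>u. indicator {y..x} u * step_fun (u + (w - of_int k + c))) (d k c)" for k c
    unfolding d_def by (rule ramp_diff_integral[OF assms])
  have "has_bochner_integral lborel (\<lambda>u. \<Sum>k\<in>S. f k *
      (indicator {y..x} u * step_fun (u + (w - of_int k + 2)) - 3 * (indicator {y..x} u * step_fun (u + (w - of_int k + 1)))
       + 3 * (indicator {y..x} u * step_fun (u + (w - of_int k + 0))) - indicator {y..x} u * step_fun (u + (w - of_int k + (-1)))))
      (\<Sum>k\<in>S. f k * (d k 2 - 3 * d k 1 + 3 * d k 0 - d k (- 1)))"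
    by (intro has_bochner_integral_sum has_bochner_integral_mult_right has_bochner_integral_diff
        has_bochner_integral_add b)
  moreover have "(\<lambda>u. \<Sum>k\<in>S. f k *
      (indicator {y..x} u * step_fun (u + (w - of_int k + 2)) - 3 * (indicator {y..x} u * step_fun (u + (w - of_int k + 1)))
       + 3 * (indicator {y..x} u * step_fun (u + (w - of_int k + 0))) - indicator {y..x} u * step_fun (u + (w - of_int k + (-1)))))
    = (\<lambda>u. indicator {y..x} u * spline step_fun f S (w + u))"
    unfolding spline_def sum_distrib_left
    by (intro ext sum.cong) (auto simp: algebra_simps)
  moreover have "(\<Sum>k\<in>S. f k * (d k 2 - 3 * d k 1 + 3 * d k 0 - d k (- 1)))
     = spline ramp f S (w + x) - spline ramp f S (w + y)"
    unfolding spline_def sum_subtractf[symmetric] d_def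
    by (intro sum.cong) (auto simp: algebra_simps)
  ultimately show ?thesis by (simp add: has_bochner_integral_integral_eq)
qed

text \<open>\<open>spline step_fun\<close> is a second difference. For \<open>l = 2\<close> both
  differences are thrown on the law and \<open>f\<close> itself has to be bounded; for
  \<open>l = 1\<close> one of them stays with \<open>f\<close>.\<close>

definition smooth_bound :: "nat \<Rightarrow> (int \<Rightarrow> real) \<Rightarrow> real \<Rightarrow> bool" where
  "smooth_bound l f C \<longleftrightarrow> (if l = 1 then \<forall>k. \<bar>f (k + 1) - f k\<bar> \<le> C else \<forall>k. \<bar>f k\<bar> \<le> C)"

definition cell :: "int \<Rightarrow> real \<Rightarrow> real set" where
  "cell k u = {of_int k - u ..< of_int k + 1 - u}"

lemma cell_borel[measurable]: "cell k u \<in> sets borel" by (simp add: cell_def)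

lemma disjoint_cells: "disjoint_family_on (\<lambda>k. cell k u) S"
proof (unfold disjoint_family_on_def, intro ballI impI)
  fix j k :: int assume "j \<noteq> k"
  then have "real_of_int j + 1 \<le> of_int k \<or> real_of_int k + 1 \<le> of_int j" by linarith
  then show "cell j u \<inter> cell k u = {}" by (auto simp: cell_def)
qed

text \<open>The real translation \<open>u\<close> is absorbed by the cells, so that only integer
  shifts of \<open>w\<close> remain, and these are the shifts in \<open>diff_conv\<close>.\<close>

lemma spline_step_second_diff:
  "spline step_fun f S (w + u) = (\<Sum>k\<in>S. f k *
    (indicator (cell k u) (w + 2) - 2 * indicator (cell k u) (w + 1) + indicator (cell k u) w))"
  unfolding spline_def by (intro sum.cong) (auto simp: step_fun_def cell_def indicator_def)

text \<open>Summation by parts. The index set gains the left neighbours of \<open>S\<close>, where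
  \<open>f (k + 1)\<close> may be nonzero although \<open>f k\<close> is zero.\<close>

lemma spline_step_first_diff:
  assumes "finite S" "\<And>k. k \<notin> S \<Longrightarrow> f k = 0"
  shows "spline step_fun f S (w + u) = (\<Sum>k\<in>S \<union> (\<lambda>k. k - 1) ` S. (f (k + 1) - f k) *
    (indicator (cell k u) (w + 1) - indicator (cell k u) w))"
proof -
  define T where "T = S \<union> (\<lambda>k. k - 1) ` S"
  define e :: "int \<Rightarrow> real" where "e = (\<lambda>k. indicator (cell k u) (w + 1) - indicator (cell k u) w)"
  have "finite T" using assms by (auto simp: T_def)
  have "(\<Sum>k\<in>T. (f (k + 1) - f k) * e k) = (\<Sum>k\<in>T. f (k + 1) * e k) - (\<Sum>k\<in>T. f k * e k)"
    by (simp add: left_diff_distrib sum_subtractf)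
  also have "(\<Sum>k\<in>T. f k * e k) = (\<Sum>k\<in>S. f k * e k)"
    using \<open>finite T\<close> assms by (intro sum.mono_neutral_right) (auto simp: T_def)
  also have "(\<Sum>k\<in>T. f (k + 1) * e k) = (\<Sum>k\<in>(\<lambda>k. k - 1) ` S. f (k + 1) * e k)"
  proof (rule sum.mono_neutral_right)
    show "\<forall>k\<in>T - (\<lambda>k. k - 1) ` S. f (k + 1) * e k = 0"
    proof
      fix k assume "k \<in> T - (\<lambda>k. k - 1) ` S"
      then have "k + 1 \<notin> S" by (force intro: image_eqI[of _ _ "k + 1"])
      then show "f (k + 1) * e k = 0" using assms by simp
    qed
  qed (use \<open>finite T\<close> in \<open>auto simp: T_def\<close>)
  also have "\<dots> = (\<Sum>k\<in>S. f k * e (k - 1))" by (subst sum.reindex) (auto simp: inj_on_def)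
  also have "\<dots> - (\<Sum>k\<in>S. f k * e k) = (\<Sum>k\<in>S. f k * (e (k - 1) - e k))"
    by (simp add: right_diff_distrib sum_subtractf)
  \<comment> \<open>Moving a cell one unit to the left has the same effect as moving the point one
    unit to the right.\<close>
  also have "\<dots> = spline step_fun f S (w + u)"
    unfolding spline_step_second_diff e_def
    by (intro sum.cong) (auto simp: cell_def indicator_def)
  finally show ?thesis unfolding T_def e_def by simp
qed

section \<open>Averages of the splines against a law\<close>

context
  fixes \<mu> :: "real measure"
  assumes prob: "prob_space \<mu>" and sets_\<mu>[measurable_cong]: "sets \<mu> = sets borel"
begin

text \<open>The smoothing estimate. After integration the spline is a combination of
  \<open>diff_conv l \<mu>\<close> over the disjoint cells with coefficients at most
  \<open>C\<close>, and a finite disjoint family costs at most one \<open>D_norm\<close>.\<close>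

lemma integral_spline_step_bound:
  assumes l: "l \<in> {1, 2}" and S: "finite S" "\<And>k. k \<notin> S \<Longrightarrow> f k = 0" and C: "smooth_bound l f C"
  shows "\<bar>\<integral>w. spline step_fun f S (w + u) \<partial>\<mu>\<bar> \<le> C * D_norm l \<mu>"
proof -
  interpret prob_space \<mu> by (rule prob)
  have i[simp]: "integrable \<mu> (\<lambda>w. indicator (cell k u) (w + c) :: real)" for k c
    by (rule integrable_const_bound[where B=1]) (auto simp: indicator_def)
  have i0[simp]: "integrable \<mu> (\<lambda>w. indicator (cell k u) w :: real)" for k using i[of k 0] by simp
  have C0: "0 \<le> C" using C by (auto simp: smooth_bound_def split: if_splits intro: order_trans[OF abs_ge_zero])
  have main: "\<bar>\<Sum>k\<in>T. g k * diff_conv l \<mu> (cell k u)\<bar> \<le> C * D_norm l \<mu>"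
    if "finite T" "\<And>k. \<bar>g k\<bar> \<le> C" for T and g :: "int \<Rightarrow> real"
  proof -
    have "\<bar>\<Sum>k\<in>T. g k * diff_conv l \<mu> (cell k u)\<bar> \<le> (\<Sum>k\<in>T. C * \<bar>diff_conv l \<mu> (cell k u)\<bar>)"
      using that by (intro order_trans[OF sum_abs] sum_mono) (auto simp: abs_mult intro!: mult_right_mono)
    also have "\<dots> = C * (\<Sum>k\<in>T. \<bar>diff_conv l \<mu> (cell k u)\<bar>)" by (simp add: sum_distrib_left)
    also have "\<dots> \<le> C * D_norm l \<mu>"
      using that C0 by (intro mult_left_mono sum_abs_diff_conv_le_D_norm[OF prob sets_\<mu> l] disjoint_cells) auto
    finally show ?thesis .
  qed
  consider "l = 1" | "l = 2" using l by auto
  then show ?thesis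
  proof cases
    case 1
    have *: "(\<integral>w. (\<Sum>k\<in>T. g k * (indicator (cell k u) (w + 1) - indicator (cell k u) w)) \<partial>\<mu>)
        = (\<Sum>k\<in>T. g k * diff_conv 1 \<mu> (cell k u))" for T and g :: "int \<Rightarrow> real"
      unfolding diff_conv_1_integral[OF prob sets_\<mu> cell_borel]
      by (subst Bochner_Integration.integral_sum) (auto intro!: Bochner_Integration.integrable_diff i i0)
    have sp: "spline step_fun f S (w + u) = (\<Sum>k\<in>S \<union> (\<lambda>k. k - 1) ` S. (f (k + 1) - f k) *
        (indicator (cell k u) (w + 1) - indicator (cell k u) w))" for w
      by (rule spline_step_first_diff) (use S in auto)
    have "(\<integral>w. spline step_fun f S (w + u) \<partial>\<mu>)
      = (\<Sum>k\<in>S \<union> (\<lambda>k. k - 1) ` S. (f (k + 1) - f k) * diff_conv l \<mu> (cell k u))"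
      unfolding sp 1 by (rule *)
    then show ?thesis using main[of _ "\<lambda>k. f (k + 1) - f k"] S C 1 by (simp add: smooth_bound_def)
  next
    case 2
    have "(\<integral>w. spline step_fun f S (w + u) \<partial>\<mu>) = (\<Sum>k\<in>S. f k * diff_conv l \<mu> (cell k u))"
      unfolding spline_step_second_diff 2 by (simp add: diff_conv_2_integral[OF prob sets_\<mu>])
    then show ?thesis using main[of _ "\<lambda>k. f k"] S C 2 by (simp add: smooth_bound_def)
  qed
qed

text \<open>The order of integration matters: the absolute value is taken only after averaging over
  \<open>\<mu>\<close>, since it is this average, and not the integrand, that is small.\<close>

lemma Fubini_segment_bound:
  fixes g :: "real \<Rightarrow> real \<Rightarrow> real"
  assumes g[measurable]: "(\<lambda>(w, u). g w u) \<in> borel_measurable (borel \<Otimes>\<^sub>M borel)"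
    and B: "\<And>w u. \<bar>g w u\<bar> \<le> B"
    and h: "integrable lborel (\<lambda>u. indicator {a..b} u * h u)"
    and le: "\<And>u. a \<le> u \<Longrightarrow> u \<le> b \<Longrightarrow> \<bar>\<integral>w. g w u \<partial>\<mu>\<bar> \<le> h u"
  shows "\<bar>\<integral>w. (\<integral>u. indicator {a..b} u * g w u \<partial>lborel) \<partial>\<mu>\<bar> \<le> (\<integral>u. indicator {a..b} u * h u \<partial>lborel)"
proof -
  interpret prob_space \<mu> by (rule prob)
  interpret P: pair_sigma_finite \<mu> lborel by standard
  have int: "integrable (\<mu> \<Otimes>\<^sub>M lborel) (\<lambda>(w, u). indicator {a..b} u * g w u)"
  proof (rule integrableI_bounded_set[where A="UNIV \<times> {a..b}" and B=B])
    have "emeasure (\<mu> \<Otimes>\<^sub>M lborel) (UNIV \<times> {a..b}) = emeasure \<mu> UNIV * emeasure lborel {a..b}"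
      using sets_eq_imp_space_eq[OF sets_\<mu>] sets.top[of \<mu>] by (intro lborel.emeasure_pair_measure_Times) auto
    moreover have "emeasure \<mu> UNIV < top" using emeasure_finite[of UNIV] by (simp only: less_top)
    ultimately show "emeasure (\<mu> \<Otimes>\<^sub>M lborel) (UNIV \<times> {a..b}) < \<infinity>"
      by (simp add: emeasure_lborel_Icc_eq ennreal_mult_less_top)
    show "UNIV \<times> {a..b} \<in> sets (\<mu> \<Otimes>\<^sub>M lborel)"
      using sets_eq_imp_space_eq[OF sets_\<mu>] sets.top[of \<mu>] by auto
    show "AE x in \<mu> \<Otimes>\<^sub>M lborel. x \<in> UNIV \<times> {a..b} \<longrightarrow> norm (case x of (w, u) \<Rightarrow> indicator {a..b} u * g w u) \<le> B"
      using B by (auto simp: abs_mult)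
  qed (auto simp: indicator_def)
  have "(\<integral>w. (\<integral>u. indicator {a..b} u * g w u \<partial>lborel) \<partial>\<mu>) = (\<integral>u. (\<integral>w. indicator {a..b} u * g w u \<partial>\<mu>) \<partial>lborel)"
    using P.Fubini_integral[OF int] by simp
  also have "\<bar>\<dots>\<bar> \<le> (\<integral>u. \<bar>\<integral>w. indicator {a..b} u * g w u \<partial>\<mu>\<bar> \<partial>lborel)" by (rule integral_abs_bound)
  also have "\<dots> \<le> (\<integral>u. indicator {a..b} u * h u \<partial>lborel)"
  proof (rule integral_mono)
    show "integrable lborel (\<lambda>u. \<bar>\<integral>w. indicator {a..b} u * g w u \<partial>\<mu>\<bar>)"
      using P.integrable_snd[OF int] by simp
  qed (use h le in \<open>auto simp: indicator_def\<close>)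
  finally show ?thesis .
qed

lemma segment_integral_const:
  "a \<le> b \<Longrightarrow> integrable lborel (\<lambda>u. indicator {a..b} u * (c::real))"
  "a \<le> b \<Longrightarrow> (\<integral>u. indicator {a..b} u * (c::real) \<partial>lborel) = c * (b - a)"
  by (auto simp: measure_def emeasure_lborel_Icc_eq)

lemma segment_integral_linear:
  "has_bochner_integral lborel (\<lambda>u. indicator {0..1} u * (c * u)) (c / 2 :: real)"
proof -
  have "has_bochner_integral lborel (\<lambda>u. (c * u) * indicator {0..1} u) (c * 1\<^sup>2 / 2 - c * 0\<^sup>2 / 2 :: real)"
    by (rule has_bochner_integral_FTC_Icc_real) (auto intro!: derivative_eq_intros)
  then show ?thesis by (simp add: mult.commute)
qed

context
  fixes l :: nat and f :: "int \<Rightarrow> real" and S :: "int set" and C :: real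
  assumes l: "l \<in> {1, 2}" and S: "finite S" "\<And>k. k \<notin> S \<Longrightarrow> f k = 0" and C: "smooth_bound l f C"
begin

text \<open>The increment is the integral of \<open>spline step_fun\<close> over the segment from
  \<open>y\<close> to \<open>x\<close>, each point of which obeys the smoothing estimate.\<close>

lemma integral_spline_ramp_lipschitz:
  "\<bar>\<integral>w. spline ramp f S (w + x) - spline ramp f S (w + y) \<partial>\<mu>\<bar> \<le> C * D_norm l \<mu> * \<bar>x - y\<bar>"
proof -
  have *: "\<bar>\<integral>w. spline ramp f S (w + x) - spline ramp f S (w + y) \<partial>\<mu>\<bar> \<le> C * D_norm l \<mu> * (x - y)" if "y \<le> x" for x y
  proof -
    have "\<bar>\<integral>w. spline ramp f S (w + x) - spline ramp f S (w + y) \<partial>\<mu>\<bar>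
        = \<bar>\<integral>w. (\<integral>u. indicator {y..x} u * spline step_fun f S (w + u) \<partial>lborel) \<partial>\<mu>\<bar>"
      by (simp add: spline_ramp_diff_integral[OF that])
    also have "\<dots> \<le> (\<integral>u. indicator {y..x} u * (C * D_norm l \<mu>) \<partial>lborel)"
      by (rule Fubini_segment_bound[OF _ spline_step_bound])
        (use that integral_spline_step_bound[OF l S C] in \<open>auto intro!: segment_integral_const\<close>)
    finally show ?thesis unfolding segment_integral_const(2)[OF that] .
  qed
  show ?thesis
  proof (cases "y \<le> x")
    case True
    then show ?thesis using *[OF True] by simp
  next
    case False
    have "(\<integral>w. spline ramp f S (w + x) - spline ramp f S (w + y) \<partial>\<mu>)
      = - (\<integral>w. spline ramp f S (w + y) - spline ramp f S (w + x) \<partial>\<mu>)"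
      by (subst Bochner_Integration.integral_minus[symmetric]) simp
    then show ?thesis using *[of x y] False by simp
  qed
qed

text \<open>The remainder is the integral over \<open>s\<close> in \<open>{0..1}\<close> of
  \<open>h\<close> times the increment of the derivative over \<open>s * h\<close>. The averaged
  Lipschitz bound contributes the second factor \<open>s * h\<close>, and integrating
  \<open>s\<close> gives the factor 1/2.\<close>

lemma integral_spline_taylor:
  "\<bar>\<integral>w. spline quad_ramp f S (w + y + h) - spline quad_ramp f S (w + y) - h * spline ramp f S (w + y) \<partial>\<mu>\<bar>
    \<le> C * D_norm l \<mu> * h\<^sup>2 / 2"
proof -
  let ?\<gamma> = "spline ramp f S" and ?G = "spline quad_ramp f S"
  have eq: "?G (z + h) - ?G z - h * ?\<gamma> z = (\<integral>s. indicator {0..1} s * (h * (?\<gamma> (z + s * h) - ?\<gamma> z)) \<partial>lborel)" for z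
  proof -
    have "(\<integral>s. (h * (?\<gamma> (z + s * h) - ?\<gamma> z)) * indicator {0..1} s \<partial>lborel)
      = (?G (z + 1 * h) - 1 * (h * ?\<gamma> z)) - (?G (z + 0 * h) - 0 * (h * ?\<gamma> z))"
    proof (rule integral_FTC_Icc_real)
      fix s :: real
      have "((\<lambda>s. ?G (z + s * h)) has_field_derivative ?\<gamma> (z + s * h) * h) (at s)"
        by (rule DERIV_chain2[OF spline_has_derivative]) (auto intro!: derivative_eq_intros)
      then show "((\<lambda>s. ?G (z + s * h) - s * (h * ?\<gamma> z)) has_field_derivative h * (?\<gamma> (z + s * h) - ?\<gamma> z)) (at s)"
        by (auto intro!: derivative_eq_intros simp: algebra_simps)
      show "isCont (\<lambda>s. h * (?\<gamma> (z + s * h) - ?\<gamma> z)) s"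
        by (intro continuous_intros isCont_o2[OF _ isCont_spline_ramp])
    qed simp
    then show ?thesis by (simp add: mult.commute)
  qed
  have "\<bar>\<integral>w. ?G (w + y + h) - ?G (w + y) - h * ?\<gamma> (w + y) \<partial>\<mu>\<bar>
      = \<bar>\<integral>w. (\<integral>s. indicator {0..1} s * (h * (?\<gamma> (w + y + s * h) - ?\<gamma> (w + y))) \<partial>lborel) \<partial>\<mu>\<bar>"
    by (simp only: eq)
  also have "\<dots> \<le> (\<integral>s. indicator {0..1} s * ((C * D_norm l \<mu> * h\<^sup>2) * s) \<partial>lborel)"
  proof (rule Fubini_segment_bound)
    show "\<bar>h * (?\<gamma> (w + y + s * h) - ?\<gamma> (w + y))\<bar> \<le> \<bar>h\<bar> * (8 * (\<Sum>k\<in>S. \<bar>f k\<bar>))" for w s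
      unfolding abs_mult
      by (intro mult_left_mono order_trans[OF abs_triangle_ineq4])
        (use spline_ramp_bound[of f S "w + y + s * h"] spline_ramp_bound[of f S "w + y"] in auto)
    show "integrable lborel (\<lambda>u. indicator {0..1} u * (C * D_norm l \<mu> * h\<^sup>2 * u))"
      using segment_integral_linear by (rule integrable.intros)
    fix s :: real assume s: "0 \<le> s" "s \<le> 1"
    have "\<bar>\<integral>w. h * (?\<gamma> (w + y + s * h) - ?\<gamma> (w + y)) \<partial>\<mu>\<bar>
        = \<bar>h\<bar> * \<bar>\<integral>w. ?\<gamma> (w + (y + s * h)) - ?\<gamma> (w + y) \<partial>\<mu>\<bar>"
      by (simp add: abs_mult add.assoc)
    also have "\<dots> \<le> \<bar>h\<bar> * (C * D_norm l \<mu> * \<bar>(y + s * h) - y\<bar>)"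
      by (intro mult_left_mono integral_spline_ramp_lipschitz) auto
    also have "\<dots> = C * D_norm l \<mu> * h\<^sup>2 * s"
      using s by (simp add: abs_mult power2_eq_square)
    finally show "\<bar>\<integral>w. h * (?\<gamma> (w + y + s * h) - ?\<gamma> (w + y)) \<partial>\<mu>\<bar> \<le> C * D_norm l \<mu> * h\<^sup>2 * s" .
  qed measurable
  also have "\<dots> = C * D_norm l \<mu> * h\<^sup>2 / 2"
    using segment_integral_linear by (rule has_bochner_integral_integral_eq)
  finally show ?thesis .
qed

end

end

section \<open>Disintegration along a conditional law\<close>

context
  fixes M F :: "'w measure" and X :: "'w \<Rightarrow> real" and K :: "'w \<Rightarrow> real measure"
  assumes prob: "prob_space M" and F: "subalgebra M F" and X[measurable]: "X \<in> borel_measurable M"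
    and K: "is_cond_law M F X K"
begin

lemma cond_law_kernel: "K \<in> F \<rightarrow>\<^sub>M prob_algebra borel"
  using K by (simp add: is_cond_law_def)

lemma cond_law_prob: "\<omega> \<in> space M \<Longrightarrow> prob_space (K \<omega>)"
  and cond_law_sets: "\<omega> \<in> space M \<Longrightarrow> sets (K \<omega>) = sets borel"
  using measurable_space[OF cond_law_kernel, of \<omega>] F by (auto simp: subalgebra_def space_prob_algebra)

lemma joint_kernel: "(\<lambda>\<omega>. distr (K \<omega>) (F \<Otimes>\<^sub>M borel) (Pair \<omega>)) \<in> F \<rightarrow>\<^sub>M prob_algebra (F \<Otimes>\<^sub>M borel)"
proof (rule measurable_distr_prob_space2[OF cond_law_kernel])
  have "(\<lambda>(x, y). (x, y)) = (\<lambda>z :: 'w \<times> real. z)" by auto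
  then show "(\<lambda>(x, y). (x, y)) \<in> F \<Otimes>\<^sub>M borel \<rightarrow>\<^sub>M F \<Otimes>\<^sub>M (borel :: real measure)" by simp
qed

lemma joint_kernel_M: "(\<lambda>\<omega>. distr (K \<omega>) (F \<Otimes>\<^sub>M borel) (Pair \<omega>)) \<in> M \<rightarrow>\<^sub>M subprob_algebra (F \<Otimes>\<^sub>M borel)"
  by (rule measurable_from_subalg[OF F measurable_prob_algebraD[OF joint_kernel]])

lemma joint_measurable: "(\<lambda>\<omega>. (\<omega>, X \<omega>)) \<in> M \<rightarrow>\<^sub>M F \<Otimes>\<^sub>M borel"
  using measurable_from_subalg[OF F measurable_ident] by (intro measurable_Pair X) (simp add: id_def)

lemma Pair_measurable_kernel: "\<omega> \<in> space M \<Longrightarrow> Pair \<omega> \<in> K \<omega> \<rightarrow>\<^sub>M F \<Otimes>\<^sub>M borel"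
  using F cond_law_sets[of \<omega>]
  by (subst measurable_cong_sets[of _ borel]) (auto simp: subalgebra_def intro!: measurable_Pair)

text \<open>A conditional law is specified only set by set through conditional expectations. On a
  rectangle \<open>A \<times> B\<close> with \<open>A\<close> in \<open>F\<close> this is the
  defining property of the conditional expectation, and rectangles form a generator stable under
  intersection.\<close>

lemma joint_law_eq:
  "distr M (F \<Otimes>\<^sub>M borel) (\<lambda>\<omega>. (\<omega>, X \<omega>)) = M \<bind> (\<lambda>\<omega>. distr (K \<omega>) (F \<Otimes>\<^sub>M borel) (Pair \<omega>))"
proof (rule measure_eqI_generator_eq)
  interpret prob_space M by (rule prob)
  interpret finite_measure_subalgebra M F by standard (rule F)
  have spF: "space F = space M" using F by (auto simp: subalgebra_def)
  let ?E = "{a \<times> b |a b. a \<in> sets F \<and> b \<in> sets (borel :: real measure)}"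
  show "Int_stable ?E" by (rule Int_stable_pair_measure_generator)
  show "?E \<subseteq> Pow (space F \<times> space borel)" using sets.sets_into_space by auto
  show "sets (distr M (F \<Otimes>\<^sub>M borel) (\<lambda>\<omega>. (\<omega>, X \<omega>))) = sigma_sets (space F \<times> space borel) ?E"
    by (simp add: sets_pair_measure)
  show "sets (M \<bind> (\<lambda>\<omega>. distr (K \<omega>) (F \<Otimes>\<^sub>M borel) (Pair \<omega>))) = sigma_sets (space F \<times> space borel) ?E"
    using not_empty by (subst sets_bind[where N="F \<Otimes>\<^sub>M borel"]) (simp_all add: sets_pair_measure)
  show "range (\<lambda>_::nat. space F \<times> space borel) \<subseteq> ?E" using sets.top[of F] sets.top[of borel] by blast
  interpret T: prob_space "distr M (F \<Otimes>\<^sub>M borel) (\<lambda>\<omega>. (\<omega>, X \<omega>))"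
    by (rule prob_space_distr[OF joint_measurable])
  show "emeasure (distr M (F \<Otimes>\<^sub>M borel) (\<lambda>\<omega>. (\<omega>, X \<omega>))) (space F \<times> space borel) \<noteq> \<infinity>" for i :: nat
    by (simp add: T.emeasure_finite)
  fix Z assume "Z \<in> ?E"
  then obtain A B where Z: "Z = A \<times> B" and A: "A \<in> sets F" and B[measurable]: "B \<in> sets borel" by auto
  have ZS: "Z \<in> sets (F \<Otimes>\<^sub>M borel)" using A B Z by auto
  have AM[measurable]: "A \<in> sets M" using A F by (auto simp: subalgebra_def)
  define e where "e = real_cond_exp M F (\<lambda>\<omega>. indicator B (X \<omega>))"
  have iB: "integrable M (\<lambda>\<omega>. indicator B (X \<omega>) :: real)"
    by (rule integrable_const_bound[where B=1]) (auto simp: indicator_def)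
  have Ke: "AE \<omega> in M. measure (K \<omega>) B = e \<omega>"
    using K B unfolding is_cond_law_def e_def by blast
  have ie: "integrable M (\<lambda>\<omega>. indicator A \<omega> * e \<omega>)"
    using integrable_mult_indicator[OF AM real_cond_exp_int(1)[OF iB]] by (simp add: e_def)
  have en: "AE \<omega> in M. 0 \<le> e \<omega>" unfolding e_def by (rule real_cond_exp_pos) auto
  have "emeasure (M \<bind> (\<lambda>\<omega>. distr (K \<omega>) (F \<Otimes>\<^sub>M borel) (Pair \<omega>))) Z
      = (\<integral>\<^sup>+\<omega>. emeasure (distr (K \<omega>) (F \<Otimes>\<^sub>M borel) (Pair \<omega>)) Z \<partial>M)"
    by (rule emeasure_bind[OF not_empty joint_kernel_M ZS])
  also have "\<dots> = (\<integral>\<^sup>+\<omega>. ennreal (indicator A \<omega> * measure (K \<omega>) B) \<partial>M)"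
  proof (rule nn_integral_cong)
    fix \<omega> assume \<omega>: "\<omega> \<in> space M"
    interpret Kw: prob_space "K \<omega>" by (rule cond_law_prob[OF \<omega>])
    have "space (K \<omega>) = UNIV" using sets_eq_imp_space_eq[OF cond_law_sets[OF \<omega>]] by simp
    then have "emeasure (distr (K \<omega>) (F \<Otimes>\<^sub>M borel) (Pair \<omega>)) Z = emeasure (K \<omega>) (Pair \<omega> -` Z)"
      using emeasure_distr[OF Pair_measurable_kernel[OF \<omega>] ZS] by simp
    also have "Pair \<omega> -` Z = (if \<omega> \<in> A then B else {})" using Z by auto
    finally show "emeasure (distr (K \<omega>) (F \<Otimes>\<^sub>M borel) (Pair \<omega>)) Z = ennreal (indicator A \<omega> * measure (K \<omega>) B)"
      by (simp add: Kw.emeasure_eq_measure)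
  qed
  also have "\<dots> = (\<integral>\<^sup>+\<omega>. ennreal (indicator A \<omega> * e \<omega>) \<partial>M)"
    by (rule nn_integral_cong_AE) (use Ke in \<open>auto elim!: eventually_mono\<close>)
  also have "\<dots> = ennreal (\<integral>\<omega>. indicator A \<omega> * e \<omega> \<partial>M)"
    by (rule nn_integral_eq_integral[OF ie]) (use en in \<open>auto elim!: eventually_mono\<close>)
  also have "(\<integral>\<omega>. indicator A \<omega> * e \<omega> \<partial>M) = (\<integral>\<omega>. indicator A \<omega> * indicator B (X \<omega>) \<partial>M)"
    using real_cond_exp_intA[OF iB A] unfolding e_def set_lebesgue_integral_def by simp
  also have "(\<lambda>\<omega>. indicator A \<omega> * indicator B (X \<omega>)) = (indicator (A \<inter> X -` B) :: 'w \<Rightarrow> real)"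
    by (auto simp: indicator_def fun_eq_iff)
  also have "(\<integral>\<omega>. (indicator (A \<inter> X -` B) \<omega> :: real) \<partial>M) = measure M (A \<inter> X -` B)"
  proof -
    have "A \<inter> X -` B \<inter> space M = A \<inter> X -` B" using sets.sets_into_space[OF AM] by auto
    then show ?thesis by simp
  qed
  also have "ennreal (measure M (A \<inter> X -` B)) = emeasure (distr M (F \<Otimes>\<^sub>M borel) (\<lambda>\<omega>. (\<omega>, X \<omega>))) Z"
  proof -
    have "(\<lambda>\<omega>. (\<omega>, X \<omega>)) -` Z \<inter> space M = A \<inter> X -` B"
      using sets.sets_into_space[OF AM] Z by auto
    then show ?thesis using emeasure_distr[OF joint_measurable ZS] by (simp add: emeasure_eq_measure)
  qed
  finally show "emeasure (distr M (F \<Otimes>\<^sub>M borel) (\<lambda>\<omega>. (\<omega>, X \<omega>))) Z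
      = emeasure (M \<bind> (\<lambda>\<omega>. distr (K \<omega>) (F \<Otimes>\<^sub>M borel) (Pair \<omega>))) Z" by simp
qed (use F in \<open>auto simp: subalgebra_def\<close>)

lemma nn_integral_disintegration:
  assumes [measurable]: "\<phi> \<in> borel_measurable (F \<Otimes>\<^sub>M borel)"
  shows "(\<integral>\<^sup>+\<omega>. \<phi> (\<omega>, X \<omega>) \<partial>M) = (\<integral>\<^sup>+\<omega>. (\<integral>\<^sup>+w. \<phi> (\<omega>, w) \<partial>K \<omega>) \<partial>M)"
proof -
  have "(\<integral>\<^sup>+\<omega>. \<phi> (\<omega>, X \<omega>) \<partial>M) = (\<integral>\<^sup>+z. \<phi> z \<partial>distr M (F \<Otimes>\<^sub>M borel) (\<lambda>\<omega>. (\<omega>, X \<omega>)))"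
    by (rule nn_integral_distr[symmetric, OF joint_measurable]) simp
  also have "\<dots> = (\<integral>\<^sup>+\<omega>. (\<integral>\<^sup>+z. \<phi> z \<partial>distr (K \<omega>) (F \<Otimes>\<^sub>M borel) (Pair \<omega>)) \<partial>M)"
    unfolding joint_law_eq by (rule nn_integral_bind[OF _ joint_kernel_M]) simp
  also have "\<dots> = (\<integral>\<^sup>+\<omega>. (\<integral>\<^sup>+w. \<phi> (\<omega>, w) \<partial>K \<omega>) \<partial>M)"
    by (intro nn_integral_cong nn_integral_distr Pair_measurable_kernel) simp_all
  finally show ?thesis .
qed

lemma nn_integral_kernel_measurable:
  assumes [measurable]: "\<phi> \<in> borel_measurable (F \<Otimes>\<^sub>M borel)"
  shows "(\<lambda>\<omega>. \<integral>\<^sup>+w. \<phi> (\<omega>, w) \<partial>K \<omega>) \<in> borel_measurable M"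
proof (rule measurable_from_subalg[OF F])
  show "(\<lambda>\<omega>. \<integral>\<^sup>+w. \<phi> (\<omega>, w) \<partial>K \<omega>) \<in> borel_measurable F"
    by (rule nn_integral_measurable_subprob_algebra2[where N=borel])
      (use measurable_prob_algebraD[OF cond_law_kernel] in simp_all)
qed

text \<open>The disintegration formula is available for nonnegative functions, so positive and
  negative parts are treated separately. Their kernel integrals are almost surely finite, hence
  their difference is the kernel integral of \<open>\<phi>\<close>.\<close>

lemma abs_integral_le_disintegration:
  fixes \<phi> :: "'w \<times> real \<Rightarrow> real"
  assumes [measurable]: "\<phi> \<in> borel_measurable (F \<Otimes>\<^sub>M borel)" and int: "integrable M (\<lambda>\<omega>. \<phi> (\<omega>, X \<omega>))"
  shows "ennreal \<bar>\<integral>\<omega>. \<phi> (\<omega>, X \<omega>) \<partial>M\<bar> \<le> (\<integral>\<^sup>+\<omega>. ennreal \<bar>\<integral>w. \<phi> (\<omega>, w) \<partial>K \<omega>\<bar> \<partial>M)"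
proof -
  define p where "p = (\<lambda>\<omega>. \<integral>\<^sup>+w. ennreal (\<phi> (\<omega>, w)) \<partial>K \<omega>)"
  define m where "m = (\<lambda>\<omega>. \<integral>\<^sup>+w. ennreal (- \<phi> (\<omega>, w)) \<partial>K \<omega>)"
  have [measurable]: "p \<in> borel_measurable M" "m \<in> borel_measurable M"
    unfolding p_def m_def
    using nn_integral_kernel_measurable[of "\<lambda>z. ennreal (\<phi> z)"] nn_integral_kernel_measurable[of "\<lambda>z. ennreal (- \<phi> z)"]
    by simp_all
  have ip: "(\<integral>\<^sup>+\<omega>. p \<omega> \<partial>M) = (\<integral>\<^sup>+\<omega>. ennreal (\<phi> (\<omega>, X \<omega>)) \<partial>M)"
    unfolding p_def using nn_integral_disintegration[of "\<lambda>z. ennreal (\<phi> z)"] by simp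
  have im: "(\<integral>\<^sup>+\<omega>. m \<omega> \<partial>M) = (\<integral>\<^sup>+\<omega>. ennreal (- \<phi> (\<omega>, X \<omega>)) \<partial>M)"
    unfolding m_def using nn_integral_disintegration[of "\<lambda>z. ennreal (- \<phi> z)"] by simp
  have fin: "(\<integral>\<^sup>+\<omega>. p \<omega> \<partial>M) \<noteq> \<infinity>" "(\<integral>\<^sup>+\<omega>. m \<omega> \<partial>M) \<noteq> \<infinity>"
    unfolding ip im using int by (auto simp: real_integrable_def)
  have AEfin: "AE \<omega> in M. p \<omega> \<noteq> \<infinity>" "AE \<omega> in M. m \<omega> \<noteq> \<infinity>"
    using nn_integral_PInf_AE[of p M] nn_integral_PInf_AE[of m M] fin by auto
  have I: "integrable M (\<lambda>\<omega>. enn2real (p \<omega>))" "integrable M (\<lambda>\<omega>. enn2real (m \<omega>))"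
    and E: "(\<integral>\<omega>. enn2real (p \<omega>) \<partial>M) = enn2real (\<integral>\<^sup>+\<omega>. p \<omega> \<partial>M)"
           "(\<integral>\<omega>. enn2real (m \<omega>) \<partial>M) = enn2real (\<integral>\<^sup>+\<omega>. m \<omega> \<partial>M)"
  proof -
    have *: "integrable M (\<lambda>\<omega>. enn2real (q \<omega>)) \<and> (\<integral>\<omega>. enn2real (q \<omega>) \<partial>M) = enn2real (\<integral>\<^sup>+\<omega>. q \<omega> \<partial>M)"
      if [measurable]: "q \<in> borel_measurable M" and f: "(\<integral>\<^sup>+\<omega>. q \<omega> \<partial>M) \<noteq> \<infinity>" for q
    proof -
      have "AE \<omega> in M. q \<omega> \<noteq> \<infinity>" using f by (intro nn_integral_PInf_AE) auto
      then have eq: "(\<integral>\<^sup>+\<omega>. ennreal (enn2real (q \<omega>)) \<partial>M) = (\<integral>\<^sup>+\<omega>. q \<omega> \<partial>M)"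
        by (intro nn_integral_cong_AE) (auto elim!: eventually_mono simp: less_top)
      show ?thesis
        using eq f by (auto simp: integral_eq_nn_integral less_top intro!: integrableI_nonneg)
    qed
    show "integrable M (\<lambda>\<omega>. enn2real (p \<omega>))" "integrable M (\<lambda>\<omega>. enn2real (m \<omega>))"
       "(\<integral>\<omega>. enn2real (p \<omega>) \<partial>M) = enn2real (\<integral>\<^sup>+\<omega>. p \<omega> \<partial>M)"
       "(\<integral>\<omega>. enn2real (m \<omega>) \<partial>M) = enn2real (\<integral>\<^sup>+\<omega>. m \<omega> \<partial>M)"
      using * fin by auto
  qed
  have "(\<integral>\<omega>. \<phi> (\<omega>, X \<omega>) \<partial>M) = (\<integral>\<omega>. enn2real (p \<omega>) - enn2real (m \<omega>) \<partial>M)"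
    using I E by (simp add: real_lebesgue_integral_def[OF int] ip im)
  then have "ennreal \<bar>\<integral>\<omega>. \<phi> (\<omega>, X \<omega>) \<partial>M\<bar> \<le> (\<integral>\<^sup>+\<omega>. ennreal \<bar>enn2real (p \<omega>) - enn2real (m \<omega>)\<bar> \<partial>M)"
    using integral_norm_bound_ennreal[of M "\<lambda>\<omega>. enn2real (p \<omega>) - enn2real (m \<omega>)"] I by simp
  also have "\<dots> = (\<integral>\<^sup>+\<omega>. ennreal \<bar>\<integral>w. \<phi> (\<omega>, w) \<partial>K \<omega>\<bar> \<partial>M)"
  proof (rule nn_integral_cong_AE)
    have "AE \<omega> in M. \<omega> \<in> space M" by simp
    then show "AE \<omega> in M. ennreal \<bar>enn2real (p \<omega>) - enn2real (m \<omega>)\<bar> = ennreal \<bar>\<integral>w. \<phi> (\<omega>, w) \<partial>K \<omega>\<bar>"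
      using AEfin
    proof eventually_elim
      case (elim \<omega>)
      have [measurable]: "(\<lambda>w. \<phi> (\<omega>, w)) \<in> borel_measurable (K \<omega>)"
        using measurable_compose[OF Pair_measurable_kernel[OF elim(1)], of \<phi> borel] by simp
      have "integrable (K \<omega>) (\<lambda>w. \<phi> (\<omega>, w))"
        using elim by (simp add: real_integrable_def p_def m_def)
      then show ?case by (simp add: real_lebesgue_integral_def p_def m_def)
    qed
  qed
  finally show ?thesis .
qed

end

text \<open>Given \<open>Y\<close>, the first argument of \<open>\<psi>\<close> may be frozen,
  because \<open>Y\<close> is measurable for the sigma-algebra that it generates. This turns the
  random displacements of \<open>W\<close> into constants in the smoothing estimates.\<close>

lemma abs_integral_le_cond_law:
  fixes \<psi> :: "'b \<Rightarrow> real \<Rightarrow> real"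
  assumes M: "prob_space M" and Y: "Y \<in> M \<rightarrow>\<^sub>M N" and X: "X \<in> borel_measurable M"
    and \<psi>: "(\<lambda>(y, w). \<psi> y w) \<in> borel_measurable (N \<Otimes>\<^sub>M borel)"
    and int: "integrable M (\<lambda>\<omega>. \<psi> (Y \<omega>) (X \<omega>))"
  shows "ennreal \<bar>\<integral>\<omega>. \<psi> (Y \<omega>) (X \<omega>) \<partial>M\<bar> \<le> (\<integral>\<^sup>+\<omega>. ennreal \<bar>\<integral>w. \<psi> (Y \<omega>) w \<partial>cond_law M N Y X \<omega>\<bar> \<partial>M)"
proof -
  let ?F = "vimage_algebra (space M) Y N"
  have F: "subalgebra M ?F"
    using Y unfolding subalgebra_def by (auto simp: sets_vimage_algebra2 measurable_def)
  have "Y \<in> ?F \<rightarrow>\<^sub>M N" using Y by (intro measurable_vimage_algebra1) (auto simp: measurable_def)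
  then have "(\<lambda>z. (Y (fst z), snd z)) \<in> ?F \<Otimes>\<^sub>M borel \<rightarrow>\<^sub>M N \<Otimes>\<^sub>M (borel :: real measure)" by measurable
  from measurable_compose[OF this \<psi>]
  have "(\<lambda>z. \<psi> (Y (fst z)) (snd z)) \<in> borel_measurable (?F \<Otimes>\<^sub>M borel)" by simp
  from abs_integral_le_disintegration[OF M F X cond_law_is_cond_law[OF M Y X] this] int
  show ?thesis by simp
qed

lemma cond_law_real_prob:
  assumes M: "prob_space M" and Y: "Y \<in> M \<rightarrow>\<^sub>M N" and X: "X \<in> borel_measurable M" and \<omega>: "\<omega> \<in> space M"
  shows "prob_space (cond_law M N Y X \<omega>)" "sets (cond_law M N Y X \<omega>) = sets borel"
proof -
  have F: "subalgebra M (vimage_algebra (space M) Y N)"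
    using Y unfolding subalgebra_def by (auto simp: sets_vimage_algebra2 measurable_def)
  show "prob_space (cond_law M N Y X \<omega>)" "sets (cond_law M N Y X \<omega>) = sets borel"
    using cond_law_prob[OF M F X cond_law_is_cond_law[OF M Y X] \<omega>]
      cond_law_sets[OF M F X cond_law_is_cond_law[OF M Y X] \<omega>] by auto
qed

section \<open>Local dependence\<close>

text \<open>
  The integrands of \<open>theta\<close> contain \<open>D_norm\<close>, an uncountable supremum, so that their measurability is
  not available and \<open>nn_integral_cmult\<close> does not apply.
\<close>

lemma nn_integral_cmult_le:
  assumes "0 \<le> c"
  shows "(\<integral>\<^sup>+x. ennreal c * f x \<partial>M) \<le> ennreal c * (\<integral>\<^sup>+x. f x \<partial>M)"
proof (cases "c = 0")
  case False
  with assms have c: "c > 0" by simp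
  show ?thesis unfolding nn_integral_def[of M "\<lambda>x. ennreal c * f x"]
  proof (rule SUP_least)
    fix g assume "g \<in> {g. simple_function M g \<and> g \<le> (\<lambda>x. ennreal c * f x)}"
    then have g: "simple_function M g" and le: "\<And>x. g x \<le> ennreal c * f x" by (auto simp: le_fun_def)
    have [measurable]: "g \<in> borel_measurable M" using g by (rule borel_measurable_simple_function)
    have inv: "ennreal c * (ennreal (inverse c) * z) = z" "ennreal (inverse c) * (ennreal c * z) = z" for z
      using c by (simp_all add: mult.assoc[symmetric] ennreal_mult[symmetric])
    have "integral\<^sup>S M g = (\<integral>\<^sup>+x. ennreal c * (ennreal (inverse c) * g x) \<partial>M)"
      unfolding inv by (rule nn_integral_eq_simple_integral[symmetric, OF g])
    also have "\<dots> = ennreal c * (\<integral>\<^sup>+x. ennreal (inverse c) * g x \<partial>M)"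
      by (rule nn_integral_cmult) simp
    also have "\<dots> \<le> ennreal c * (\<integral>\<^sup>+x. f x \<partial>M)"
    proof (intro mult_left_mono nn_integral_mono)
      fix x show "ennreal (inverse c) * g x \<le> f x"
        using mult_left_mono[OF le[of x], of "ennreal (inverse c)"] by (simp add: inv)
    qed simp
    finally show "integral\<^sup>S M g \<le> ennreal c * (\<integral>\<^sup>+x. f x \<partial>M)" .
  qed
qed simp

lemma integrable_mult_of_square:
  fixes f g :: "'w \<Rightarrow> real"
  assumes [measurable]: "f \<in> borel_measurable M" "g \<in> borel_measurable M"
    and "integrable M (\<lambda>x. (f x)\<^sup>2)" "integrable M (\<lambda>x. (g x)\<^sup>2)"
  shows "integrable M (\<lambda>x. f x * g x)"
proof (rule Bochner_Integration.integrable_bound)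
  show "integrable M (\<lambda>x. (f x)\<^sup>2 + (g x)\<^sup>2)" using assms by simp
  have "\<bar>f x * g x\<bar> \<le> (f x)\<^sup>2 + (g x)\<^sup>2" for x
  proof -
    have "0 \<le> (\<bar>f x\<bar> - \<bar>g x\<bar>)\<^sup>2" by simp
    then have "2 * (\<bar>f x\<bar> * \<bar>g x\<bar>) \<le> (f x)\<^sup>2 + (g x)\<^sup>2" by (simp add: power2_diff)
    moreover have "0 \<le> \<bar>f x\<bar> * \<bar>g x\<bar>" by simp
    ultimately show ?thesis unfolding abs_mult by linarith
  qed
  then show "AE x in M. norm (f x * g x) \<le> norm ((f x)\<^sup>2 + (g x)\<^sup>2)" by simp
qed simp

lemma integrable_square_sum:
  fixes f :: "'i \<Rightarrow> 'w \<Rightarrow> real"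
  assumes "finite I" "\<And>i. i \<in> I \<Longrightarrow> f i \<in> borel_measurable M"
    and "\<And>i. i \<in> I \<Longrightarrow> integrable M (\<lambda>x. (f i x)\<^sup>2)"
  shows "integrable M (\<lambda>x. (\<Sum>i\<in>I. f i x)\<^sup>2)"
  unfolding power2_eq_square sum_product
  by (intro Bochner_Integration.integrable_sum integrable_mult_of_square) (use assms in auto)

lemma subfamily_measurable:
  assumes "\<And>i. i \<in> P \<Longrightarrow> \<xi> i \<in> borel_measurable M"
  shows "subfamily \<xi> P \<in> M \<rightarrow>\<^sub>M family_space P"
  unfolding subfamily_def[abs_def] using assms by (intro measurable_restrict) auto

lemma expectation_indep_subfamilies:
  fixes g h :: "('i \<Rightarrow> real) \<Rightarrow> real"
  assumes M: "prob_space M" and ind: "indep_subfamilies M \<xi> P Q"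
    and g: "g \<in> borel_measurable (family_space P)" and h: "h \<in> borel_measurable (family_space Q)"
    and ig: "integrable M (\<lambda>\<omega>. g (subfamily \<xi> P \<omega>))" and ih: "integrable M (\<lambda>\<omega>. h (subfamily \<xi> Q \<omega>))"
  shows "(\<integral>\<omega>. g (subfamily \<xi> P \<omega>) * h (subfamily \<xi> Q \<omega>) \<partial>M)
    = (\<integral>\<omega>. g (subfamily \<xi> P \<omega>) \<partial>M) * (\<integral>\<omega>. h (subfamily \<xi> Q \<omega>) \<partial>M)"
proof -
  interpret prob_space M by (rule M)
  have "indep_var borel (g \<circ> subfamily \<xi> P) borel (h \<circ> subfamily \<xi> Q)"
    using ind g h unfolding indep_subfamilies_def by (rule indep_var_compose)
  then show ?thesis using indep_var_lebesgue_integral[of "g \<circ> subfamily \<xi> P" "h \<circ> subfamily \<xi> Q"] ig ih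
    by (simp add: comp_def)
qed

context
  fixes M :: "'w measure" and J :: "'i set" and \<xi> :: "'i \<Rightarrow> 'w \<Rightarrow> real"
    and A B :: "'i \<Rightarrow> 'i set" and W :: "'w \<Rightarrow> real" and \<eta> \<tau> :: "'i \<Rightarrow> 'w \<Rightarrow> real"
  assumes prob: "prob_space M"
    and J: "finite J"
    and rv: "\<And>i. i \<in> J \<Longrightarrow> \<xi> i \<in> borel_measurable M"
    and sq: "\<And>i. i \<in> J \<Longrightarrow> integrable M (\<lambda>\<omega>. (\<xi> i \<omega>)\<^sup>2)"
    and mean: "\<And>i. i \<in> J \<Longrightarrow> prob_space.expectation M (\<xi> i) = 0"
    and W: "W = (\<lambda>\<omega>. \<Sum>i\<in>J. \<xi> i \<omega>)"
    and subs: "\<And>i. i \<in> J \<Longrightarrow> A i \<subseteq> B i \<and> B i \<subseteq> J"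
    and indep1: "\<And>i. i \<in> J \<Longrightarrow> indep_subfamilies M \<xi> {i} (J - A i)"
    and indep2: "\<And>i. i \<in> J \<Longrightarrow> indep_subfamilies M \<xi> (A i) (J - B i)"
    and \<eta>: "\<eta> = (\<lambda>i \<omega>. \<Sum>j\<in>A i. \<xi> j \<omega>)"
    and \<tau>: "\<tau> = (\<lambda>i \<omega>. \<Sum>j\<in>B i. \<xi> j \<omega>)"
begin

interpretation prob_space M by (rule prob)

lemma
  shows W_measurable: "W \<in> borel_measurable M"
    and eta_measurable: "i \<in> J \<Longrightarrow> \<eta> i \<in> borel_measurable M"
    and tau_measurable: "i \<in> J \<Longrightarrow> \<tau> i \<in> borel_measurable M"
  unfolding W \<eta> \<tau> using rv subs by (auto intro!: borel_measurable_sum)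

lemma
  shows W_square: "integrable M (\<lambda>\<omega>. (W \<omega>)\<^sup>2)"
    and eta_square: "i \<in> J \<Longrightarrow> integrable M (\<lambda>\<omega>. (\<eta> i \<omega>)\<^sup>2)"
proof -
  show "integrable M (\<lambda>\<omega>. (W \<omega>)\<^sup>2)" unfolding W using rv sq J by (intro integrable_square_sum) auto
  assume i: "i \<in> J"
  then have sub: "A i \<subseteq> J" using subs[OF i] by auto
  show "integrable M (\<lambda>\<omega>. (\<eta> i \<omega>)\<^sup>2)"
    unfolding \<eta> using rv sq J sub by (intro integrable_square_sum) (auto dest: finite_subset)
qed

lemma xi_integrable: "i \<in> J \<Longrightarrow> integrable M (\<xi> i)"
  by (rule square_integrable_imp_integrable[OF rv sq])

lemma W_integrable: "integrable M W"
  unfolding W by (rule Bochner_Integration.integrable_sum) (rule xi_integrable)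

lemma expectation_W: "expectation W = 0"
  unfolding W using mean xi_integrable by (subst Bochner_Integration.integral_sum) auto

lemma variance_W: "variance W = expectation (\<lambda>\<omega>. (W \<omega>)\<^sup>2)"
  by (simp add: expectation_W)

lemma W_diff: 
  assumes "i \<in> J"
  shows "W \<omega> - \<eta> i \<omega> = (\<Sum>j\<in>J - A i. \<xi> j \<omega>)" "W \<omega> - \<tau> i \<omega> = (\<Sum>j\<in>J - B i. \<xi> j \<omega>)"
proof -
  have "A i \<subseteq> J" "B i \<subseteq> J" using subs[OF assms] by auto
  then show "W \<omega> - \<eta> i \<omega> = (\<Sum>j\<in>J - A i. \<xi> j \<omega>)" "W \<omega> - \<tau> i \<omega> = (\<Sum>j\<in>J - B i. \<xi> j \<omega>)"
    using sum_diff[OF J, of "A i" "\<lambda>j. \<xi> j \<omega>"] sum_diff[OF J, of "B i" "\<lambda>j. \<xi> j \<omega>"]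
    by (simp_all add: W \<eta> \<tau>)
qed

text \<open>If \<open>i\<close> lies outside \<open>A i\<close>, then \<open>\<xi> i\<close> belongs
  to the family that it is independent of; being independent of itself with mean zero, it has second
  moment zero. This settles the degenerate indices, for which \<open>\<xi> i * \<eta> i\<close> need
  not be a function of the family on \<open>A i\<close>.\<close>

lemma xi_zero:
  assumes i: "i \<in> J" "i \<notin> A i"
  shows "AE \<omega> in M. \<xi> i \<omega> = 0"
proof -
  have "(\<integral>\<omega>. subfamily \<xi> {i} \<omega> i * subfamily \<xi> (J - A i) \<omega> i \<partial>M)
    = (\<integral>\<omega>. subfamily \<xi> {i} \<omega> i \<partial>M) * (\<integral>\<omega>. subfamily \<xi> (J - A i) \<omega> i \<partial>M)"
    by (rule expectation_indep_subfamilies[OF prob indep1[OF i(1)]])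
      (use i xi_integrable in \<open>auto simp: subfamily_def intro!: measurable_component_singleton\<close>)
  then have "(\<integral>\<omega>. (\<xi> i \<omega>)\<^sup>2 \<partial>M) = 0"
    using i mean by (simp add: subfamily_def power2_eq_square)
  then have "AE \<omega> in M. (\<xi> i \<omega>)\<^sup>2 = 0"
    using sq[OF i(1)] by (subst (asm) integral_nonneg_eq_0_iff_AE) auto
  then show ?thesis by (auto elim!: eventually_mono)
qed

text \<open>\<open>W - \<eta> i\<close> is a function of the family off \<open>A i\<close>, and the
  independent factor \<open>\<xi> i\<close> has mean zero.\<close>

lemma expectation_xi_rest:
  assumes i: "i \<in> J" and g[measurable]: "g \<in> borel_measurable borel"
    and int: "integrable M (\<lambda>\<omega>. g (W \<omega> - \<eta> i \<omega>))"
  shows "expectation (\<lambda>\<omega>. \<xi> i \<omega> * g (W \<omega> - \<eta> i \<omega>)) = 0"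
proof -
  let ?h = "\<lambda>x. g (\<Sum>j\<in>J - A i. x j)"
  have h: "?h (subfamily \<xi> (J - A i) \<omega>) = g (W \<omega> - \<eta> i \<omega>)" for \<omega>
    by (simp add: W_diff[OF i] subfamily_def)
  have "(\<integral>\<omega>. subfamily \<xi> {i} \<omega> i * ?h (subfamily \<xi> (J - A i) \<omega>) \<partial>M)
    = (\<integral>\<omega>. subfamily \<xi> {i} \<omega> i \<partial>M) * (\<integral>\<omega>. ?h (subfamily \<xi> (J - A i) \<omega>) \<partial>M)"
  proof (rule expectation_indep_subfamilies[OF prob indep1[OF i]])
    show "?h \<in> borel_measurable (family_space (J - A i))" by measurable
    show "integrable M (\<lambda>\<omega>. ?h (subfamily \<xi> (J - A i) \<omega>))" using int unfolding h .
  qed (use i xi_integrable in \<open>auto simp: subfamily_def intro!: measurable_component_singleton\<close>)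
  then show ?thesis using i mean unfolding h by (simp add: subfamily_def)
qed

text \<open>With \<open>i\<close> in \<open>A i\<close> the product
  \<open>\<xi> i * \<eta> i\<close> is a function of the family on \<open>A i\<close>, while
  \<open>W - \<tau> i\<close> depends on the family off \<open>B i\<close>.\<close>

lemma expectation_xi_eta_rest:
  assumes i: "i \<in> J" "i \<in> A i" and g[measurable]: "g \<in> borel_measurable borel"
    and int: "integrable M (\<lambda>\<omega>. g (W \<omega> - \<tau> i \<omega>))"
  shows "expectation (\<lambda>\<omega>. \<xi> i \<omega> * \<eta> i \<omega> * g (W \<omega> - \<tau> i \<omega>))
    = expectation (\<lambda>\<omega>. \<xi> i \<omega> * \<eta> i \<omega>) * expectation (\<lambda>\<omega>. g (W \<omega> - \<tau> i \<omega>))"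
proof -
  let ?f = "\<lambda>x. x i * (\<Sum>j\<in>A i. x j)"
  let ?h = "\<lambda>x. g (\<Sum>j\<in>J - B i. x j)"
  have h: "?h (subfamily \<xi> (J - B i) \<omega>) = g (W \<omega> - \<tau> i \<omega>)" for \<omega>
    by (simp add: W_diff[OF i(1)] subfamily_def)
  have f: "?f (subfamily \<xi> (A i) \<omega>) = \<xi> i \<omega> * \<eta> i \<omega>" for \<omega>
    using i by (simp add: \<eta> subfamily_def)
  have "(\<integral>\<omega>. ?f (subfamily \<xi> (A i) \<omega>) * ?h (subfamily \<xi> (J - B i) \<omega>) \<partial>M)
    = (\<integral>\<omega>. ?f (subfamily \<xi> (A i) \<omega>) \<partial>M) * (\<integral>\<omega>. ?h (subfamily \<xi> (J - B i) \<omega>) \<partial>M)"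
  proof (rule expectation_indep_subfamilies[OF prob indep2[OF i(1)]])
    have [measurable]: "(\<lambda>x. x i) \<in> borel_measurable (family_space (A i))"
      using i(2) by (rule measurable_component_singleton)
    show "?f \<in> borel_measurable (family_space (A i))" by measurable
    show "?h \<in> borel_measurable (family_space (J - B i))" by measurable
    show "integrable M (\<lambda>\<omega>. ?f (subfamily \<xi> (A i) \<omega>))" unfolding f
      using i rv sq eta_measurable eta_square by (intro integrable_mult_of_square) auto
    show "integrable M (\<lambda>\<omega>. ?h (subfamily \<xi> (J - B i) \<omega>))" using int unfolding h .
  qed
  then show ?thesis unfolding h f .
qed

text \<open>In the second moment of \<open>W\<close> one factor is expanded, and \<open>W\<close>
  may be replaced by \<open>\<eta> i\<close> next to \<open>\<xi> i\<close>. The identity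
  distributes the term with the derivative over the indices, to be compared one by one.\<close>

lemma variance_W_eq: "variance W = (\<Sum>i\<in>J. expectation (\<lambda>\<omega>. \<xi> i \<omega> * \<eta> i \<omega>))"
proof -
  have int: "integrable M (\<lambda>\<omega>. \<xi> i \<omega> * W \<omega>)" "integrable M (\<lambda>\<omega>. \<xi> i \<omega> * \<eta> i \<omega>)" if "i \<in> J" for i
    using that rv sq W_measurable W_square eta_measurable eta_square
    by (auto intro!: integrable_mult_of_square)
  have "variance W = expectation (\<lambda>\<omega>. \<Sum>i\<in>J. \<xi> i \<omega> * W \<omega>)"
    unfolding variance_W by (simp add: sum_distrib_right[symmetric] power2_eq_square) (simp add: W)
  also have "\<dots> = (\<Sum>i\<in>J. expectation (\<lambda>\<omega>. \<xi> i \<omega> * W \<omega>))"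
    using int by (intro Bochner_Integration.integral_sum)
  also have "\<dots> = (\<Sum>i\<in>J. expectation (\<lambda>\<omega>. \<xi> i \<omega> * \<eta> i \<omega>))"
  proof (rule sum.cong)
    fix i assume i: "i \<in> J"
    have "integrable M (\<lambda>\<omega>. W \<omega> - \<eta> i \<omega>)"
      using W_integrable square_integrable_imp_integrable[OF eta_measurable[OF i] eta_square[OF i]] by simp
    from expectation_xi_rest[OF i _ this]
    have "expectation (\<lambda>\<omega>. \<xi> i \<omega> * W \<omega> - \<xi> i \<omega> * \<eta> i \<omega>) = 0"
      by (simp add: right_diff_distrib)
    then show "expectation (\<lambda>\<omega>. \<xi> i \<omega> * W \<omega>) = expectation (\<lambda>\<omega>. \<xi> i \<omega> * \<eta> i \<omega>)"
      using int[OF i] by simp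
  qed simp
  finally show ?thesis .
qed

section \<open>The contribution of a single index\<close>

context
  fixes l :: nat and f :: "int \<Rightarrow> real" and S :: "int set" and C b :: real
  assumes l: "l \<in> {1, 2}" and S: "finite S" "\<And>k. k \<notin> S \<Longrightarrow> f k = 0" and C: "smooth_bound l f C"
begin

text \<open>The spline and its derivative as functions of the centered variable. The offset
  \<open>b\<close> leads back to the integers; it will be \<open>n * p\<close>.\<close>

abbreviation (input) "sol_avg x \<equiv> spline quad_ramp f S (x + b)"
abbreviation (input) "sol_diff x \<equiv> spline ramp f S (x + b)"

lemma C_nonneg: "0 \<le> C"
  using C by (auto simp: smooth_bound_def split: if_splits intro: order_trans[OF abs_ge_zero])

lemma spline_ramp_integrable:
  assumes [measurable]: "Z \<in> borel_measurable M"
  shows "integrable M (\<lambda>\<omega>. sol_diff (Z \<omega>))"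
  by (rule integrable_const_bound[where B="4 * (\<Sum>k\<in>S. \<bar>f k\<bar>)"]) (auto simp: spline_ramp_bound)

lemma mult_spline_ramp_integrable:
  assumes [measurable]: "Z \<in> borel_measurable M" and Y: "integrable M Y"
  shows "integrable M (\<lambda>\<omega>. Y \<omega> * sol_diff (Z \<omega>))"
proof (rule Bochner_Integration.integrable_bound)
  have [measurable]: "Y \<in> borel_measurable M" using Y by simp
  show "(\<lambda>\<omega>. Y \<omega> * sol_diff (Z \<omega>)) \<in> borel_measurable M" by measurable
  show "integrable M (\<lambda>\<omega>. Y \<omega> * (4 * (\<Sum>k\<in>S. \<bar>f k\<bar>)))" using Y by simp
  show "AE \<omega> in M. norm (Y \<omega> * sol_diff (Z \<omega>)) \<le> norm (Y \<omega> * (4 * (\<Sum>k\<in>S. \<bar>f k\<bar>)))"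
    using spline_ramp_bound[of f S] by (auto simp: abs_mult sum_nonneg intro!: mult_left_mono)
qed

lemma spline_quad_ramp_growth: "\<bar>sol_avg z\<bar> \<le> \<bar>sol_avg 0\<bar> + 4 * (\<Sum>k\<in>S. \<bar>f k\<bar>) * \<bar>z\<bar>"
  using spline_quad_ramp_lipschitz[of f S "z + b" "0 + b"] by simp

lemma spline_quad_ramp_integrable:
  assumes [measurable]: "Z \<in> borel_measurable M" and Z: "integrable M Z"
  shows "integrable M (\<lambda>\<omega>. sol_avg (Z \<omega>))"
proof (rule Bochner_Integration.integrable_bound)
  show "integrable M (\<lambda>\<omega>. \<bar>sol_avg 0\<bar> + 4 * (\<Sum>k\<in>S. \<bar>f k\<bar>) * \<bar>Z \<omega>\<bar>)" using Z by simp
  show "AE \<omega> in M. norm (sol_avg (Z \<omega>)) \<le> norm (\<bar>sol_avg 0\<bar> + 4 * (\<Sum>k\<in>S. \<bar>f k\<bar>) * \<bar>Z \<omega>\<bar>)"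
    using spline_quad_ramp_growth by (auto intro: order_trans[OF _ abs_ge_self])
qed measurable

text \<open>The spline grows at most linearly, so integrability of \<open>Y\<close> and
  \<open>Y * Z\<close> suffices, and no third moment is called for.\<close>

lemma mult_spline_quad_ramp_integrable:
  assumes [measurable]: "Z \<in> borel_measurable M" "Y \<in> borel_measurable M"
    and Y: "integrable M Y" and YZ: "integrable M (\<lambda>\<omega>. Y \<omega> * Z \<omega>)"
  shows "integrable M (\<lambda>\<omega>. Y \<omega> * sol_avg (Z \<omega>))"
proof (rule Bochner_Integration.integrable_bound)
  show "integrable M (\<lambda>\<omega>. \<bar>Y \<omega>\<bar> * \<bar>sol_avg 0\<bar> + 4 * (\<Sum>k\<in>S. \<bar>f k\<bar>) * \<bar>Y \<omega> * Z \<omega>\<bar>)"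
    using Y YZ by (intro Bochner_Integration.integrable_add integrable_mult_left integrable_mult_right integrable_abs)
  have "\<bar>Y \<omega> * sol_avg (Z \<omega>)\<bar> \<le> \<bar>Y \<omega>\<bar> * \<bar>sol_avg 0\<bar> + 4 * (\<Sum>k\<in>S. \<bar>f k\<bar>) * \<bar>Y \<omega> * Z \<omega>\<bar>" for \<omega>
    using mult_left_mono[OF spline_quad_ramp_growth[of "Z \<omega>"], of "\<bar>Y \<omega>\<bar>"]
    by (simp add: abs_mult algebra_simps)
  then show "AE \<omega> in M. norm (Y \<omega> * sol_avg (Z \<omega>)) \<le> norm (\<bar>Y \<omega>\<bar> * \<bar>sol_avg 0\<bar> + 4 * (\<Sum>k\<in>S. \<bar>f k\<bar>) * \<bar>Y \<omega> * Z \<omega>\<bar>)"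
    by (auto intro: order_trans[OF _ abs_ge_self])
qed measurable

text \<open>The left side is finite from second moments alone, whereas \<open>theta\<close> may be
  infinite; hence the comparison in \<open>ennreal\<close>. The three remainders \<open>T1\<close>,
  \<open>T2\<close>, \<open>T3\<close> match the three terms of \<open>theta\<close>.\<close>

lemma local_term_bound:
  assumes i: "i \<in> J"
  shows "ennreal \<bar>expectation (\<lambda>\<omega>. \<xi> i \<omega> * \<eta> i \<omega>) * expectation (\<lambda>\<omega>. sol_diff (W \<omega>)) - expectation (\<lambda>\<omega>. \<xi> i \<omega> * sol_avg (W \<omega>))\<bar>
    \<le> ennreal C * theta M W l (\<xi> i) (\<eta> i) (\<tau> i)"
proof (cases "i \<in> A i")
  case False
  note z = xi_zero[OF i False]
  have "expectation (\<lambda>\<omega>. \<xi> i \<omega> * \<eta> i \<omega>) = 0" "expectation (\<lambda>\<omega>. \<xi> i \<omega> * sol_avg (W \<omega>)) = 0"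
    using z by (auto intro!: integral_eq_zero_AE elim!: eventually_mono)
  then show ?thesis by simp
next
  case iA: True
  note [measurable] = W_measurable eta_measurable[OF i] tau_measurable[OF i] rv[OF i]
  let ?D = "\<lambda>N Y \<omega>. D_norm l (cond_law M N Y W \<omega>)"
  have K: "prob_space (cond_law M N Y W \<omega>)" "sets (cond_law M N Y W \<omega>) = sets borel"
    if "Y \<in> M \<rightarrow>\<^sub>M N" "\<omega> \<in> space M" for Y :: "'w \<Rightarrow> 'c" and N \<omega>
    using cond_law_real_prob[OF prob that(1) W_measurable that(2)] by auto
  have ie: "integrable M (\<lambda>\<omega>. \<xi> i \<omega> * \<eta> i \<omega>)" and iW: "integrable M (\<lambda>\<omega>. \<xi> i \<omega> * W \<omega>)"
    using rv sq eta_measurable eta_square W_measurable W_square i by (auto intro!: integrable_mult_of_square)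
  have ieta: "integrable M (\<eta> i)" by (rule square_integrable_imp_integrable) (use i eta_square in auto)
  have iWe: "integrable M (\<lambda>\<omega>. \<xi> i \<omega> * (W \<omega> - \<eta> i \<omega>))" using ie iW by (simp add: right_diff_distrib)
  have i1: "integrable M (\<lambda>\<omega>. \<xi> i \<omega> * sol_avg (W \<omega>))" "integrable M (\<lambda>\<omega>. \<xi> i \<omega> * sol_avg (W \<omega> - \<eta> i \<omega>))"
    using i xi_integrable iW iWe by (auto intro!: mult_spline_quad_ramp_integrable)
  have i2: "integrable M (\<lambda>\<omega>. \<xi> i \<omega> * \<eta> i \<omega> * sol_diff (W \<omega> - \<eta> i \<omega>))" "integrable M (\<lambda>\<omega>. \<xi> i \<omega> * \<eta> i \<omega> * sol_diff (W \<omega> - \<tau> i \<omega>))"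
    using ie by (auto intro!: mult_spline_ramp_integrable)
  have i3: "integrable M (\<lambda>\<omega>. sol_diff (W \<omega>))" "integrable M (\<lambda>\<omega>. sol_diff (W \<omega> - \<tau> i \<omega>))"
    by (auto intro!: spline_ramp_integrable)

  define T1 where "T1 = expectation (\<lambda>\<omega>. \<xi> i \<omega> * (sol_avg (W \<omega>) - sol_avg (W \<omega> - \<eta> i \<omega>) - \<eta> i \<omega> * sol_diff (W \<omega> - \<eta> i \<omega>)))"
  define T2 where "T2 = expectation (\<lambda>\<omega>. \<xi> i \<omega> * \<eta> i \<omega> * (sol_diff (W \<omega> - \<eta> i \<omega>) - sol_diff (W \<omega> - \<tau> i \<omega>)))"
  define T3 where "T3 = expectation (\<lambda>\<omega>. sol_diff (W \<omega>) - sol_diff (W \<omega> - \<tau> i \<omega>))"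
  \<comment> \<open>\<open>T1\<close> and \<open>T2\<close> are split into expectations with bounded
    or linearly growing factors. Their bounds by cubic moments cannot serve for this, as these may
    be infinite.\<close>
  have j1: "integrable M (\<lambda>\<omega>. \<xi> i \<omega> * (sol_avg (W \<omega>) - sol_avg (W \<omega> - \<eta> i \<omega>) - \<eta> i \<omega> * sol_diff (W \<omega> - \<eta> i \<omega>)))"
    using i1 i2 by (simp add: right_diff_distrib mult.assoc[symmetric])
  have j2: "integrable M (\<lambda>\<omega>. \<xi> i \<omega> * \<eta> i \<omega> * (sol_diff (W \<omega> - \<eta> i \<omega>) - sol_diff (W \<omega> - \<tau> i \<omega>)))"
    using i2 by (simp add: right_diff_distrib)

  \<comment> \<open>This term has mean zero and so enters the Taylor remainder for free.\<close>
  have "expectation (\<lambda>\<omega>. \<xi> i \<omega> * sol_avg (W \<omega> - \<eta> i \<omega>)) = 0"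
    using W_integrable ieta by (intro expectation_xi_rest[OF i, where g="\<lambda>x. sol_avg x"] spline_quad_ramp_integrable) auto
  then have e1: "T1 = expectation (\<lambda>\<omega>. \<xi> i \<omega> * sol_avg (W \<omega>)) - expectation (\<lambda>\<omega>. \<xi> i \<omega> * \<eta> i \<omega> * sol_diff (W \<omega> - \<eta> i \<omega>))"
    unfolding T1_def using i1 i2 by (simp add: right_diff_distrib mult.assoc[symmetric])
  have e2: "T2 = expectation (\<lambda>\<omega>. \<xi> i \<omega> * \<eta> i \<omega> * sol_diff (W \<omega> - \<eta> i \<omega>))
      - expectation (\<lambda>\<omega>. \<xi> i \<omega> * \<eta> i \<omega>) * expectation (\<lambda>\<omega>. sol_diff (W \<omega> - \<tau> i \<omega>))"
    unfolding T2_def using i2 expectation_xi_eta_rest[OF i iA _ i3(2)]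
    by (simp add: right_diff_distrib)
  have e3: "T3 = expectation (\<lambda>\<omega>. sol_diff (W \<omega>)) - expectation (\<lambda>\<omega>. sol_diff (W \<omega> - \<tau> i \<omega>))"
    unfolding T3_def using i3 by simp
  have eq: "expectation (\<lambda>\<omega>. \<xi> i \<omega> * \<eta> i \<omega>) * expectation (\<lambda>\<omega>. sol_diff (W \<omega>)) - expectation (\<lambda>\<omega>. \<xi> i \<omega> * sol_avg (W \<omega>))
      = expectation (\<lambda>\<omega>. \<xi> i \<omega> * \<eta> i \<omega>) * T3 - T2 - T1"
    unfolding e1 e2 e3 by (simp add: algebra_simps)

  have b1: "ennreal \<bar>T1\<bar> \<le> ennreal C * (ennreal (1/2) *
       (\<integral>\<^sup>+\<omega>. ennreal (\<bar>\<xi> i \<omega>\<bar> * (\<eta> i \<omega>)\<^sup>2 * ?D borel (\<lambda>\<omega>. (\<xi> i \<omega>, \<eta> i \<omega>)) \<omega>) \<partial>M))"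
  proof -
    let ?Y = "\<lambda>\<omega>. (\<xi> i \<omega>, \<eta> i \<omega>)"
    let ?\<psi> = "\<lambda>(x, y) w. x * (sol_avg w - sol_avg (w - y) - y * sol_diff (w - y))"
    have Y: "?Y \<in> M \<rightarrow>\<^sub>M borel" by measurable
    have \<psi>: "(\<lambda>(z, w). ?\<psi> z w) \<in> borel_measurable (borel \<Otimes>\<^sub>M borel)"
      unfolding case_prod_beta borel_prod[symmetric] by measurable
    have "ennreal \<bar>T1\<bar> \<le> (\<integral>\<^sup>+\<omega>. ennreal \<bar>\<integral>w. ?\<psi> (?Y \<omega>) w \<partial>cond_law M borel ?Y W \<omega>\<bar> \<partial>M)"
      using abs_integral_le_cond_law[OF prob Y W_measurable \<psi>] j1 by (simp add: T1_def)
    also have "\<dots> \<le> (\<integral>\<^sup>+\<omega>. ennreal (C / 2) * ennreal (\<bar>\<xi> i \<omega>\<bar> * (\<eta> i \<omega>)\<^sup>2 * ?D borel ?Y \<omega>) \<partial>M)"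
    proof (rule nn_integral_mono)
      fix \<omega> assume \<omega>: "\<omega> \<in> space M"
      let ?K = "cond_law M borel ?Y W \<omega>"
      \<comment> \<open>Under the conditional law \<open>\<eta> i \<omega>\<close> is a constant,
        and the Taylor estimate applies at base point \<open>b - \<eta> i \<omega>\<close> with step
        \<open>\<eta> i \<omega>\<close>.\<close>
      have "\<bar>\<integral>w. ?\<psi> (?Y \<omega>) w \<partial>?K\<bar>
          = \<bar>\<xi> i \<omega>\<bar> * \<bar>\<integral>w. spline quad_ramp f S (w + (b - \<eta> i \<omega>) + \<eta> i \<omega>) - spline quad_ramp f S (w + (b - \<eta> i \<omega>))
              - \<eta> i \<omega> * spline ramp f S (w + (b - \<eta> i \<omega>)) \<partial>?K\<bar>"
        by (simp add: abs_mult diff_add_eq add_diff_eq)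
      also have "\<dots> \<le> \<bar>\<xi> i \<omega>\<bar> * (C * D_norm l ?K * (\<eta> i \<omega>)\<^sup>2 / 2)"
        by (intro mult_left_mono integral_spline_taylor K[OF Y \<omega>] l S C) auto
      also have "\<dots> = C / 2 * (\<bar>\<xi> i \<omega>\<bar> * (\<eta> i \<omega>)\<^sup>2 * ?D borel ?Y \<omega>)" by simp
      finally show "ennreal \<bar>\<integral>w. ?\<psi> (?Y \<omega>) w \<partial>?K\<bar> \<le> ennreal (C / 2) * ennreal (\<bar>\<xi> i \<omega>\<bar> * (\<eta> i \<omega>)\<^sup>2 * ?D borel ?Y \<omega>)"
        using C_nonneg D_norm_nonneg[OF K[OF Y \<omega>] l] by (simp add: ennreal_mult[symmetric] ennreal_leI)
    qed
    also have "\<dots> \<le> ennreal (C / 2) * (\<integral>\<^sup>+\<omega>. ennreal (\<bar>\<xi> i \<omega>\<bar> * (\<eta> i \<omega>)\<^sup>2 * ?D borel ?Y \<omega>) \<partial>M)"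
      using C_nonneg by (intro nn_integral_cmult_le) simp
    also have "ennreal (C / 2) = ennreal C * ennreal (1 / 2)"
      using C_nonneg by (subst ennreal_mult[symmetric]) auto
    finally show ?thesis by (simp only: mult.assoc)
  qed

  have b2: "ennreal \<bar>T2\<bar> \<le> ennreal C *
       (\<integral>\<^sup>+\<omega>. ennreal (\<bar>\<xi> i \<omega> * \<eta> i \<omega> * (\<tau> i \<omega> - \<eta> i \<omega>)\<bar> * ?D borel (\<lambda>\<omega>. (\<xi> i \<omega>, \<eta> i \<omega>, \<tau> i \<omega>)) \<omega>) \<partial>M)"
  proof -
    let ?Y = "\<lambda>\<omega>. (\<xi> i \<omega>, \<eta> i \<omega>, \<tau> i \<omega>)"
    let ?\<psi> = "\<lambda>(x, y, z) w. x * y * (sol_diff (w - y) - sol_diff (w - z))"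
    have Y: "?Y \<in> M \<rightarrow>\<^sub>M borel" by measurable
    have \<psi>: "(\<lambda>(z, w). ?\<psi> z w) \<in> borel_measurable (borel \<Otimes>\<^sub>M borel)"
      unfolding case_prod_beta borel_prod[symmetric] by measurable
    have "ennreal \<bar>T2\<bar> \<le> (\<integral>\<^sup>+\<omega>. ennreal \<bar>\<integral>w. ?\<psi> (?Y \<omega>) w \<partial>cond_law M borel ?Y W \<omega>\<bar> \<partial>M)"
      using abs_integral_le_cond_law[OF prob Y W_measurable \<psi>] j2 by (simp add: T2_def)
    also have "\<dots> \<le> (\<integral>\<^sup>+\<omega>. ennreal C * ennreal (\<bar>\<xi> i \<omega> * \<eta> i \<omega> * (\<tau> i \<omega> - \<eta> i \<omega>)\<bar> * ?D borel ?Y \<omega>) \<partial>M)"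
    proof (rule nn_integral_mono)
      fix \<omega> assume \<omega>: "\<omega> \<in> space M"
      let ?K = "cond_law M borel ?Y W \<omega>"
      have "\<bar>\<integral>w. ?\<psi> (?Y \<omega>) w \<partial>?K\<bar>
          = \<bar>\<xi> i \<omega> * \<eta> i \<omega>\<bar> * \<bar>\<integral>w. spline ramp f S (w + (b - \<eta> i \<omega>)) - spline ramp f S (w + (b - \<tau> i \<omega>)) \<partial>?K\<bar>"
        by (simp add: abs_mult diff_add_eq add_diff_eq)
      also have "\<dots> \<le> \<bar>\<xi> i \<omega> * \<eta> i \<omega>\<bar> * (C * D_norm l ?K * \<bar>(b - \<eta> i \<omega>) - (b - \<tau> i \<omega>)\<bar>)"
        by (intro mult_left_mono integral_spline_ramp_lipschitz K[OF Y \<omega>] l S C) auto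
      also have "\<dots> = C * (\<bar>\<xi> i \<omega> * \<eta> i \<omega> * (\<tau> i \<omega> - \<eta> i \<omega>)\<bar> * ?D borel ?Y \<omega>)" by (simp add: abs_mult)
      finally show "ennreal \<bar>\<integral>w. ?\<psi> (?Y \<omega>) w \<partial>?K\<bar> \<le> ennreal C * ennreal (\<bar>\<xi> i \<omega> * \<eta> i \<omega> * (\<tau> i \<omega> - \<eta> i \<omega>)\<bar> * ?D borel ?Y \<omega>)"
        using C_nonneg D_norm_nonneg[OF K[OF Y \<omega>] l] by (simp add: ennreal_mult[symmetric] ennreal_leI)
    qed
    also have "\<dots> \<le> ennreal C * (\<integral>\<^sup>+\<omega>. ennreal (\<bar>\<xi> i \<omega> * \<eta> i \<omega> * (\<tau> i \<omega> - \<eta> i \<omega>)\<bar> * ?D borel ?Y \<omega>) \<partial>M)"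
      using C_nonneg by (intro nn_integral_cmult_le)
    finally show ?thesis .
  qed

  have b3: "ennreal \<bar>T3\<bar> \<le> ennreal C * (\<integral>\<^sup>+\<omega>. ennreal (\<bar>\<tau> i \<omega>\<bar> * ?D borel (\<tau> i) \<omega>) \<partial>M)"
  proof -
    let ?\<psi> = "\<lambda>z w. sol_diff w - sol_diff (w - z)"
    have Y: "\<tau> i \<in> M \<rightarrow>\<^sub>M borel" by measurable
    have \<psi>: "(\<lambda>(z, w). ?\<psi> z w) \<in> borel_measurable (borel \<Otimes>\<^sub>M borel)"
      unfolding case_prod_beta by measurable
    have "ennreal \<bar>T3\<bar> \<le> (\<integral>\<^sup>+\<omega>. ennreal \<bar>\<integral>w. ?\<psi> (\<tau> i \<omega>) w \<partial>cond_law M borel (\<tau> i) W \<omega>\<bar> \<partial>M)"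
      using abs_integral_le_cond_law[OF prob Y W_measurable \<psi>] i3 by (simp add: T3_def)
    also have "\<dots> \<le> (\<integral>\<^sup>+\<omega>. ennreal C * ennreal (\<bar>\<tau> i \<omega>\<bar> * ?D borel (\<tau> i) \<omega>) \<partial>M)"
    proof (rule nn_integral_mono)
      fix \<omega> assume \<omega>: "\<omega> \<in> space M"
      let ?K = "cond_law M borel (\<tau> i) W \<omega>"
      have "\<bar>\<integral>w. ?\<psi> (\<tau> i \<omega>) w \<partial>?K\<bar> = \<bar>\<integral>w. spline ramp f S (w + b) - spline ramp f S (w + (b - \<tau> i \<omega>)) \<partial>?K\<bar>"
        by (simp add: algebra_simps)
      also have "\<dots> \<le> C * D_norm l ?K * \<bar>b - (b - \<tau> i \<omega>)\<bar>"
        by (intro integral_spline_ramp_lipschitz K[OF Y \<omega>] l S C) auto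
      also have "\<dots> = C * (\<bar>\<tau> i \<omega>\<bar> * ?D borel (\<tau> i) \<omega>)" by simp
      finally show "ennreal \<bar>\<integral>w. ?\<psi> (\<tau> i \<omega>) w \<partial>?K\<bar> \<le> ennreal C * ennreal (\<bar>\<tau> i \<omega>\<bar> * ?D borel (\<tau> i) \<omega>)"
        using C_nonneg D_norm_nonneg[OF K[OF Y \<omega>] l] by (simp add: ennreal_mult[symmetric] ennreal_leI)
    qed
    also have "\<dots> \<le> ennreal C * (\<integral>\<^sup>+\<omega>. ennreal (\<bar>\<tau> i \<omega>\<bar> * ?D borel (\<tau> i) \<omega>) \<partial>M)"
      using C_nonneg by (intro nn_integral_cmult_le)
    finally show ?thesis .
  qed

  have "\<bar>expectation (\<lambda>\<omega>. \<xi> i \<omega> * \<eta> i \<omega>) * T3 - T2 - T1\<bar>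
      \<le> \<bar>T1\<bar> + \<bar>T2\<bar> + \<bar>expectation (\<lambda>\<omega>. \<xi> i \<omega> * \<eta> i \<omega>)\<bar> * \<bar>T3\<bar>"
    unfolding abs_mult[symmetric] by linarith
  then have "ennreal \<bar>expectation (\<lambda>\<omega>. \<xi> i \<omega> * \<eta> i \<omega>) * T3 - T2 - T1\<bar>
      \<le> ennreal \<bar>T1\<bar> + ennreal \<bar>T2\<bar> + ennreal \<bar>expectation (\<lambda>\<omega>. \<xi> i \<omega> * \<eta> i \<omega>)\<bar> * ennreal \<bar>T3\<bar>"
    by (simp add: ennreal_leI ennreal_plus[symmetric] ennreal_mult[symmetric] del: ennreal_plus)
  also have "\<dots> \<le> ennreal C * (ennreal (1/2) *
       (\<integral>\<^sup>+\<omega>. ennreal (\<bar>\<xi> i \<omega>\<bar> * (\<eta> i \<omega>)\<^sup>2 * ?D borel (\<lambda>\<omega>. (\<xi> i \<omega>, \<eta> i \<omega>)) \<omega>) \<partial>M))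
     + ennreal C * (\<integral>\<^sup>+\<omega>. ennreal (\<bar>\<xi> i \<omega> * \<eta> i \<omega> * (\<tau> i \<omega> - \<eta> i \<omega>)\<bar> * ?D borel (\<lambda>\<omega>. (\<xi> i \<omega>, \<eta> i \<omega>, \<tau> i \<omega>)) \<omega>) \<partial>M)
     + ennreal \<bar>expectation (\<lambda>\<omega>. \<xi> i \<omega> * \<eta> i \<omega>)\<bar> * (ennreal C * (\<integral>\<^sup>+\<omega>. ennreal (\<bar>\<tau> i \<omega>\<bar> * ?D borel (\<tau> i) \<omega>) \<partial>M))"
    by (intro add_mono mult_left_mono b1 b2 b3) simp
  also have "\<dots> = ennreal C * theta M W l (\<xi> i) (\<eta> i) (\<tau> i)"
    unfolding theta_def by (simp only: distrib_left mult_ac)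
  finally show ?thesis unfolding eq .
qed

lemma local_dependence_stein_bound:
  "ennreal \<bar>expectation (\<lambda>\<omega>. variance W * sol_diff (W \<omega>) - W \<omega> * sol_avg (W \<omega>))\<bar>
    \<le> ennreal C * (\<Sum>i\<in>J. theta M W l (\<xi> i) (\<eta> i) (\<tau> i))"
proof -
  have iG: "integrable M (\<lambda>\<omega>. \<xi> i \<omega> * sol_avg (W \<omega>))" if i: "i \<in> J" for i
    using i rv W_measurable xi_integrable sq W_square
    by (intro mult_spline_quad_ramp_integrable integrable_mult_of_square) auto
  have "(\<lambda>\<omega>. W \<omega> * sol_avg (W \<omega>)) = (\<lambda>\<omega>. \<Sum>i\<in>J. \<xi> i \<omega> * sol_avg (W \<omega>))"
    by (simp add: W sum_distrib_right)
  then have "expectation (\<lambda>\<omega>. W \<omega> * sol_avg (W \<omega>)) = (\<Sum>i\<in>J. expectation (\<lambda>\<omega>. \<xi> i \<omega> * sol_avg (W \<omega>)))"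
    using iG by (simp add: Bochner_Integration.integral_sum)
  moreover have "integrable M (\<lambda>\<omega>. W \<omega> * sol_avg (W \<omega>))"
    using W_measurable W_integrable W_square
    by (intro mult_spline_quad_ramp_integrable) (auto simp: power2_eq_square)
  moreover have "integrable M (\<lambda>\<omega>. sol_diff (W \<omega>))" using W_measurable by (rule spline_ramp_integrable)
  ultimately have eq: "expectation (\<lambda>\<omega>. variance W * sol_diff (W \<omega>) - W \<omega> * sol_avg (W \<omega>))
     = (\<Sum>i\<in>J. expectation (\<lambda>\<omega>. \<xi> i \<omega> * \<eta> i \<omega>) * expectation (\<lambda>\<omega>. sol_diff (W \<omega>)) - expectation (\<lambda>\<omega>. \<xi> i \<omega> * sol_avg (W \<omega>)))"
    unfolding variance_W_eq by (simp add: sum_subtractf sum_distrib_right)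
  have "ennreal \<bar>expectation (\<lambda>\<omega>. variance W * sol_diff (W \<omega>) - W \<omega> * sol_avg (W \<omega>))\<bar>
      \<le> ennreal (\<Sum>i\<in>J. \<bar>expectation (\<lambda>\<omega>. \<xi> i \<omega> * \<eta> i \<omega>) * expectation (\<lambda>\<omega>. sol_diff (W \<omega>)) - expectation (\<lambda>\<omega>. \<xi> i \<omega> * sol_avg (W \<omega>))\<bar>)"
    unfolding eq by (intro ennreal_leI sum_abs)
  also have "\<dots> = (\<Sum>i\<in>J. ennreal \<bar>expectation (\<lambda>\<omega>. \<xi> i \<omega> * \<eta> i \<omega>) * expectation (\<lambda>\<omega>. sol_diff (W \<omega>)) - expectation (\<lambda>\<omega>. \<xi> i \<omega> * sol_avg (W \<omega>))\<bar>)"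
    by (rule sum_ennreal[symmetric]) simp
  also have "\<dots> \<le> (\<Sum>i\<in>J. ennreal C * theta M W l (\<xi> i) (\<eta> i) (\<tau> i))"
    by (rule sum_mono) (rule local_term_bound)
  finally show ?thesis by (simp add: sum_distrib_left)
qed

end

end

section \<open>Coarser conditioning\<close>

definition lattice_pt :: "real \<Rightarrow> int \<Rightarrow> real" where "lattice_pt a k = a + of_int k"

definition lattice_pts :: "real \<Rightarrow> nat \<Rightarrow> real set" where
  "lattice_pts a N = lattice_pt a ` {- int N..int N}"

lemma range_lattice_pt_iff: "x \<in> range (lattice_pt a) \<longleftrightarrow> x - a \<in> \<int>"
proof -
  have "x = a + of_int k \<longleftrightarrow> x - a = of_int k" for k :: int by linarith
  then show ?thesis unfolding lattice_pt_def Ints_def image_iff by blast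
qed

lemma UN_lattice_pts: "(\<Union>N. lattice_pts a N) = range (lattice_pt a)"
proof -
  have "k \<in> {- int (nat \<bar>k\<bar>)..int (nat \<bar>k\<bar>)}" for k by auto
  then show ?thesis unfolding lattice_pts_def by blast
qed

lemma incseq_lattice_pts: "incseq (lattice_pts a)"
  unfolding incseq_def lattice_pts_def by (intro allI impI image_mono) simp

lemma range_lattice_pt_borel: "range (lattice_pt a) \<in> sets borel"
  by (rule sets.countable) simp_all

section \<open>Laws on a lattice\<close>

context
  fixes \<mu> :: "real measure" and a :: real and l :: nat
  assumes prob: "prob_space \<mu>" and sets_\<mu>[measurable_cong]: "sets \<mu> = sets borel"
    and l: "l \<in> {1, 2}"
begin

lemma diff_conv_singleton:
  "diff_conv l \<mu> {x} = (if l = 1 then measure \<mu> {x - 1} - measure \<mu> {x}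
     else measure \<mu> {x - 2} - 2 * measure \<mu> {x - 1} + measure \<mu> {x})"
proof -
  have m: "measure (distr \<mu> borel (\<lambda>x. x + c)) {x} = measure \<mu> {x - c}" for c
  proof -
    have "(\<lambda>x. x + c) -` {x} \<inter> space \<mu> = {x - c}"
      using sets_eq_imp_space_eq[OF sets_\<mu>] by auto
    then show ?thesis by (subst measure_distr) auto
  qed
  show ?thesis using l diff_conv_1[OF prob sets_\<mu>, of "{x}"] diff_conv_2[OF prob sets_\<mu>, of "{x}"]
    unfolding m by auto
qed

lemma sum_lattice_le_D_norm:
  "(\<Sum>k\<in>{- int N..int N}. \<bar>diff_conv l \<mu> {lattice_pt a k}\<bar>) \<le> D_norm l \<mu>"
proof (rule sum_abs_diff_conv_le_D_norm[OF prob sets_\<mu> l])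
  show "disjoint_family_on (\<lambda>k. {lattice_pt a k}) {- int N..int N}"
    unfolding disjoint_family_on_def by (simp add: lattice_pt_def)
qed auto

text \<open>Every partition sum is a limit of sums over finite windows of the lattice, where the
  triangle inequality splits each block into atoms. Thus countably many inequalities about atoms
  control the supremum over all partitions.\<close>

lemma D_norm_le_lattice:
  assumes conc: "measure \<mu> (range (lattice_pt a)) = 1"
    and le: "\<And>N. (\<Sum>k\<in>{- int N..int N}. \<bar>diff_conv l \<mu> {lattice_pt a k}\<bar>) \<le> c"
  shows "D_norm l \<mu> \<le> c"
proof -
  let ?m = "\<lambda>i A. measure (distr \<mu> borel (\<lambda>x. x + real i)) A"
  have pr: "prob_space (distr \<mu> borel (\<lambda>x. x + real i))" for i by (rule prob_shift[OF prob sets_\<mu>])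
  have sing: "{x} \<in> sets borel" for x :: real by simp
  have dc: "diff_conv l \<mu> A = (if l = 1 then ?m 1 A - ?m 0 A else ?m 2 A - 2 * ?m 1 A + ?m 0 A)" for A
    using l diff_conv_1[OF prob sets_\<mu>, of A] diff_conv_2[OF prob sets_\<mu>, of A] by auto
  have fin: "finite (lattice_pts a N)" for N by (simp add: lattice_pts_def)
  \<comment> \<open>The shifts 0, 1, 2 are integers and preserve the lattice, so one sequence of
    windows serves all three laws.\<close>
  have conc': "?m i (range (lattice_pt a)) = 1" for i
  proof -
    have "x + real i - a \<in> \<int> \<longleftrightarrow> x - a \<in> \<int>" for x
    proof
      assume "x + real i - a \<in> \<int>"
      then have "(x + real i - a) - real i \<in> \<int>" by (rule Ints_diff) simp
      then show "x - a \<in> \<int>" by simp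
    next
      assume "x - a \<in> \<int>"
      then have "(x - a) + real i \<in> \<int>" by (rule Ints_add) simp
      then show "x + real i - a \<in> \<int>" by (simp add: algebra_simps)
    qed
    then have "(\<lambda>x. x + real i) -` range (lattice_pt a) \<inter> space \<mu> = range (lattice_pt a)"
      using sets_eq_imp_space_eq[OF sets_\<mu>] by (simp only: set_eq_iff Int_iff vimage_eq range_lattice_pt_iff) simp
    then show ?thesis using conc range_lattice_pt_borel by (subst measure_distr) auto
  qed
  have lim: "(\<lambda>N. diff_conv l \<mu> (A \<inter> lattice_pts a N)) \<longlonglongrightarrow> diff_conv l \<mu> A" if A: "A \<in> sets borel" for A
  proof -
    have "(\<lambda>N. ?m i (A \<inter> lattice_pts a N)) \<longlonglongrightarrow> ?m i A" for i
    proof -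
      interpret D: prob_space "distr \<mu> borel (\<lambda>x. x + real i)" by (rule pr)
      have AE: "AE x in distr \<mu> borel (\<lambda>x. x + real i). x \<in> range (lattice_pt a)"
        using conc'[of i] range_lattice_pt_borel by (intro D.AE_prob_1) auto
      have "A \<inter> lattice_pts a N \<in> sets borel" for N
        using A borel_closed[OF finite_imp_closed[OF fin]] by (rule sets.Int)
      then have "(\<lambda>N. ?m i (A \<inter> lattice_pts a N)) \<longlonglongrightarrow> ?m i (\<Union>N. A \<inter> lattice_pts a N)"
        using incseq_lattice_pts[of a] unfolding incseq_def
        by (intro D.finite_Lim_measure_incseq) (auto simp: incseq_def image_subset_iff)
      also have "(\<Union>N. A \<inter> lattice_pts a N) = A \<inter> range (lattice_pt a)"
        using UN_lattice_pts by blast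
      also have "?m i (A \<inter> range (lattice_pt a)) = ?m i A"
        using AE A range_lattice_pt_borel by (intro D.finite_measure_eq_AE) auto
      finally show ?thesis .
    qed
    from this[of 0] this[of 1] this[of 2] show ?thesis
      unfolding dc by (cases "l = 1") (simp_all only: simp_thms if_True if_False, (intro tendsto_intros; assumption)+)
  qed
  have fin_sum: "diff_conv l \<mu> E = (\<Sum>x\<in>E. diff_conv l \<mu> {x})" if "finite E" for E
  proof -
    have eq: "?m i E = (\<Sum>x\<in>E. ?m i {x})" for i
    proof -
      interpret D: prob_space "distr \<mu> borel (\<lambda>x. x + real i)" by (rule pr)
      show ?thesis using that by (intro D.finite_measure_eq_sum_singleton) auto
    qed
    show ?thesis
    proof (cases "l = 1")
      case True
      show ?thesis unfolding dc if_P[OF True] sum_subtractf eq[of 0] eq[of 1] ..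
    next
      case False
      show ?thesis
        unfolding dc if_not_P[OF False] sum.distrib sum_subtractf sum_distrib_left[symmetric] eq[of 0] eq[of 1] eq[of 2] ..
    qed
  qed
  show ?thesis
    unfolding D_norm_def variation_norm_def
  proof (rule cSUP_least)
    have "{UNIV} \<in> {P. finite P \<and> P \<subseteq> sets borel \<and> partition_on UNIV (P :: real set set)}"
      by (auto simp: partition_on_def)
    then show "{P. finite P \<and> P \<subseteq> sets borel \<and> partition_on UNIV (P :: real set set)} \<noteq> {}" by blast
    fix P :: "real set set" assume "P \<in> {P. finite P \<and> P \<subseteq> sets borel \<and> partition_on UNIV P}"
    then have P: "finite P" "\<And>A. A \<in> P \<Longrightarrow> A \<in> sets borel" "disjoint P" by (auto simp: partition_on_def)
    have "(\<Sum>A\<in>P. \<bar>diff_conv l \<mu> (A \<inter> lattice_pts a N)\<bar>) \<le> c" for N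
    proof -
      have "(\<Sum>A\<in>P. \<bar>diff_conv l \<mu> (A \<inter> lattice_pts a N)\<bar>)
          \<le> (\<Sum>A\<in>P. \<Sum>x\<in>A \<inter> lattice_pts a N. \<bar>diff_conv l \<mu> {x}\<bar>)"
        using fin by (subst fin_sum) (auto intro!: sum_mono sum_abs)
      also have "\<dots> = (\<Sum>x\<in>(\<Union>A\<in>P. A \<inter> lattice_pts a N). \<bar>diff_conv l \<mu> {x}\<bar>)"
        using P fin by (intro sum.UNION_disjoint[symmetric]) (auto simp: disjoint_def)
      also have "\<dots> \<le> (\<Sum>x\<in>lattice_pts a N. \<bar>diff_conv l \<mu> {x}\<bar>)"
        using fin by (intro sum_mono2) auto
      also have "\<dots> = (\<Sum>k\<in>{- int N..int N}. \<bar>diff_conv l \<mu> {lattice_pt a k}\<bar>)"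
        unfolding lattice_pts_def by (subst sum.reindex) (auto simp: lattice_pt_def inj_on_def)
      also have "\<dots> \<le> c" by (rule le)
      finally show ?thesis .
    qed
    moreover have "(\<lambda>N. \<Sum>A\<in>P. \<bar>diff_conv l \<mu> (A \<inter> lattice_pts a N)\<bar>) \<longlonglongrightarrow> (\<Sum>A\<in>P. \<bar>diff_conv l \<mu> A\<bar>)"
      using P by (intro tendsto_sum tendsto_rabs lim)
    ultimately show "(\<Sum>A\<in>P. \<bar>diff_conv l \<mu> A\<bar>) \<le> c"
      by (intro LIMSEQ_le_const2) auto
  qed
qed

end

text \<open>The law given \<open>g (Y \<omega>)\<close> is a conditional average of the laws given
  \<open>Y\<close>, and sums of absolute values are convex. For a fixed window this is an almost
  sure statement; the lattice reduces the supremum to countably many windows, whose null sets may be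
  united.\<close>

lemma D_norm_cond_law_coarser:
  assumes M: "prob_space M" and X: "X \<in> borel_measurable M" and lat: "AE \<omega> in M. X \<omega> - a \<in> \<int>"
    and Y: "Y \<in> M \<rightarrow>\<^sub>M N" and g: "g \<in> N \<rightarrow>\<^sub>M N'" and l: "l \<in> {1, 2}"
    and le: "AE \<omega> in M. D_norm l (cond_law M N Y X \<omega>) \<le> c"
  shows "AE \<omega> in M. D_norm l (cond_law M N' (\<lambda>\<omega>. g (Y \<omega>)) X \<omega>) \<le> c"
proof -
  interpret prob_space M by (rule M)
  have Y': "(\<lambda>\<omega>. g (Y \<omega>)) \<in> M \<rightarrow>\<^sub>M N'" using Y g by (rule measurable_compose)
  define F where "F = vimage_algebra (space M) Y N"
  define F' where "F' = vimage_algebra (space M) (\<lambda>\<omega>. g (Y \<omega>)) N'"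
  define K where "K = cond_law M N Y X"
  define K' where "K' = cond_law M N' (\<lambda>\<omega>. g (Y \<omega>)) X"
  have F: "subalgebra M F" and F': "subalgebra M F'"
    using Y Y' unfolding F_def F'_def subalgebra_def by (auto simp: sets_vimage_algebra2 measurable_def)
  have YF: "Y \<in> F \<rightarrow>\<^sub>M N" unfolding F_def using Y by (intro measurable_vimage_algebra1) (auto simp: measurable_def)
  have FF': "subalgebra F F'"
  proof -
    have "(\<lambda>\<omega>. g (Y \<omega>)) \<in> F \<rightarrow>\<^sub>M N'" using YF g by (rule measurable_compose)
    then show ?thesis unfolding F'_def subalgebra_def
      by (auto simp: sets_vimage_algebra2 measurable_def F_def)
  qed
  interpret F: finite_measure_subalgebra M F by standard (rule F)
  interpret F': finite_measure_subalgebra M F' by standard (rule F')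
  have K: "is_cond_law M F X K" and K': "is_cond_law M F' X K'"
    unfolding F_def F'_def K_def K'_def using cond_law_is_cond_law[OF M Y X] cond_law_is_cond_law[OF M Y' X] by auto
  have Kp: "prob_space (K \<omega>)" "sets (K \<omega>) = sets borel" "prob_space (K' \<omega>)" "sets (K' \<omega>) = sets borel"
    if "\<omega> \<in> space M" for \<omega>
    unfolding K_def K'_def using cond_law_real_prob[OF M Y X that] cond_law_real_prob[OF M Y' X that] by auto
  note X[measurable]
  have iB: "integrable M (\<lambda>\<omega>. indicator B (X \<omega>) :: real)" if [measurable]: "B \<in> sets borel" for B
    by (rule integrable_const_bound[where B=1]) (auto simp: indicator_def)
  have Km[measurable]: "(\<lambda>\<omega>. measure (K \<omega>) B) \<in> borel_measurable M" if "B \<in> sets borel" for B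
    using measurable_compose[OF cond_law_kernel[OF M F X K] measurable_measure_prob_algebra[OF that]]
    by (rule measurable_from_subalg[OF F])
  have iK: "integrable M (\<lambda>\<omega>. measure (K \<omega>) B)" if "B \<in> sets borel" for B
    using Km[OF that] Kp by (intro integrable_const_bound[where B=1] AE_I2) (auto intro: prob_space.prob_le_1)
  \<comment> \<open>The averaging of the conditional laws, one set at a time, is the tower property
    of conditional expectation.\<close>
  have tower: "AE \<omega> in M. measure (K' \<omega>) B = real_cond_exp M F' (\<lambda>\<omega>. measure (K \<omega>) B) \<omega>"
    if B: "B \<in> sets borel" for B
  proof -
    have "AE \<omega> in M. real_cond_exp M F' (\<lambda>\<omega>. measure (K \<omega>) B) \<omega>
        = real_cond_exp M F' (real_cond_exp M F (\<lambda>\<omega>. indicator B (X \<omega>))) \<omega>"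
      using K B Km[OF B] by (intro F'.real_cond_exp_cong) (auto simp: is_cond_law_def)
    moreover have "AE \<omega> in M. real_cond_exp M F' (real_cond_exp M F (\<lambda>\<omega>. indicator B (X \<omega>))) \<omega>
        = real_cond_exp M F' (\<lambda>\<omega>. indicator B (X \<omega>)) \<omega>"
      by (rule F'.real_cond_exp_nested_subalg[OF F FF' iB[OF B]])
    moreover have "AE \<omega> in M. measure (K' \<omega>) B = real_cond_exp M F' (\<lambda>\<omega>. indicator B (X \<omega>)) \<omega>"
      using K' B by (simp add: is_cond_law_def)
    ultimately show ?thesis by eventually_elim simp
  qed
  define d where "d = (\<lambda>K k (\<omega>::'a). diff_conv l (K \<omega> :: real measure) {lattice_pt a k})"
  define q where "q = (\<lambda>K k j (\<omega>::'a). measure (K \<omega> :: real measure) {lattice_pt a k - real j})"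
  have dq: "d L k \<omega> = (if l = 1 then q L k 1 \<omega> - q L k 0 \<omega> else q L k 2 \<omega> - 2 * q L k 1 \<omega> + q L k 0 \<omega>)"
    if "prob_space (L \<omega>)" "sets (L \<omega>) = sets borel" for L k \<omega>
    using diff_conv_singleton[OF that l] by (simp add: d_def q_def)
  have iq: "integrable M (q K k j)" for k j unfolding q_def by (rule iK) simp
  have tq: "AE \<omega> in M. q K' k j \<omega> = real_cond_exp M F' (q K k j) \<omega>" for k j
    unfolding q_def by (rule tower) simp
  \<comment> \<open>This equals \<open>d K k\<close> on \<open>space M\<close>, but as a combination
    of the integrable functions \<open>q\<close> it has no such proviso and can be conditioned
    directly.\<close>
  define dd where "dd = (\<lambda>k \<omega>. if l = 1 then q K k 1 \<omega> - q K k 0 \<omega> else q K k 2 \<omega> - 2 * q K k 1 \<omega> + q K k 0 \<omega>)"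
  have idd: "integrable M (dd k)" for k unfolding dd_def using iq l by auto
  have td: "AE \<omega> in M. d K' k \<omega> = real_cond_exp M F' (dd k) \<omega>" for k
  proof (cases "l = 1")
    case True
    have "AE \<omega> in M. real_cond_exp M F' (\<lambda>\<omega>. q K k 1 \<omega> - q K k 0 \<omega>) \<omega>
        = real_cond_exp M F' (q K k 1) \<omega> - real_cond_exp M F' (q K k 0) \<omega>"
      by (rule F'.real_cond_exp_diff) (rule iq)+
    moreover have "AE \<omega> in M. \<omega> \<in> space M" by simp
    ultimately show ?thesis using tq[of k 1] tq[of k 0]
      by eventually_elim (simp add: dq Kp dd_def True)
  next
    case False
    have "AE \<omega> in M. real_cond_exp M F' (\<lambda>\<omega>. (q K k 2 \<omega> - 2 * q K k 1 \<omega>) + q K k 0 \<omega>) \<omega>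
        = real_cond_exp M F' (\<lambda>\<omega>. q K k 2 \<omega> - 2 * q K k 1 \<omega>) \<omega> + real_cond_exp M F' (q K k 0) \<omega>"
      using iq by (intro F'.real_cond_exp_add) auto
    moreover have "AE \<omega> in M. real_cond_exp M F' (\<lambda>\<omega>. q K k 2 \<omega> - 2 * q K k 1 \<omega>) \<omega>
        = real_cond_exp M F' (q K k 2) \<omega> - real_cond_exp M F' (\<lambda>\<omega>. 2 * q K k 1 \<omega>) \<omega>"
      using iq by (intro F'.real_cond_exp_diff) auto
    moreover have "AE \<omega> in M. real_cond_exp M F' (\<lambda>\<omega>. 2 * q K k 1 \<omega>) \<omega> = 2 * real_cond_exp M F' (q K k 1) \<omega>"
      using iq by (intro F'.real_cond_exp_cmult) auto
    moreover have "AE \<omega> in M. \<omega> \<in> space M" by simp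
    ultimately show ?thesis using tq[of k 1] tq[of k 0] tq[of k 2]
      by eventually_elim (simp add: dq Kp dd_def False[unfolded One_nat_def])
  qed
  have tabs: "AE \<omega> in M. \<bar>real_cond_exp M F' (dd k) \<omega>\<bar> \<le> real_cond_exp M F' (\<lambda>\<omega>. \<bar>dd k \<omega>\<bar>) \<omega>" for k
  proof -
    have "AE \<omega> in M. real_cond_exp M F' (dd k) \<omega> \<le> real_cond_exp M F' (\<lambda>\<omega>. \<bar>dd k \<omega>\<bar>) \<omega>"
      using idd by (intro F'.real_cond_exp_mono) auto
    moreover have "AE \<omega> in M. real_cond_exp M F' (\<lambda>\<omega>. - 1 * dd k \<omega>) \<omega> \<le> real_cond_exp M F' (\<lambda>\<omega>. \<bar>dd k \<omega>\<bar>) \<omega>"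
      using idd by (intro F'.real_cond_exp_mono) auto
    moreover have "AE \<omega> in M. real_cond_exp M F' (\<lambda>\<omega>. - 1 * dd k \<omega>) \<omega> = - 1 * real_cond_exp M F' (dd k) \<omega>"
      using idd by (intro F'.real_cond_exp_cmult) auto
    ultimately show ?thesis by eventually_elim auto
  qed
  have "AE \<omega> in M. (\<Sum>k\<in>{- int N..int N}. \<bar>d K' k \<omega>\<bar>) \<le> c" for N
  proof -
    let ?I = "{- int N..int N}"
    have "AE \<omega> in M. \<omega> \<in> space M" by simp
    then have "AE \<omega> in M. (\<Sum>k\<in>?I. \<bar>dd k \<omega>\<bar>) \<le> c"
      using le
    proof eventually_elim
      case (elim \<omega>)
      have "dd k \<omega> = diff_conv l (K \<omega>) {lattice_pt a k}" for k
        using dq[of K \<omega> k, OF Kp(1,2)[OF elim(1)]] by (simp add: dd_def d_def)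
      then show ?case using sum_lattice_le_D_norm[OF Kp(1,2)[OF elim(1)] l, of a N] elim(2) by (simp add: K_def)
    qed
    then have "AE \<omega> in M. real_cond_exp M F' (\<lambda>\<omega>. \<Sum>k\<in>?I. \<bar>dd k \<omega>\<bar>) \<omega> \<le> c"
      using idd by (intro F'.real_cond_exp_le_c) auto
    moreover have "AE \<omega> in M. real_cond_exp M F' (\<lambda>\<omega>. \<Sum>k\<in>?I. \<bar>dd k \<omega>\<bar>) \<omega>
        = (\<Sum>k\<in>?I. real_cond_exp M F' (\<lambda>\<omega>. \<bar>dd k \<omega>\<bar>) \<omega>)"
      using idd by (intro F'.real_cond_exp_sum) auto
    moreover have "AE \<omega> in M. \<forall>k\<in>?I. \<bar>d K' k \<omega>\<bar> \<le> real_cond_exp M F' (\<lambda>\<omega>. \<bar>dd k \<omega>\<bar>) \<omega>"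
    proof (rule AE_finite_allI)
      fix k show "AE \<omega> in M. \<bar>d K' k \<omega>\<bar> \<le> real_cond_exp M F' (\<lambda>\<omega>. \<bar>dd k \<omega>\<bar>) \<omega>"
        using td[of k] tabs[of k] by eventually_elim simp
    qed simp
    ultimately show ?thesis
    proof eventually_elim
      case (elim \<omega>)
      have "(\<Sum>k\<in>?I. \<bar>d K' k \<omega>\<bar>) \<le> (\<Sum>k\<in>?I. real_cond_exp M F' (\<lambda>\<omega>. \<bar>dd k \<omega>\<bar>) \<omega>)"
        using elim(3) by (intro sum_mono) auto
      then show ?case using elim by simp
    qed
  qed
  then have all: "AE \<omega> in M. \<forall>N. (\<Sum>k\<in>{- int N..int N}. \<bar>d K' k \<omega>\<bar>) \<le> c"
    unfolding AE_all_countable by blast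
  have conc: "AE \<omega> in M. measure (K' \<omega>) (range (lattice_pt a)) = 1"
  proof -
    let ?R = "range (lattice_pt a)"
    have "AE \<omega> in M. real_cond_exp M F' (\<lambda>\<omega>. indicator ?R (X \<omega>)) \<omega> = real_cond_exp M F' (\<lambda>\<omega>. 1) \<omega>"
    proof (rule F'.real_cond_exp_cong)
      show "AE \<omega> in M. indicator ?R (X \<omega>) = (1::real)"
        using lat by eventually_elim (simp add: range_lattice_pt_iff indicator_def)
    qed (use range_lattice_pt_borel in measurable)
    moreover have "AE \<omega> in M. real_cond_exp M F' (\<lambda>\<omega>. 1) \<omega> = 1"
      by (rule F'.real_cond_exp_F_meas) auto
    moreover have "AE \<omega> in M. measure (K' \<omega>) ?R = real_cond_exp M F' (\<lambda>\<omega>. indicator ?R (X \<omega>)) \<omega>"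
      using K' range_lattice_pt_borel by (auto simp: is_cond_law_def)
    ultimately show ?thesis by eventually_elim simp
  qed
  have "AE \<omega> in M. \<omega> \<in> space M" by simp
  with all conc show ?thesis
  proof eventually_elim
    case (elim \<omega>)
    have "D_norm l (K' \<omega>) \<le> c"
      using elim by (intro D_norm_le_lattice[OF Kp(3,4) l, where a=a]) (auto simp: d_def)
    then show ?case by (simp add: K'_def)
  qed
qed

lemma nn_integral_mult_bound_le:
  fixes u D :: "'w \<Rightarrow> real"
  assumes "\<And>\<omega>. 0 \<le> u \<omega>" "0 \<le> c" "AE \<omega> in M. D \<omega> \<le> c"
  shows "(\<integral>\<^sup>+\<omega>. ennreal (u \<omega> * D \<omega>) \<partial>M) \<le> ennreal c * (\<integral>\<^sup>+\<omega>. ennreal (u \<omega>) \<partial>M)"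
proof -
  have "(\<integral>\<^sup>+\<omega>. ennreal (u \<omega> * D \<omega>) \<partial>M) \<le> (\<integral>\<^sup>+\<omega>. ennreal c * ennreal (u \<omega>) \<partial>M)"
  proof (rule nn_integral_mono_AE)
    show "AE \<omega> in M. ennreal (u \<omega> * D \<omega>) \<le> ennreal c * ennreal (u \<omega>)"
      using assms(3)
    proof eventually_elim
      case (elim \<omega>)
      then have "u \<omega> * D \<omega> \<le> c * u \<omega>" using mult_left_mono[OF elim assms(1)[of \<omega>]] by (simp add: mult.commute)
      then show ?case using assms(1,2) by (simp add: ennreal_mult[symmetric] ennreal_leI)
    qed
  qed
  also have "\<dots> \<le> ennreal c * (\<integral>\<^sup>+\<omega>. ennreal (u \<omega>) \<partial>M)" by (rule nn_integral_cmult_le) fact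
  finally show ?thesis .
qed

section \<open>Binomial approximation\<close>

lemma ennreal_SUP_le:
  fixes g :: "'a \<Rightarrow> real"
  assumes "I \<noteq> {}" "\<And>x. x \<in> I \<Longrightarrow> ennreal (g x) \<le> R" "\<And>x. x \<in> I \<Longrightarrow> 0 \<le> g x"
  shows "ennreal (SUP x\<in>I. g x) \<le> R"
proof (cases R)
  case (real r)
  then have "g x \<le> r" if "x \<in> I" for x
    using assms(2)[OF that] that by (simp add: ennreal_le_iff)
  then have "(SUP x\<in>I. g x) \<le> r" using assms(1) by (intro cSUP_least) auto
  then show ?thesis using real by (simp add: ennreal_leI)
qed simp

lemma measure_centered_binomial:
  assumes "0 \<le> p" "p \<le> 1" and A: "A \<in> sets borel"
  shows "measure (centered_binomial n p) A = (\<Sum>j\<in>{j. real j - real n * p \<in> A} \<inter> {..n}. bin_weight n p j)"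
proof -
  let ?H = "{j. real j - real n * p \<in> A}"
  have "measure (centered_binomial n p) A = measure_pmf.prob (binomial_pmf n p) ?H"
    using A by (simp add: centered_binomial_def measure_distr vimage_def)
  also have "\<dots> = measure_pmf.prob (binomial_pmf n p) (?H \<inter> {..n})"
  proof (rule measure_pmf.finite_measure_eq_AE)
    show "AE x in measure_pmf (binomial_pmf n p). (x \<in> ?H) = (x \<in> ?H \<inter> {..n})"
      using assms set_pmf_binomial_eq[of p n] by (auto simp: AE_measure_pmf_iff split: if_splits)
  qed auto
  also have "\<dots> = (\<Sum>j\<in>?H \<inter> {..n}. bin_weight n p j)"
    by (subst measure_measure_pmf_finite) (auto simp: bin_weight_def)
  finally show ?thesis .
qed

text \<open>The splines are indexed by integers. Since \<open>set_sol\<close> already vanishes at 0,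
  the extension by 0 to negative integers creates no new increment.\<close>

definition int_sol :: "nat \<Rightarrow> real \<Rightarrow> nat set \<Rightarrow> int \<Rightarrow> real" where
  "int_sol n p H k = (if 0 \<le> k then set_sol n p H (nat k) else 0)"

section \<open>The Stein equation on all integers\<close>

context
  fixes n :: nat and p :: real
  assumes p: "0 < p" "p < 1"
begin

lemma int_sol_support: "k \<notin> {0..int n} \<Longrightarrow> int_sol n p H k = 0"
  by (auto simp: int_sol_def set_sol_above[OF p])

lemma int_sol_diff_bound: "\<bar>int_sol n p H (k + 1) - int_sol n p H k\<bar> \<le> 1 / ((real n + 1) * p * (1 - p))"
proof -
  consider "0 \<le> k" | "k = -1" | "k < -1" by linarith
  then show ?thesis
  proof cases
    case 1
    then have "nat (k + 1) = Suc (nat k)" by simp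
    then show ?thesis using 1 set_sol_diff_bound[OF p, of n H "nat k"] by (simp add: int_sol_def)
  qed (use p in \<open>auto simp: int_sol_def set_sol_0[OF p]\<close>)
qed

lemma int_sol_point_bound:
  "\<bar>int_sol n p (H \<inter> {j}) k\<bar> \<le> 1 / ((real n + 1) * p * (1 - p))"
  using set_sol_point_bound[OF p, of n H j "nat k"] p by (simp add: int_sol_def)

lemma int_sol_stein:
  assumes "0 \<le> k" "k \<le> int n"
  shows "p * (real n - of_int k) * int_sol n p H (k + 1) - (1 - p) * of_int k * int_sol n p H k
    = of_bool (nat k \<in> H) - (\<Sum>j\<in>H \<inter> {..n}. bin_weight n p j)"
proof -
  have "nat (k + 1) = Suc (nat k)" "real (nat k) = of_int k" using assms by auto
  then show ?thesis using set_sol_stein[OF p, of "nat k" n H] assms by (simp add: int_sol_def nat_le_iff)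
qed

lemma int_sol_outside:
  assumes "k < 0 \<or> int n < k"
  shows "int_sol n p H k = 0" "int_sol n p H (k + 1) = 0"
  using assms by (auto simp: int_sol_def set_sol_0[OF p] set_sol_above[OF p])

lemma sum_bin_weight_bounds:
  "0 \<le> (\<Sum>j\<in>H \<inter> {..n}. bin_weight n p j)" "(\<Sum>j\<in>H \<inter> {..n}. bin_weight n p j) \<le> 1"
proof -
  show "0 \<le> (\<Sum>j\<in>H \<inter> {..n}. bin_weight n p j)" by (simp add: sum_nonneg)
  have "(\<Sum>j\<in>H \<inter> {..n}. bin_weight n p j) \<le> (\<Sum>j\<le>n. bin_weight n p j)" by (rule sum_mono2) auto
  then show "(\<Sum>j\<in>H \<inter> {..n}. bin_weight n p j) \<le> 1" using sum_bin_weight[of p n] p by simp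
qed

end

text \<open>
  For a lattice point \<open>x = k - n p\<close> the Stein identity gives the bracket up to the correction
  \<open>(n p (1 - p) - \<sigma>2 + t x) \<Delta>\<close>; points outside the binomial support satisfy \<open>\<bar>x\<bar> \<ge> n / 2\<close>.
\<close>

lemma stein_pointwise_bound:
  fixes \<sigma>2 \<delta> t p x :: real and n :: nat and k :: int
  assumes \<sigma>2: "\<sigma>2 > 1" and \<delta>: "0 \<le> \<delta>" "\<delta> < 1" and n: "real n = 4 * \<sigma>2 + \<delta>"
    and t: "0 \<le> t" "real n * t < 1" and p: "p = 1/2 - t"
    and x: "x = of_int k - real n * p"
  shows "\<bar>indicator K k - (\<Sum>j\<in>{j. int j \<in> K} \<inter> {..n}. bin_weight n p j)
      - (\<sigma>2 * (int_sol n p {j. int j \<in> K} (k + 1) - int_sol n p {j. int j \<in> K} k)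
         - x * ((int_sol n p {j. int j \<in> K} k + int_sol n p {j. int j \<in> K} (k + 1)) / 2))\<bar>
    \<le> (1 / \<sigma>2) * (1 / 4 + t * (x\<^sup>2 + 1) / 2) + 4 / (real n)\<^sup>2 * x\<^sup>2"
    (is "\<bar>?h - ?P - (\<sigma>2 * (?f' - ?f) - x * ((?f + ?f') / 2))\<bar> \<le> ?B")
    and "1 / ((real n + 1) * p * (1 - p)) \<le> 1 / \<sigma>2"
proof -
  let ?H = "{j. int j \<in> K}"
  have n4: "real n > 4" using \<sigma>2 \<delta> n by simp
  \<comment> \<open>Integrality of \<open>n\<close> matters: \<open>n > 4\<close> alone would give
    only \<open>n * t\<^sup>2 \<le> 1/4\<close>, which does not suffice for the lower bound on
    \<open>(n + 1) * p * (1 - p)\<close>.\<close>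
  then have "n \<ge> 5" by simp
  then have n5: "real n \<ge> 5" by simp
  have t5: "t < 1 / 5"
  proof -
    have "5 * t \<le> real n * t" using n5 t by (intro mult_right_mono) auto
    then show ?thesis using t by simp
  qed
  have p01: "0 < p" "p < 1" using p t t5 by auto
  have nt2: "real n * t\<^sup>2 \<le> 1 / 5"
  proof -
    have "real n * t\<^sup>2 = (real n * t) * t" by (simp add: power2_eq_square)
    also have "\<dots> \<le> 1 * t" using t by (intro mult_right_mono) auto
    finally show ?thesis using t5 by simp
  qed
  have t2: "t\<^sup>2 \<le> 1 / 25"
  proof -
    have "t\<^sup>2 \<le> (1 / 5)\<^sup>2" using t t5 by (intro power_mono) auto
    then show ?thesis by (simp add: power2_eq_square)
  qed
  have pq: "p * (1 - p) = 1 / 4 - t\<^sup>2" unfolding p by (simp add: algebra_simps power2_eq_square)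
  \<comment> \<open>The extra 1/4 that comes from \<open>n + 1\<close> pays for the loss
    \<open>n * t\<^sup>2 + t\<^sup>2 \<le> 1/5 + 1/25\<close>, so the Stein bound becomes exactly
    \<open>1 / \<sigma>2\<close>.\<close>
  have "(real n + 1) * p * (1 - p) = real n / 4 + 1 / 4 - real n * t\<^sup>2 - t\<^sup>2"
    unfolding mult.assoc pq by (simp add: algebra_simps)
  also have "\<dots> \<ge> \<sigma>2" using n \<delta> nt2 t2 by linarith
  finally have ge: "\<sigma>2 \<le> (real n + 1) * p * (1 - p)" .
  then show C: "1 / ((real n + 1) * p * (1 - p)) \<le> 1 / \<sigma>2" using \<sigma>2 by (intro divide_left_mono) auto
  have \<Delta>: "\<bar>?f' - ?f\<bar> \<le> 1 / \<sigma>2" using int_sol_diff_bound[OF p01, where n=n and H="?H" and k=k] C by simp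
  have hP: "\<bar>?h - ?P\<bar> \<le> 1"
    using sum_bin_weight_bounds[OF p01, where n=n and H="?H"] by (auto simp: indicator_def)
  have B1: "0 \<le> (1 / \<sigma>2) * (1 / 4 + t * (x\<^sup>2 + 1) / 2)" using \<sigma>2 t by auto
  show "\<bar>?h - ?P - (\<sigma>2 * (?f' - ?f) - x * ((?f + ?f') / 2))\<bar> \<le> ?B"
  proof (cases "0 \<le> k \<and> k \<le> int n")
    case True
    have "?h - ?P = p * (real n - of_int k) * ?f' - (1 - p) * of_int k * ?f"
      using int_sol_stein[OF p01, where n=n and H="?H" and k=k] True by (simp add: indicator_def of_bool_def)
    also have "\<dots> = \<sigma>2 * (?f' - ?f) - x * ((?f + ?f') / 2) + (real n * (p * (1 - p)) - \<sigma>2 + t * x) * (?f' - ?f)"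
    proof -
      have k: "of_int k = x + real n * p" using x by simp
      have q: "t = 1/2 - p" using p by simp
      show ?thesis unfolding k q by (simp add: algebra_simps)
    qed
    finally have "\<bar>?h - ?P - (\<sigma>2 * (?f' - ?f) - x * ((?f + ?f') / 2))\<bar>
        = \<bar>real n * (p * (1 - p)) - \<sigma>2 + t * x\<bar> * \<bar>?f' - ?f\<bar>"
      by (simp add: abs_mult)
    also have "\<dots> \<le> (1 / 4 + t * (x\<^sup>2 + 1) / 2) * (1 / \<sigma>2)"
    proof (rule mult_mono[OF _ \<Delta>])
      have "real n * (p * (1 - p)) - \<sigma>2 = \<delta> / 4 - real n * t\<^sup>2"
        unfolding pq n by (simp add: algebra_simps)
      moreover have "0 \<le> real n * t\<^sup>2" by simp
      ultimately have "\<bar>real n * (p * (1 - p)) - \<sigma>2\<bar> \<le> 1 / 4" using \<delta> nt2 by linarith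
      \<comment> \<open>The linear term is traded for a quadratic one, whose mean is given by
        \<open>\<sigma>2\<close>.\<close>
      moreover have "\<bar>t * x\<bar> \<le> t * (x\<^sup>2 + 1) / 2"
      proof -
        have "0 \<le> (\<bar>x\<bar> - 1)\<^sup>2" by simp
        then have "\<bar>x\<bar> \<le> (x\<^sup>2 + 1) / 2" by (simp add: power2_diff)
        from mult_left_mono[OF this t(1)] show ?thesis using t by (simp add: abs_mult)
      qed
      ultimately show "\<bar>real n * (p * (1 - p)) - \<sigma>2 + t * x\<bar> \<le> 1 / 4 + t * (x\<^sup>2 + 1) / 2" by linarith
    qed (use t in auto)
    also have "\<dots> \<le> ?B" by simp
    finally show ?thesis .
  next
    case False
    have np: "real n * p = real n / 2 - real n * t" unfolding p by (simp add: algebra_simps)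
    have "real n / 2 \<le> \<bar>x\<bar>"
    proof (cases "0 \<le> k")
      case True
      then have "int n + 1 \<le> k" using False by simp
      then have "real n + 1 \<le> of_int k" by linarith
      moreover have "0 \<le> real n * t" using t by simp
      ultimately show ?thesis using x np by linarith
    next
      case False
      then have "k \<le> -1" by simp
      then have "of_int k \<le> (-1::real)" by linarith
      then show ?thesis using x np t by linarith
    qed
    then have "(real n / 2)\<^sup>2 \<le> \<bar>x\<bar>\<^sup>2" by (rule power_mono) simp
    \<comment> \<open>Chebyshev's inequality in pointwise form: outside the support there is no
      Stein equation, and the trivial bound 1 is replaced by a multiple of
      \<open>x\<^sup>2\<close>.\<close>
    then have "1 \<le> 4 / (real n)\<^sup>2 * x\<^sup>2" using n5 by (simp add: field_simps power2_eq_square)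
    moreover have "?f = 0" "?f' = 0" using int_sol_outside[OF p01, where n=n and H="?H" and k=k] False by auto
    ultimately show ?thesis using hP B1 by simp
  qed
qed

text \<open>Each of the three conditionings in \<open>theta\<close> is by a function of the family
  on \<open>B i\<close>, hence coarser. That \<open>\<xi> i\<close> is such a function requires
  \<open>i\<close> in \<open>B i\<close>; if \<open>i\<close> is not in \<open>A i\<close>, then
  \<open>\<xi> i\<close> is almost surely 0 and all three terms vanish.\<close>

lemma theta_le_constant:
  fixes M :: "'w measure" and J :: "'i set" and \<xi> :: "'i \<Rightarrow> 'w \<Rightarrow> real"
    and a :: "'i \<Rightarrow> real" and A B :: "'i \<Rightarrow> 'i set"
    and W :: "'w \<Rightarrow> real" and \<eta> \<tau> :: "'i \<Rightarrow> 'w \<Rightarrow> real"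
  assumes prob: "prob_space M"
    and J: "finite J"
    and rv: "\<And>i. i \<in> J \<Longrightarrow> \<xi> i \<in> borel_measurable M"
    and sq: "\<And>i. i \<in> J \<Longrightarrow> integrable M (\<lambda>\<omega>. (\<xi> i \<omega>)\<^sup>2)"
    and mean: "\<And>i. i \<in> J \<Longrightarrow> prob_space.expectation M (\<xi> i) = 0"
    and lattice: "AE \<omega> in M. W \<omega> - a0 \<in> \<int>"
    and W: "W = (\<lambda>\<omega>. \<Sum>i\<in>J. \<xi> i \<omega>)"
    and subs: "\<And>i. i \<in> J \<Longrightarrow> A i \<subseteq> B i \<and> B i \<subseteq> J"
    and indep1: "\<And>i. i \<in> J \<Longrightarrow> indep_subfamilies M \<xi> {i} (J - A i)"
    and indep2: "\<And>i. i \<in> J \<Longrightarrow> indep_subfamilies M \<xi> (A i) (J - B i)"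
    and \<eta>: "\<eta> = (\<lambda>i \<omega>. \<Sum>j\<in>A i. \<xi> j \<omega>)"
    and \<tau>: "\<tau> = (\<lambda>i \<omega>. \<Sum>j\<in>B i. \<xi> j \<omega>)"
    and l: "l \<in> {1, 2}" and i: "i \<in> J"
    and c: "AE \<omega> in M. D_norm l (cond_law M (family_space (B i)) (subfamily \<xi> (B i)) W \<omega>) \<le> c"
  shows "theta M W l (\<xi> i) (\<eta> i) (\<tau> i) \<le> ennreal c *
          (ennreal (1/2) * (\<integral>\<^sup>+\<omega>. ennreal \<bar>\<xi> i \<omega> * (\<eta> i \<omega>)\<^sup>2\<bar> \<partial>M)
           + (\<integral>\<^sup>+\<omega>. ennreal \<bar>\<xi> i \<omega> * \<eta> i \<omega> * (\<tau> i \<omega> - \<eta> i \<omega>)\<bar> \<partial>M)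
           + ennreal \<bar>\<integral>\<omega>. \<xi> i \<omega> * \<eta> i \<omega> \<partial>M\<bar> * (\<integral>\<^sup>+\<omega>. ennreal \<bar>\<tau> i \<omega>\<bar> \<partial>M))"
proof (cases "i \<in> A i")
  case False
  interpret prob_space M by (rule prob)
  have z: "AE \<omega> in M. \<xi> i \<omega> = 0"
    by (rule xi_zero[OF prob J rv sq mean W subs indep1 indep2 \<eta> \<tau> i False])
  have "(\<integral>\<omega>. \<xi> i \<omega> * \<eta> i \<omega> \<partial>M) = 0"
    using z by (auto intro!: integral_eq_zero_AE elim!: eventually_mono)
  moreover have "(\<integral>\<^sup>+\<omega>. ennreal (\<bar>\<xi> i \<omega>\<bar> * u \<omega>) \<partial>M) = 0" for u
  proof -
    have "(\<integral>\<^sup>+\<omega>. ennreal (\<bar>\<xi> i \<omega>\<bar> * u \<omega>) \<partial>M) = (\<integral>\<^sup>+\<omega>. 0 \<partial>M)"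
      by (rule nn_integral_cong_AE) (use z in \<open>auto elim!: eventually_mono\<close>)
    then show ?thesis by simp
  qed
  ultimately have "theta M W l (\<xi> i) (\<eta> i) (\<tau> i) = 0"
    unfolding theta_def by (simp add: abs_mult mult.assoc)
  then show ?thesis by simp
next
  case iA: True
  interpret prob_space M by (rule prob)
  have sub: "A i \<subseteq> B i" "B i \<subseteq> J" "i \<in> B i" using subs[OF i] iA by auto
  have Wm: "W \<in> borel_measurable M" unfolding W using rv by simp
  have K: "prob_space (cond_law M (family_space (B i)) (subfamily \<xi> (B i)) W \<omega>)"
      "sets (cond_law M (family_space (B i)) (subfamily \<xi> (B i)) W \<omega>) = sets borel" if "\<omega> \<in> space M" for \<omega>
    using cond_law_real_prob[OF prob subfamily_measurable[of "B i" \<xi> M] Wm that] sub rv by auto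
  \<comment> \<open>The constant is an arbitrary real, and \<open>ennreal\<close> sends negative
    numbers to 0, so its sign is derived from that of \<open>D_norm\<close>.\<close>
  have "AE \<omega> in M. 0 \<le> c"
    using c AE_space[of M]
  proof eventually_elim
    case (elim \<omega>)
    then show ?case using D_norm_nonneg[OF K[OF elim(2)] l] by simp
  qed
  then have c0: "0 \<le> c" by simp
  have coarse: "AE \<omega> in M. D_norm l (cond_law M N Y W \<omega>) \<le> c"
    if g: "g \<in> family_space (B i) \<rightarrow>\<^sub>M N" and Y: "Y = (\<lambda>\<omega>. g (subfamily \<xi> (B i) \<omega>))" for g N Y
    unfolding Y using sub rv
    by (intro D_norm_cond_law_coarser[OF prob Wm lattice _ g l c] subfamily_measurable) auto
  have comp[measurable]: "(\<lambda>x. x j) \<in> borel_measurable (family_space (B i))" if "j \<in> B i" for j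
    using that by (rule measurable_component_singleton)
  have e: "\<xi> i = (\<lambda>\<omega>. subfamily \<xi> (B i) \<omega> i)" "\<eta> i = (\<lambda>\<omega>. \<Sum>j\<in>A i. subfamily \<xi> (B i) \<omega> j)"
    "\<tau> i = (\<lambda>\<omega>. \<Sum>j\<in>B i. subfamily \<xi> (B i) \<omega> j)"
    using sub by (auto simp: \<eta> \<tau> subfamily_def fun_eq_iff intro!: sum.cong)
  have m1: "(\<lambda>x. x i) \<in> borel_measurable (family_space (B i))" using sub by (intro comp)
  have m2: "(\<lambda>x. \<Sum>j\<in>A i. x j) \<in> borel_measurable (family_space (B i))"
    using sub by (intro borel_measurable_sum comp) auto
  have m3: "(\<lambda>x. \<Sum>j\<in>B i. x j) \<in> borel_measurable (family_space (B i))"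
    by (intro borel_measurable_sum comp)
  have 1: "AE \<omega> in M. D_norm l (cond_law M borel (\<lambda>\<omega>. (\<xi> i \<omega>, \<eta> i \<omega>)) W \<omega>) \<le> c"
    by (rule coarse[of "\<lambda>x. (x i, \<Sum>j\<in>A i. x j)"]) (use m1 m2 in \<open>auto simp: e intro: borel_measurable_Pair\<close>)
  have 2: "AE \<omega> in M. D_norm l (cond_law M borel (\<lambda>\<omega>. (\<xi> i \<omega>, \<eta> i \<omega>, \<tau> i \<omega>)) W \<omega>) \<le> c"
    by (rule coarse[of "\<lambda>x. (x i, \<Sum>j\<in>A i. x j, \<Sum>j\<in>B i. x j)"])
      (use m1 m2 m3 in \<open>auto simp: e intro: borel_measurable_Pair\<close>)
  have 3: "AE \<omega> in M. D_norm l (cond_law M borel (\<tau> i) W \<omega>) \<le> c"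
    by (rule coarse[OF m3]) (simp add: e)
  have "theta M W l (\<xi> i) (\<eta> i) (\<tau> i)
      \<le> ennreal (1/2) * (ennreal c * (\<integral>\<^sup>+\<omega>. ennreal (\<bar>\<xi> i \<omega>\<bar> * (\<eta> i \<omega>)\<^sup>2) \<partial>M))
       + ennreal c * (\<integral>\<^sup>+\<omega>. ennreal \<bar>\<xi> i \<omega> * \<eta> i \<omega> * (\<tau> i \<omega> - \<eta> i \<omega>)\<bar> \<partial>M)
       + ennreal \<bar>\<integral>\<omega>. \<xi> i \<omega> * \<eta> i \<omega> \<partial>M\<bar> * (ennreal c * (\<integral>\<^sup>+\<omega>. ennreal \<bar>\<tau> i \<omega>\<bar> \<partial>M))"
    unfolding theta_def
    by (intro add_mono mult_left_mono nn_integral_mult_bound_le c0 1 2 3) auto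
  also have "\<dots> = ennreal c *
          (ennreal (1/2) * (\<integral>\<^sup>+\<omega>. ennreal (\<bar>\<xi> i \<omega>\<bar> * (\<eta> i \<omega>)\<^sup>2) \<partial>M)
           + (\<integral>\<^sup>+\<omega>. ennreal \<bar>\<xi> i \<omega> * \<eta> i \<omega> * (\<tau> i \<omega> - \<eta> i \<omega>)\<bar> \<partial>M)
           + ennreal \<bar>\<integral>\<omega>. \<xi> i \<omega> * \<eta> i \<omega> \<partial>M\<bar> * (\<integral>\<^sup>+\<omega>. ennreal \<bar>\<tau> i \<omega>\<bar> \<partial>M))"
    by (simp only: distrib_left mult_ac)
  also have "(\<lambda>\<omega>. ennreal (\<bar>\<xi> i \<omega>\<bar> * (\<eta> i \<omega>)\<^sup>2)) = (\<lambda>\<omega>. ennreal \<bar>\<xi> i \<omega> * (\<eta> i \<omega>)\<^sup>2\<bar>)"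
    by (simp add: abs_mult)
  finally show ?thesis .
qed

text \<open>The difference of the two probabilities is the expectation of the Stein bracket
  \<open>R\<close>, which local dependence controls, plus an error of mean at most
  \<open>1.75 / \<sigma>2\<close>. The set \<open>K\<close> is arbitrary for total variation and has
  at most one point for the local distance.\<close>

lemma binomial_approx_on_set:
  fixes M :: "'w measure" and J :: "'i set" and \<xi> :: "'i \<Rightarrow> 'w \<Rightarrow> real"
    and A B :: "'i \<Rightarrow> 'i set"
    and W :: "'w \<Rightarrow> real" and \<eta> \<tau> :: "'i \<Rightarrow> 'w \<Rightarrow> real"
    and \<sigma>2 \<delta> t p :: real and n :: nat and K :: "int set"
  assumes prob: "prob_space M"
    and J: "finite J"
    and rv: "\<And>i. i \<in> J \<Longrightarrow> \<xi> i \<in> borel_measurable M"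
    and sq: "\<And>i. i \<in> J \<Longrightarrow> integrable M (\<lambda>\<omega>. (\<xi> i \<omega>)\<^sup>2)"
    and mean: "\<And>i. i \<in> J \<Longrightarrow> prob_space.expectation M (\<xi> i) = 0"
    and W: "W = (\<lambda>\<omega>. \<Sum>i\<in>J. \<xi> i \<omega>)"
    and subs: "\<And>i. i \<in> J \<Longrightarrow> A i \<subseteq> B i \<and> B i \<subseteq> J"
    and indep1: "\<And>i. i \<in> J \<Longrightarrow> indep_subfamilies M \<xi> {i} (J - A i)"
    and indep2: "\<And>i. i \<in> J \<Longrightarrow> indep_subfamilies M \<xi> (A i) (J - B i)"
    and \<eta>: "\<eta> = (\<lambda>i \<omega>. \<Sum>j\<in>A i. \<xi> j \<omega>)"
    and \<tau>: "\<tau> = (\<lambda>i \<omega>. \<Sum>j\<in>B i. \<xi> j \<omega>)"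
    and \<sigma>2: "\<sigma>2 = prob_space.variance M W" "\<sigma>2 > 1"
    and \<delta>: "0 \<le> \<delta>" "\<delta> < 1" and n: "real n = 4 * \<sigma>2 + \<delta>"
    and t: "0 \<le> t" "real n * t < 1" and p: "p = 1/2 - t"
    and lat: "AE \<omega> in M. W \<omega> + real n * p \<in> \<int>"
    and l: "l \<in> {1, 2}" and K: "l = 1 \<or> K \<subseteq> {k0}"
  shows "ennreal \<bar>prob_space.expectation M (\<lambda>\<omega>. indicator K \<lfloor>W \<omega> + real n * p\<rfloor>)
      - (\<Sum>j\<in>{j. int j \<in> K} \<inter> {..n}. bin_weight n p j)\<bar>
    \<le> ennreal (1 / \<sigma>2) * ((\<Sum>i\<in>J. theta M W l (\<xi> i) (\<eta> i) (\<tau> i)) + ennreal 1.75)"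
proof -
  interpret prob_space M by (rule prob)
  let ?H = "{j. int j \<in> K}"
  let ?P = "\<Sum>j\<in>?H \<inter> {..n}. bin_weight n p j"
  let ?f = "int_sol n p ?H" and ?S = "{0..int n}" and ?b = "real n * p"
  define V where "V = (\<lambda>\<omega>. \<lfloor>W \<omega> + ?b\<rfloor>)"
  define R where "R = (\<lambda>\<omega>. \<sigma>2 * spline ramp ?f ?S (W \<omega> + ?b) - W \<omega> * spline quad_ramp ?f ?S (W \<omega> + ?b))"
  have [measurable]: "W \<in> borel_measurable M" unfolding W using rv by simp
  have V_meas[measurable]: "V \<in> M \<rightarrow>\<^sub>M count_space UNIV" unfolding V_def by measurable
  have W2: "integrable M (\<lambda>\<omega>. (W \<omega>)\<^sup>2)" and Wi: "integrable M W"
    and vW: "expectation (\<lambda>\<omega>. (W \<omega>)\<^sup>2) = \<sigma>2"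
    using W_square[OF prob J rv sq mean W subs indep1 indep2 \<eta> \<tau>]
      W_integrable[OF prob J rv sq mean W subs indep1 indep2 \<eta> \<tau>]
      variance_W[OF prob J rv sq mean W subs indep1 indep2 \<eta> \<tau>] \<sigma>2 by auto
  have "real n * t < 1" "real n > 4" using t n \<sigma>2 \<delta> by auto
  have "t < 1 / 4"
  proof -
    have "4 * t \<le> real n * t" using \<open>real n > 4\<close> t by (intro mult_right_mono) auto
    then show ?thesis using t by simp
  qed
  then have p01: "0 < p" "p < 1" using p t by auto
  have sup: "finite ?S" "\<And>k. k \<notin> ?S \<Longrightarrow> ?f k = 0" using int_sol_support[OF p01] by auto
  note pw = stein_pointwise_bound(1)[OF \<sigma>2(2) \<delta> n t p] and C = stein_pointwise_bound(2)[OF \<sigma>2(2) \<delta> n t p refl]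
  have sb: "smooth_bound l ?f (1 / \<sigma>2)"
  proof (cases "l = 1")
    case True
    then show ?thesis using int_sol_diff_bound[OF p01, where n=n and H="?H"] C by (auto simp: smooth_bound_def intro: order_trans)
  next
    case False
    \<comment> \<open>For negative \<open>k0\<close> the set on the left is empty, so the default
      value of \<open>nat\<close> does no harm.\<close>
    then have "?H = ?H \<inter> {nat k0}" using K by auto
    then have "\<bar>?f k\<bar> \<le> 1 / ((real n + 1) * p * (1 - p))" for k
      using int_sol_point_bound[OF p01, where n=n and H="?H" and j="nat k0" and k=k] by simp
    then show ?thesis using False C by (auto simp: smooth_bound_def intro: order_trans)
  qed
  have stein: "ennreal \<bar>expectation R\<bar> \<le> ennreal (1 / \<sigma>2) * (\<Sum>i\<in>J. theta M W l (\<xi> i) (\<eta> i) (\<tau> i))"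
    using local_dependence_stein_bound[OF prob J rv sq mean W subs indep1 indep2 \<eta> \<tau> l sup sb, of ?b]
    by (simp add: R_def \<sigma>2(1))
  have iR: "integrable M R"
  proof -
    have "integrable M (\<lambda>\<omega>. spline ramp ?f ?S (W \<omega> + ?b))"
      by (rule integrable_const_bound[where B="4 * (\<Sum>k\<in>?S. \<bar>?f k\<bar>)"]) (auto simp: spline_ramp_bound)
    moreover have "integrable M (\<lambda>\<omega>. W \<omega> * spline quad_ramp ?f ?S (W \<omega> + ?b))"
      using W2 Wi
      by (intro mult_spline_quad_ramp_integrable[OF prob J rv sq mean W subs indep1 indep2 \<eta> \<tau> l sup sb])
        (auto simp: power2_eq_square)
    ultimately show ?thesis unfolding R_def by auto
  qed
  have iI: "integrable M (\<lambda>\<omega>. indicator K (V \<omega>) :: real)"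
    by (rule integrable_const_bound[where B=1]) (auto simp: indicator_def)
  define E where "E = (\<lambda>\<omega>. (1 / \<sigma>2) * (1 / 4 + t * ((W \<omega>)\<^sup>2 + 1) / 2) + 4 / (real n)\<^sup>2 * (W \<omega>)\<^sup>2)"
  have iE: "integrable M E" unfolding E_def using W2 by auto
  have eE: "expectation E = (1 / \<sigma>2) * (1 / 4 + t * (\<sigma>2 + 1) / 2) + 4 / (real n)\<^sup>2 * \<sigma>2"
    unfolding E_def using W2 by (simp add: vW prob_space)
  have le: "AE \<omega> in M. \<bar>indicator K (V \<omega>) - ?P - R \<omega>\<bar> \<le> E \<omega>"
    using lat
  proof eventually_elim
    case (elim \<omega>)
    \<comment> \<open>On this event the spline and its derivative are evaluated at an integer, where
      they reproduce the average and the increment of the solution.\<close>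
    then have V: "W \<omega> + ?b = of_int (V \<omega>)" unfolding V_def by (auto elim!: Ints_cases)
    have "spline ramp ?f ?S (of_int (V \<omega>)) = ?f (V \<omega> + 1) - ?f (V \<omega>)"
      by (rule spline_ramp_int) (use sup in auto)
    moreover have "spline quad_ramp ?f ?S (of_int (V \<omega>)) = (?f (V \<omega>) + ?f (V \<omega> + 1)) / 2"
      by (rule spline_quad_ramp_int) (use sup in auto)
    ultimately have "R \<omega> = \<sigma>2 * (?f (V \<omega> + 1) - ?f (V \<omega>)) - W \<omega> * ((?f (V \<omega>) + ?f (V \<omega> + 1)) / 2)"
      unfolding R_def V by simp
    then show ?case using pw[of "W \<omega>" "V \<omega>" K] V by (simp add: E_def)
  qed
  have "\<bar>expectation (\<lambda>\<omega>. indicator K (V \<omega>)) - ?P - expectation R\<bar> = \<bar>expectation (\<lambda>\<omega>. indicator K (V \<omega>) - ?P - R \<omega>)\<bar>"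
    using iI iR by (simp add: prob_space)
  also have "\<dots> \<le> expectation (\<lambda>\<omega>. \<bar>indicator K (V \<omega>) - ?P - R \<omega>\<bar>)" by (rule integral_abs_bound)
  also have "\<dots> \<le> expectation E"
    using iI iR iE le by (intro integral_mono_AE) auto
  \<comment> \<open>Three contributions of at most 1/4 each, in units of
    \<open>1 / \<sigma>2\<close>: the mismatch of variances, the shift \<open>t\<close> through
    \<open>t * \<sigma>2 \<le> 1/4\<close>, and the values outside the binomial support. Their total
    3/4 lies within 1.75.\<close>
  also have "expectation E \<le> (1 / \<sigma>2) * 1.75"
  proof -
    have "t * (\<sigma>2 + 1) / 2 \<le> t * \<sigma>2"
    proof -
      have "t * (\<sigma>2 + 1) \<le> t * (2 * \<sigma>2)" using t \<sigma>2 by (intro mult_left_mono) auto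
      then show ?thesis by simp
    qed
    also have "4 * (t * \<sigma>2) \<le> real n * t" using n \<delta> t by (simp add: algebra_simps)
    then have "t * \<sigma>2 \<le> 1 / 4" using t by simp
    finally have 1: "t * (\<sigma>2 + 1) / 2 \<le> 1 / 4" .
    have "(4 * \<sigma>2)\<^sup>2 \<le> (real n)\<^sup>2" using n \<delta> \<sigma>2 by (intro power_mono) auto
    then have "4 / (real n)\<^sup>2 * \<sigma>2 \<le> 4 / (4 * \<sigma>2)\<^sup>2 * \<sigma>2"
      using \<sigma>2(2) \<open>real n > 4\<close> by (intro mult_right_mono divide_left_mono mult_pos_pos) auto
    also have "\<dots> = (1 / \<sigma>2) * (1 / 4)" using \<sigma>2(2) by (simp add: power2_eq_square field_simps)
    finally have 2: "4 / (real n)\<^sup>2 * \<sigma>2 \<le> (1 / \<sigma>2) * (1 / 4)" .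
    have "(1 / \<sigma>2) * (1 / 4 + t * (\<sigma>2 + 1) / 2) \<le> (1 / \<sigma>2) * (1 / 4 + 1 / 4)"
      using 1 \<sigma>2(2) by (intro mult_left_mono) auto
    then have "expectation E \<le> (1 / \<sigma>2) * (1 / 4 + 1 / 4) + (1 / \<sigma>2) * (1 / 4)" unfolding eE using 2 by linarith
    also have "\<dots> \<le> (1 / \<sigma>2) * 1.75" using \<sigma>2(2) by (simp add: field_simps)
    finally show ?thesis .
  qed
  finally have "\<bar>expectation (\<lambda>\<omega>. indicator K (V \<omega>)) - ?P\<bar> \<le> \<bar>expectation R\<bar> + (1 / \<sigma>2) * 1.75" by linarith
  then have "ennreal \<bar>expectation (\<lambda>\<omega>. indicator K (V \<omega>)) - ?P\<bar> \<le> ennreal \<bar>expectation R\<bar> + ennreal (1 / \<sigma>2) * ennreal 1.75"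
    using \<sigma>2(2) by (subst ennreal_mult[symmetric], simp, simp, subst ennreal_plus[symmetric], simp, simp, intro ennreal_leI)
  also have "\<dots> \<le> ennreal (1 / \<sigma>2) * (\<Sum>i\<in>J. theta M W l (\<xi> i) (\<eta> i) (\<tau> i)) + ennreal (1 / \<sigma>2) * ennreal 1.75"
    by (intro add_right_mono stein)
  finally show ?thesis unfolding V_def distrib_left .
qed

lemma AE_sum_lattice:
  fixes \<xi> :: "'i \<Rightarrow> 'w \<Rightarrow> real"
  assumes "finite J" "\<And>i. i \<in> J \<Longrightarrow> AE \<omega> in M. \<xi> i \<omega> - a i \<in> \<int>"
  shows "AE \<omega> in M. (\<Sum>i\<in>J. \<xi> i \<omega>) - (\<Sum>i\<in>J. a i) \<in> \<int>"
proof -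
  have "AE \<omega> in M. \<forall>i\<in>J. \<xi> i \<omega> - a i \<in> \<int>" using assms by (intro AE_finite_allI)
  then show ?thesis by eventually_elim (auto simp: sum_subtractf[symmetric] intro!: Ints_sum)
qed

theorem theorem3p1:
  fixes M :: "'w measure" and J :: "'i set" and \<xi> :: "'i \<Rightarrow> 'w \<Rightarrow> real"
    and a :: "'i \<Rightarrow> real" and A B :: "'i \<Rightarrow> 'i set"
    and W :: "'w \<Rightarrow> real" and \<eta> \<tau> :: "'i \<Rightarrow> 'w \<Rightarrow> real"
    and \<sigma>2 \<delta> t :: real
  assumes prob: "prob_space M"
    and J: "finite J"
    and rv: "\<And>i. i \<in> J \<Longrightarrow> \<xi> i \<in> borel_measurable M"
    and sq: "\<And>i. i \<in> J \<Longrightarrow> integrable M (\<lambda>\<omega>. (\<xi> i \<omega>)\<^sup>2)"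
    and mean: "\<And>i. i \<in> J \<Longrightarrow> prob_space.expectation M (\<xi> i) = 0"
    and lattice: "\<And>i. i \<in> J \<Longrightarrow> AE \<omega> in M. \<xi> i \<omega> - a i \<in> \<int>"
    and W: "W = (\<lambda>\<omega>. \<Sum>i\<in>J. \<xi> i \<omega>)"
    and \<sigma>2: "\<sigma>2 = prob_space.variance M W"
    and \<sigma>2_gt: "\<sigma>2 > 1"
    and \<delta>: "\<delta> = frac (- 4 * \<sigma>2)"
    and t: "t = frac ((\<Sum>i\<in>J. a i) + 2 * \<sigma>2 + \<delta> / 2) / (4 * \<sigma>2 + \<delta>)"
    and subs: "\<And>i. i \<in> J \<Longrightarrow> A i \<subseteq> B i \<and> B i \<subseteq> J"
    and indep1: "\<And>i. i \<in> J \<Longrightarrow> indep_subfamilies M \<xi> {i} (J - A i)"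
    and indep2: "\<And>i. i \<in> J \<Longrightarrow> indep_subfamilies M \<xi> (A i) (J - B i)"
    and \<eta>: "\<eta> = (\<lambda>i \<omega>. \<Sum>j\<in>A i. \<xi> j \<omega>)"
    and \<tau>: "\<tau> = (\<lambda>i \<omega>. \<Sum>j\<in>B i. \<xi> j \<omega>)"
  shows "\<forall>l\<in>{1, 2}.
      ennreal (dist_l l (distr M borel W) (centered_binomial (nat \<lceil>4 * \<sigma>2\<rceil>) (1/2 - t)))
        \<le> ennreal (1 / \<sigma>2) * ((\<Sum>i\<in>J. theta M W l (\<xi> i) (\<eta> i) (\<tau> i)) + ennreal 1.75)
    \<and> (\<forall>i\<in>J. \<forall>c::real.
        (AE \<omega> in M. D_norm l (cond_law M (family_space (B i)) (subfamily \<xi> (B i)) W \<omega>) \<le> c) \<longrightarrow>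
        theta M W l (\<xi> i) (\<eta> i) (\<tau> i) \<le> ennreal c *
          (ennreal (1/2) * (\<integral>\<^sup>+\<omega>. ennreal \<bar>\<xi> i \<omega> * (\<eta> i \<omega>)\<^sup>2\<bar> \<partial>M)
           + (\<integral>\<^sup>+\<omega>. ennreal \<bar>\<xi> i \<omega> * \<eta> i \<omega> * (\<tau> i \<omega> - \<eta> i \<omega>)\<bar> \<partial>M)
           + ennreal \<bar>\<integral>\<omega>. \<xi> i \<omega> * \<eta> i \<omega> \<partial>M\<bar> * (\<integral>\<^sup>+\<omega>. ennreal \<bar>\<tau> i \<omega>\<bar> \<partial>M)))"
proof (intro ballI conjI allI impI)
  interpret prob_space M by (rule prob)
  define n where "n = nat \<lceil>4 * \<sigma>2\<rceil>"
  define p where "p = 1/2 - t"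
  let ?a = "\<Sum>i\<in>J. a i"
  have latW: "AE \<omega> in M. W \<omega> - ?a \<in> \<int>" unfolding W by (rule AE_sum_lattice[OF J lattice])
  have \<delta>b: "0 \<le> \<delta>" "\<delta> < 1" unfolding \<delta> by (simp_all add: frac_lt_1)
  \<comment> \<open>Rounding up adds the fractional part of the negative, so \<open>n\<close> is
    exactly the denominator of \<open>t\<close>.\<close>
  have n: "real n = 4 * \<sigma>2 + \<delta>"
    using \<sigma>2_gt unfolding n_def \<delta> frac_def by (simp add: ceiling_def)
  have n0: "4 * \<sigma>2 + \<delta> > 0" using \<delta>b \<sigma>2_gt by simp
  have nt: "real n * t = frac (?a + 2 * \<sigma>2 + \<delta> / 2)" unfolding n using n0 by (simp add: t)
  have tb: "0 \<le> t" "real n * t < 1"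
    using n0 frac_lt_1 unfolding nt by (auto simp: t)
  have "real n * p = 2 * \<sigma>2 + \<delta> / 2 - frac (?a + 2 * \<sigma>2 + \<delta> / 2)"
    unfolding p_def nt[symmetric] by (simp add: n algebra_simps)
  \<comment> \<open>Here the choice of \<open>t\<close> takes effect: \<open>n * p\<close> is an
    integer minus the offset of \<open>W\<close>, so \<open>W + n * p\<close> is almost surely an
    integer.\<close>
  then have np: "real n * p = of_int \<lfloor>?a + 2 * \<sigma>2 + \<delta> / 2\<rfloor> - ?a" by (simp add: frac_def)
  have lat: "AE \<omega> in M. W \<omega> + real n * p \<in> \<int>"
    using latW
  proof eventually_elim
    case (elim \<omega>)
    have "W \<omega> + real n * p = (W \<omega> - ?a) + of_int \<lfloor>?a + 2 * \<sigma>2 + \<delta> / 2\<rfloor>" unfolding np by simp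
    then show ?case using elim by (simp only: Ints_add Ints_of_int)
  qed
  have p01: "0 \<le> p" "p \<le> 1"
  proof -
    have "t \<le> 1 / 4"
    proof -
      have "4 * t \<le> real n * t" using n \<delta>b \<sigma>2_gt tb by (intro mult_right_mono) auto
      then show ?thesis using tb by simp
    qed
    then show "0 \<le> p" "p \<le> 1" using tb by (auto simp: p_def)
  qed
  have [measurable]: "W \<in> borel_measurable M" unfolding W using rv by simp

  fix l :: nat assume l: "l \<in> {1, 2}"
  let ?R = "ennreal (1 / \<sigma>2) * ((\<Sum>i\<in>J. theta M W l (\<xi> i) (\<eta> i) (\<tau> i)) + ennreal 1.75)"
  have key: "ennreal \<bar>measure (distr M borel W) E - measure (centered_binomial n p) E\<bar> \<le> ?R"
    if E[measurable]: "E \<in> sets borel" and K: "l = 1 \<or> {k::int. of_int k - real n * p \<in> E} \<subseteq> {k0}" for E k0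
  proof -
    let ?K = "{k::int. of_int k - real n * p \<in> E}"
    have "measure (distr M borel W) E = expectation (\<lambda>\<omega>. indicator E (W \<omega>))"
      by (rule measure_distr_integral[OF prob]) simp_all
    also have "\<dots> = expectation (\<lambda>\<omega>. indicator ?K \<lfloor>W \<omega> + real n * p\<rfloor>)"
    proof (rule integral_cong_AE)
      show "AE \<omega> in M. indicator E (W \<omega>) = (indicator ?K \<lfloor>W \<omega> + real n * p\<rfloor> :: real)"
        using lat
      proof eventually_elim
        case (elim \<omega>)
        then obtain k where "W \<omega> + real n * p = of_int k" by (auto elim: Ints_cases)
        moreover from this have "W \<omega> = of_int k - real n * p" by simp
        ultimately show ?case by (simp add: indicator_def)
      qed
    qed measurable
    finally have 1: "measure (distr M borel W) E = expectation (\<lambda>\<omega>. indicator ?K \<lfloor>W \<omega> + real n * p\<rfloor>)" .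
    have 2: "measure (centered_binomial n p) E = (\<Sum>j\<in>{j. int j \<in> ?K} \<inter> {..n}. bin_weight n p j)"
      using measure_centered_binomial[OF p01 E, of n] by simp
    show ?thesis unfolding 1 2
      by (rule binomial_approx_on_set[OF prob J rv sq mean W subs indep1 indep2 \<eta> \<tau> \<sigma>2 \<sigma>2_gt \<delta>b n tb p_def lat l K])
  qed
  show "ennreal (dist_l l (distr M borel W) (centered_binomial (nat \<lceil>4 * \<sigma>2\<rceil>) (1/2 - t))) \<le> ?R"
    unfolding n_def[symmetric] p_def[symmetric]
  proof (cases "l = 1")
    case True
    have "ennreal (d_TV (distr M borel W) (centered_binomial n p)) \<le> ?R"
      unfolding d_TV_def
    proof (rule ennreal_SUP_le)
      show "sets (borel :: real measure) \<noteq> {}" using sets.top by blast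
      show "ennreal \<bar>measure (distr M borel W) E - measure (centered_binomial n p) E\<bar> \<le> ?R"
        if "E \<in> sets borel" for E by (rule key[OF that disjI1[OF True]])
    qed simp
    then show "ennreal (dist_l l (distr M borel W) (centered_binomial n p)) \<le> ?R" using True by (simp add: dist_l_def)
  next
    case False
    have "ennreal (d_loc (distr M borel W) (centered_binomial n p)) \<le> ?R"
      unfolding d_loc_def
    proof (rule ennreal_SUP_le)
      fix x :: real
      \<comment> \<open>A half-open interval of length one contains exactly one integer after
        translation, its rounded-up left end; this is why the local distance needs only solutions
        for single points.\<close>
      have "{k::int. of_int k - real n * p \<in> {x..<x + 1}} \<subseteq> {\<lceil>x + real n * p\<rceil>}"
        by (auto simp: ceiling_eq_iff[THEN sym] intro!: ceiling_unique[symmetric])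
      then show "ennreal \<bar>measure (distr M borel W) {x..<x+1} - measure (centered_binomial n p) {x..<x+1}\<bar> \<le> ?R"
        by (intro key[OF _ disjI2]) auto
    qed auto
    then show "ennreal (dist_l l (distr M borel W) (centered_binomial n p)) \<le> ?R" using False by (simp add: dist_l_def)
  qed
next
  interpret prob_space M by (rule prob)
  fix l :: nat and i c
  assume l: "l \<in> {1, 2}" and i: "i \<in> J"
    and c: "AE \<omega> in M. D_norm l (cond_law M (family_space (B i)) (subfamily \<xi> (B i)) W \<omega>) \<le> c"
  have latW: "AE \<omega> in M. W \<omega> - (\<Sum>i\<in>J. a i) \<in> \<int>" unfolding W by (rule AE_sum_lattice[OF J lattice])
  show "theta M W l (\<xi> i) (\<eta> i) (\<tau> i) \<le> ennreal c *
          (ennreal (1/2) * (\<integral>\<^sup>+\<omega>. ennreal \<bar>\<xi> i \<omega> * (\<eta> i \<omega>)\<^sup>2\<bar> \<partial>M)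
           + (\<integral>\<^sup>+\<omega>. ennreal \<bar>\<xi> i \<omega> * \<eta> i \<omega> * (\<tau> i \<omega> - \<eta> i \<omega>)\<bar> \<partial>M)
           + ennreal \<bar>\<integral>\<omega>. \<xi> i \<omega> * \<eta> i \<omega> \<partial>M\<bar> * (\<integral>\<^sup>+\<omega>. ennreal \<bar>\<tau> i \<omega>\<bar> \<partial>M))"
    by (rule theta_le_constant[OF prob J rv sq mean latW W subs indep1 indep2 \<eta> \<tau> l i c])
qed

end
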